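(* Let $d,N\geq 1$ be integers, $\boldsymbol{x}=(x_1,\dots,x_d)$ coordinates on $(\mathbb{C}^d,\boldsymbol{0})$ and $\boldsymbol{y}=(y_1,\dots,y_N)\in\mathbb{C}^N$. Let $P\in\mathbb{C}\{\boldsymbol{x}\}\setminus\{0\}$ with $P(\boldsymbol{0})=0$, let $L=a_1(\boldsymbol{x})\partial_{x_1}+\cdots+a_d(\boldsymbol{x})\partial_{x_d}$ with $a_1,\dots,a_d\in\mathbb{C}\{\boldsymbol{x}\}$ not all identically zero, and let $F$ be a $\mathbb{C}^N$-valued holomorphic map defined near $(\boldsymbol{0},\boldsymbol{0})\in\mathbb{C}^d\times\mathbb{C}^N$. Assume that $F(\boldsymbol{0},\boldsymbol{0})=\boldsymbol{0}$, that $\mu:=\frac{\partial F}{\partial\boldsymbol{y}}(\boldsymbol{0},\boldsymbol{0})$ is an invertible matrix, and that $L(P)(\boldsymbol{0})\neq 0$. If $\mu-n\,L(P)(\boldsymbol{0})\,I_N$ is invertible for all $n\in\mathbb{N}$, then the system of partial differential equations $$P(\boldsymbol{x})\,L(\boldsymbol{y})(\boldsymbol{x})=F(\boldsymbol{x},\boldsymbol{y})$$ has a unique analytic solution at the origin $\widehat{\boldsymbol{y}}\in\mathbb{C}\{\boldsymbol{x}\}^N$ with $\widehat{\boldsymbol{y}}(\boldsymbol{0})=\boldsymbol{0}$.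
   Context: $\mathbb{C}\{\boldsymbol{x}\}$ denotes the ring of convergent power series in $\boldsymbol{x}=(x_1,\dots,x_d)$ with complex coefficients. $\mathbb{N}$ is the set of natural numbers including $0$, and $I_N$ is the identity matrix of size $N$. The operator $L$ acts on vectors componentwise. *)

theory Defs
  imports "HOL-Analysis.Analysis"
begin

text \<open>
  Power series in the variables \<open>x\<^sub>i\<close>, \<open>i :: 'd\<close>, are coefficient families indexed by
  multi-indices \<open>\<alpha> :: nat ^ 'd\<close>, so that equality of series is equality of coefficients.
\<close>

type_synonym 'd mseries = "nat ^ 'd \<Rightarrow> complex"

definition monom_at :: "complex ^ 'd \<Rightarrow> nat ^ 'd \<Rightarrow> complex" where
  "monom_at x \<alpha> = (\<Prod>i\<in>UNIV. (x $ i) ^ (\<alpha> $ i))"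

text \<open>The underlying set of the ring of convergent power series at the origin.\<close>

definition conv_series :: "('d::finite) mseries set" where
  "conv_series = {f. \<exists>r>0. \<forall>x :: complex ^ 'd. (\<forall>i. norm (x $ i) < r) \<longrightarrow>
     (\<lambda>\<alpha>. f \<alpha> * monom_at x \<alpha>) summable_on UNIV}"

definition ms_eval :: "('d::finite) mseries \<Rightarrow> complex ^ 'd \<Rightarrow> complex" where
  "ms_eval f x = (\<Sum>\<^sub>\<infinity>\<alpha>. f \<alpha> * monom_at x \<alpha>)"

definition ms_mult :: "('d::finite) mseries \<Rightarrow> 'd mseries \<Rightarrow> 'd mseries" where
  "ms_mult f g = (\<lambda>\<alpha>. \<Sum>(\<beta>, \<gamma>) | \<beta> + \<gamma> = \<alpha>. f \<beta> * g \<gamma>)"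

lemma finite_multiindex_decompositions:
  "finite {(\<beta>, \<gamma>). \<beta> + \<gamma> = (\<alpha> :: nat ^ 'd::finite)}"
proof -
  have fin: "finite {\<beta> :: nat ^ 'd. \<forall>i. \<beta> $ i \<in> {..\<alpha> $ i}}"
  proof (rule finite_subset)
    show "{\<beta> :: nat ^ 'd. \<forall>i. \<beta> $ i \<in> {..\<alpha> $ i}}
        \<subseteq> vec_lambda ` (PiE UNIV (\<lambda>i. {..\<alpha> $ i}))"
    proof
      fix \<beta> :: "nat ^ 'd"
      assume "\<beta> \<in> {\<beta>. \<forall>i. \<beta> $ i \<in> {..\<alpha> $ i}}"
      then have "vec_nth \<beta> \<in> PiE UNIV (\<lambda>i. {..\<alpha> $ i})" by auto
      moreover have "\<beta> = vec_lambda (vec_nth \<beta>)" by simp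
      ultimately show "\<beta> \<in> vec_lambda ` (PiE UNIV (\<lambda>i. {..\<alpha> $ i}))" by (metis image_eqI)
    qed
  qed (intro finite_imageI finite_PiE; simp)
  show ?thesis
    by (rule finite_subset[OF _ finite_cartesian_product[OF fin fin]]) auto
qed

definition ms_pderiv :: "'d \<Rightarrow> ('d::finite) mseries \<Rightarrow> 'd mseries" where
  "ms_pderiv j f = (\<lambda>\<alpha>. of_nat (\<alpha> $ j + 1) * f (\<alpha> + axis j 1))"

text \<open>The derivation \<open>\<Sum>\<^sub>j a\<^sub>j \<partial>\<^sub>j\<close> on power series.\<close>

definition vfield :: "('d \<Rightarrow> 'd mseries) \<Rightarrow> ('d::finite) mseries \<Rightarrow> 'd mseries" where
  "vfield a f = (\<lambda>\<alpha>. \<Sum>j\<in>UNIV. ms_mult (a j) (ms_pderiv j f) \<alpha>)"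

text \<open>
  Holomorphy in several complex variables: Frechet differentiability with a derivative that is
  linear over the complex numbers (additivity and real linearity are part of
  \<open>has_derivative\<close>).
\<close>

definition holomorphic_map_on ::
    "((complex ^ 'd) \<times> (complex ^ 'n) \<Rightarrow> complex ^ 'm) \<Rightarrow> ((complex ^ ('d::finite)) \<times> (complex ^ ('n::finite))) set \<Rightarrow> bool" where
  "holomorphic_map_on F U \<longleftrightarrow> open U \<and>
     (\<forall>z\<in>U. \<exists>D. (F has_derivative D) (at z) \<and>
        (\<forall>c v w. D (c *s v, c *s w) = c *s D (v, w)))"

text \<open>The matrix of partial derivatives with respect to the second group of variables.\<close>

definition jacobian_snd ::
    "((complex ^ 'd) \<times> (complex ^ 'n) \<Rightarrow> complex ^ 'm) \<Rightarrow> (complex ^ 'd) \<times> (complex ^ 'n) \<Rightarrow> complex ^ 'n ^ 'm" where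
  "jacobian_snd F z = (\<chi> i j. deriv (\<lambda>t. F (fst z, snd z + axis j t) $ i) 0)"

text \<open>
  A solution is an identity of functions near the origin: for \<open>y\<close> vanishing at the origin the
  points \<open>(x, y(x))\<close> lie in the domain of \<open>F\<close> for \<open>x\<close> close to \<open>0\<close>. The operator acts
  componentwise.
\<close>

definition analytic_solution ::
    "('d::finite) mseries \<Rightarrow> ('d \<Rightarrow> 'd mseries) \<Rightarrow> ((complex ^ 'd) \<times> (complex ^ 'n) \<Rightarrow> complex ^ ('n::finite)) \<Rightarrow>
     'd mseries ^ 'n \<Rightarrow> bool" where
  "analytic_solution P a F y \<longleftrightarrow>
     (\<forall>i. y $ i \<in> conv_series) \<and>
     (\<forall>\<^sub>F x in nhds 0. \<forall>i.
        ms_eval P x * ms_eval (vfield a (y $ i)) x = F (x, \<chi> k. ms_eval (y $ k) x) $ i)"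

end

theory Submission
  imports Defs "HOL-Complex_Analysis.Conformal_Mappings"
begin

text \<open>
  Put \<open>u = L(P)\<close>, which does not vanish near the origin, and \<open>b = a / u\<close>. Along the integral curves of
  the vector field \<open>b\<close> the function \<open>P\<close> grows at unit speed, and the system says that
  \<open>P \<cdot> (dy/dt) = F(x, y) / u\<close> along each of them. Its linear part in \<open>y\<close> at the origin is \<open>\<nu> = \<mu> / u(0)\<close>,
  and the hypothesis is that \<open>n - \<nu>\<close> is invertible for every natural number \<open>n\<close>.

  In the model case the equation is \<open>s v' = \<nu> v + h(s, v)\<close> with one variable \<open>s\<close> and a small nonlinearity
  \<open>h\<close>. The operator \<open>s d/ds - \<nu>\<close> multiplies the coefficient of \<open>s\<^sup>n\<close> by \<open>n - \<nu>\<close>. Its inverse is bounded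
  in the supremum norm on discs, uniformly in the radius (\<open>euler_inv_bound\<close>), so on a small disc the
  equation is solved by contraction, holomorphically in parameters (\<open>briot_bouquet_parametric\<close>).
  Solutions are unique because the leading coefficient of a difference of two solutions is
  annihilated by \<open>n - \<nu>\<close> up to a small error (\<open>singular_equation_unique\<close>).

  The general case is reduced to the model without a change of coordinates, by a redundant family of
  model equations. Let \<open>\<Phi>\<^sub>t\<close> be the flow of \<open>b\<close>; it exists because \<open>\<Phi>\<^sub>t(x) = x + t \<Psi>\<close> turns the flow
  equation into a model equation with matrix \<open>-1\<close> (\<open>local_flow_exists\<close>). The point
  \<open>\<Gamma>(s, x) = \<Phi>\<^sub>t(x)\<close>, where \<open>t = s - P(x)\<close>, is the point on the integral curve through \<open>x\<close> at which \<open>P\<close> has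
  the value \<open>s\<close>. For every \<open>x\<close> near the origin, let \<open>Y(s, x)\<close> solve \<open>s \<partial>\<^sub>s Y = (F / u)(\<Gamma>(s, x), Y)\<close>. As
  \<open>\<Gamma>(s, x)\<close> depends only on the integral curve of \<open>x\<close>, so does \<open>Y(s, x)\<close>, by uniqueness. Therefore
  \<open>y(x) = Y(P(x), x)\<close> satisfies \<open>y(\<Phi>\<^sub>t(x)) = Y(P(x) + t, x)\<close>, and the derivative at \<open>t = 0\<close> is the system.
  Conversely, a solution \<open>y\<close> of the system gives the solution \<open>y(\<Gamma>(s, x))\<close> of the model equation, which is
  unique, and \<open>s = P(x)\<close> recovers \<open>y(x)\<close>.

  Power series enter through three facts: the chain rule along holomorphic curves
  (\<open>ms_eval_chain\<close>), the expansion of bounded separately holomorphic functions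
  (\<open>separately_holomorphic_conv_series\<close>) and the identity theorem (\<open>ms_eval_eq_0_imp_eq_0\<close>).
\<close>

section \<open>Convergent power series in several variables\<close>

definition mdeg :: "nat ^ 'd::finite \<Rightarrow> nat" where
  "mdeg \<alpha> = (\<Sum>i\<in>UNIV. \<alpha> $ i)"

lemma mdeg_add: "mdeg (\<alpha> + \<beta>) = mdeg \<alpha> + mdeg \<beta>"
  by (simp add: mdeg_def sum.distrib)

lemma mdeg_axis: "mdeg (axis j 1 :: nat ^ 'd::finite) = 1"
  by (simp add: mdeg_def axis_def)

lemma monom_at_add: "monom_at x (\<alpha> + \<beta>) = monom_at x \<alpha> * monom_at x \<beta>"
  by (simp add: monom_at_def power_add prod.distrib)

lemma norm_component_le: "norm v \<le> M \<Longrightarrow> norm (v $ i) \<le> M"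
  using Finite_Cartesian_Product.norm_nth_le order_trans by blast

lemma norm_component_less: "norm v < M \<Longrightarrow> norm (v $ i) < M"
  using Finite_Cartesian_Product.norm_nth_le le_less_trans by blast

lemma norm_monom_at_le:
  assumes "\<And>i. norm (x $ i) \<le> t"
  shows "norm (monom_at x \<alpha>) \<le> t ^ mdeg \<alpha>"
proof -
  have "norm (monom_at x \<alpha>) = (\<Prod>i\<in>UNIV. norm (x $ i) ^ (\<alpha> $ i))"
    by (simp add: monom_at_def prod_norm[symmetric] norm_power)
  also have "\<dots> \<le> (\<Prod>i\<in>UNIV. t ^ (\<alpha> $ i))"
    by (intro prod_mono conjI power_mono assms) auto
  also have "\<dots> = t ^ mdeg \<alpha>"
    by (simp add: mdeg_def power_sum)
  finally show ?thesis .
qed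

text \<open>Every finite set of multi-indices lies in a box, and over a box the sum is a product of geometric sums.\<close>

lemma summable_multi_geometric:
  fixes q :: real
  assumes "0 \<le> q" "q < 1"
  shows "(\<lambda>\<alpha> :: nat ^ 'd::finite. q ^ mdeg \<alpha>) summable_on UNIV"
proof (rule nonneg_bdd_above_summable_on)
  show "bdd_above (sum (\<lambda>\<alpha> :: nat ^ 'd. q ^ mdeg \<alpha>) ` {F. F \<subseteq> UNIV \<and> finite F})"
  proof (rule bdd_aboveI2)
    fix A :: "(nat ^ 'd) set" assume "A \<in> {F. F \<subseteq> UNIV \<and> finite F}"
    then have fin: "finite A" by simp
    define m where "m = Max (insert 0 (mdeg ` A))"
    have m: "\<alpha> $ i \<le> m" if "\<alpha> \<in> A" for \<alpha> i
    proof -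
      have "\<alpha> $ i \<le> mdeg \<alpha>"
        unfolding mdeg_def by (rule member_le_sum) auto
      also have "\<dots> \<le> m"
        unfolding m_def using fin that by (intro Max_ge) auto
      finally show ?thesis .
    qed
    have "(\<Sum>\<alpha>\<in>A. q ^ mdeg \<alpha>) = (\<Sum>g\<in>vec_nth ` A. \<Prod>i\<in>UNIV. q ^ (g i))"
      by (subst sum.reindex) (auto simp: inj_on_def vec_eq_iff mdeg_def power_sum fun_eq_iff)
    also have "\<dots> \<le> (\<Sum>g\<in>PiE (UNIV :: 'd set) (\<lambda>_. {..m}). \<Prod>i\<in>UNIV. q ^ (g i))"
    proof (rule sum_mono2)
      show "vec_nth ` A \<subseteq> PiE (UNIV :: 'd set) (\<lambda>_. {..m})" using m by auto
    qed (use assms in \<open>auto intro!: prod_nonneg finite_PiE\<close>)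
    also have "\<dots> = (\<Prod>i\<in>(UNIV::'d set). \<Sum>k\<le>m. q ^ k)"
      by (subst prod_sum_PiE) auto
    also have "\<dots> \<le> (\<Prod>i\<in>(UNIV::'d set). 1 / (1 - q))"
    proof (intro prod_mono conjI)
      have "(\<Sum>k\<le>m. q ^ k) = (1 - q ^ Suc m) / (1 - q)"
        using assms sum_gp0[of q m] by auto
      also have "\<dots> \<le> 1 / (1 - q)"
        using assms by (intro divide_right_mono) auto
      finally show "(\<Sum>k\<le>m. q ^ k) \<le> 1 / (1 - q)" .
    qed (use assms in \<open>auto intro!: sum_nonneg\<close>)
    finally show "(\<Sum>\<alpha>\<in>A. q ^ mdeg \<alpha>) \<le> (\<Prod>i\<in>(UNIV::'d set). 1 / (1 - q))" .
  qed
qed (use assms in auto)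

lemma bounded_coeffs_abs_summable:
  fixes f :: "('d::finite) mseries"
  assumes "0 < r" and f: "\<And>\<alpha>. norm (f \<alpha>) * r ^ mdeg \<alpha> \<le> C"
    and t: "0 \<le> t" "t < r"
  shows "(\<lambda>\<alpha>. norm (f \<alpha>) * t ^ mdeg \<alpha>) summable_on UNIV"
proof -
  have "(\<lambda>\<alpha> :: nat ^ 'd. C * (t / r) ^ mdeg \<alpha>) summable_on UNIV"
    using t by (intro summable_on_cmult_right summable_multi_geometric) auto
  then have "(\<lambda>\<alpha>. norm (norm (f \<alpha>) * t ^ mdeg \<alpha>)) summable_on UNIV"
  proof (rule Infinite_Sum.abs_summable_on_comparison_test')
    fix \<alpha>
    have "norm (f \<alpha>) * t ^ mdeg \<alpha> = norm (f \<alpha>) * r ^ mdeg \<alpha> * (t / r) ^ mdeg \<alpha>"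
      using assms by (simp add: power_divide)
    also have "\<dots> \<le> C * (t / r) ^ mdeg \<alpha>"
      using t \<open>0 < r\<close> by (intro mult_right_mono f) auto
    finally show "norm (norm (f \<alpha>) * t ^ mdeg \<alpha>) \<le> C * (t / r) ^ mdeg \<alpha>"
      using t by simp
  qed
  then show ?thesis using t by simp
qed

lemma bounded_coeffs_has_sum:
  fixes f :: "('d::finite) mseries"
  assumes "0 < r" and f: "\<And>\<alpha>. norm (f \<alpha>) * r ^ mdeg \<alpha> \<le> C"
    and x: "\<And>i. norm (x $ i) < r"
  shows "(\<lambda>\<alpha>. norm (f \<alpha> * monom_at x \<alpha>)) summable_on UNIV"
    and "((\<lambda>\<alpha>. f \<alpha> * monom_at x \<alpha>) has_sum ms_eval f x) UNIV"
proof -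
  define t where "t = Max (range (\<lambda>i. norm (x $ i)))"
  have t1: "norm (x $ i) \<le> t" for i
    unfolding t_def by (rule Max_ge) auto
  have "t < r" unfolding t_def using x by (subst Max_less_iff) auto
  moreover have "0 \<le> t" using t1[of undefined] norm_ge_zero order_trans by blast
  ultimately have "(\<lambda>\<alpha>. norm (f \<alpha>) * t ^ mdeg \<alpha>) summable_on UNIV"
    using assms by (intro bounded_coeffs_abs_summable) auto
  then show *: "(\<lambda>\<alpha>. norm (f \<alpha> * monom_at x \<alpha>)) summable_on UNIV"
    by (rule Infinite_Sum.abs_summable_on_comparison_test')
       (auto simp: norm_mult intro!: mult_left_mono norm_monom_at_le t1)
  show "((\<lambda>\<alpha>. f \<alpha> * monom_at x \<alpha>) has_sum ms_eval f x) UNIV"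
    unfolding ms_eval_def by (rule has_sum_infsum[OF abs_summable_summable[OF *]])
qed

text \<open>All later estimates use this form of convergence, Cauchy bounds for the coefficients.\<close>

lemma conv_series_iff_bounded_coeffs:
  fixes f :: "('d::finite) mseries"
  shows "f \<in> conv_series \<longleftrightarrow> (\<exists>r>0. \<exists>C. \<forall>\<alpha>. norm (f \<alpha>) * r ^ mdeg \<alpha> \<le> C)"
proof
  assume "f \<in> conv_series"
  then obtain r where r: "r > 0" "\<And>x :: complex ^ 'd. (\<forall>i. norm (x $ i) < r) \<Longrightarrow>
     (\<lambda>\<alpha>. f \<alpha> * monom_at x \<alpha>) summable_on UNIV"
    unfolding conv_series_def by blast
  define x :: "complex ^ 'd" where "x = (\<chi> i. of_real (r / 2))"
  have "(\<lambda>\<alpha>. norm (f \<alpha> * monom_at x \<alpha>)) summable_on UNIV"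
    using r by (subst summable_on_iff_abs_summable_on_complex[symmetric]) (auto simp: x_def)
  moreover have "norm (f \<alpha> * monom_at x \<alpha>) = norm (f \<alpha>) * (r / 2) ^ mdeg \<alpha>" for \<alpha>
    using \<open>r > 0\<close> by (simp add: x_def monom_at_def norm_mult mdeg_def power_sum prod_norm[symmetric] norm_power)
  ultimately have s: "(\<lambda>\<alpha>. norm (f \<alpha>) * (r / 2) ^ mdeg \<alpha>) summable_on UNIV"
    by simp
  have "norm (f \<alpha>) * (r / 2) ^ mdeg \<alpha> \<le> (\<Sum>\<^sub>\<infinity>\<alpha>. norm (f \<alpha>) * (r / 2) ^ mdeg \<alpha>)" for \<alpha>
    using finite_sum_le_infsum[OF s, of "{\<alpha>}"] \<open>r > 0\<close> by simp
  then show "\<exists>r>0. \<exists>C. \<forall>\<alpha>. norm (f \<alpha>) * r ^ mdeg \<alpha> \<le> C"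
    using \<open>r > 0\<close> by (intro exI[of _ "r / 2"]) auto
next
  assume "\<exists>r>0. \<exists>C. \<forall>\<alpha>. norm (f \<alpha>) * r ^ mdeg \<alpha> \<le> C"
  then show "f \<in> conv_series"
    unfolding conv_series_def mem_Collect_eq
    by (elim exE conjE) (metis abs_summable_summable[OF bounded_coeffs_has_sum(1)])
qed

text \<open>Halving the radius absorbs the factor \<open>\<alpha>\<^sub>j + 1 \<le> 2\<^sup>|\<^sup>\<alpha>\<^sup>|\<close> that differentiation produces.\<close>

lemma pderiv_bounded_coeffs:
  fixes f :: "('d::finite) mseries"
  assumes "0 < r" and f: "\<And>\<alpha>. norm (f \<alpha>) * r ^ mdeg \<alpha> \<le> C"
  shows "norm (ms_pderiv j f \<alpha>) * (r / 2) ^ mdeg \<alpha> \<le> C / r"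
proof -
  have "\<alpha> $ j \<le> mdeg \<alpha>"
    unfolding mdeg_def by (rule member_le_sum) auto
  then have "real (\<alpha> $ j + 1) \<le> 2 ^ mdeg \<alpha>"
  proof -
    have "\<alpha> $ j + 1 \<le> 2 ^ mdeg \<alpha>"
      using \<open>\<alpha> $ j \<le> mdeg \<alpha>\<close> less_exp[of "mdeg \<alpha>"] by linarith
    then have "real (\<alpha> $ j + 1) \<le> real (2 ^ mdeg \<alpha>)"
      by (rule of_nat_mono)
    then show ?thesis by simp
  qed
  have "norm (ms_pderiv j f \<alpha>) * (r / 2) ^ mdeg \<alpha>
      = real (\<alpha> $ j + 1) / 2 ^ mdeg \<alpha> * (norm (f (\<alpha> + axis j 1)) * r ^ mdeg (\<alpha> + axis j 1) / r)"
  proof -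
    have "norm (of_nat (\<alpha> $ j + 1) :: complex) = real (\<alpha> $ j + 1)"
      by (rule norm_of_nat)
    then show ?thesis
      using \<open>0 < r\<close> unfolding ms_pderiv_def mdeg_add mdeg_axis norm_mult power_divide by simp
  qed
  also have "\<dots> \<le> 1 * (C / r)"
    using \<open>real (\<alpha> $ j + 1) \<le> 2 ^ mdeg \<alpha>\<close> \<open>0 < r\<close>
    by (intro mult_mono divide_right_mono f) auto
  finally show ?thesis by simp
qed

lemma pderiv_conv_series: "f \<in> conv_series \<Longrightarrow> ms_pderiv j f \<in> conv_series"
proof -
  assume "f \<in> conv_series"
  then obtain r C where "0 < r" "\<And>\<alpha>. norm (f \<alpha>) * r ^ mdeg \<alpha> \<le> C"
    unfolding conv_series_iff_bounded_coeffs by blast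
  then show "ms_pderiv j f \<in> conv_series"
    unfolding conv_series_iff_bounded_coeffs
    using pderiv_bounded_coeffs[of r f C j] by (intro exI[of _ "r / 2"] conjI exI[of _ "C / r"]) auto
qed

lemma has_sum_finite_sum:
  fixes f :: "'i \<Rightarrow> 'a \<Rightarrow> 'b::topological_comm_monoid_add"
  assumes "\<And>i. i \<in> I \<Longrightarrow> (f i has_sum s i) A"
  shows "((\<lambda>x. \<Sum>i\<in>I. f i x) has_sum (\<Sum>i\<in>I. s i)) A"
  using assms by (induction I rule: infinite_finite_induct) (auto intro!: has_sum_add)

text \<open>Multiplying the two absolutely convergent families and regrouping by total exponent.\<close>

lemma mult_has_sum:
  fixes f g :: "('d::finite) mseries"
  assumes f: "(\<lambda>\<alpha>. norm (f \<alpha> * monom_at x \<alpha>)) summable_on UNIV"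
    and g: "(\<lambda>\<alpha>. norm (g \<alpha> * monom_at x \<alpha>)) summable_on UNIV"
  shows "((\<lambda>\<alpha>. ms_mult f g \<alpha> * monom_at x \<alpha>) has_sum (ms_eval f x * ms_eval g x)) UNIV"
proof -
  let ?h = "\<lambda>(\<beta>, \<gamma>). (f \<beta> * monom_at x \<beta>) * (g \<gamma> * monom_at x \<gamma>)"
  have fs: "((\<lambda>\<alpha>. f \<alpha> * monom_at x \<alpha>) has_sum ms_eval f x) UNIV"
    and gs: "((\<lambda>\<alpha>. g \<alpha> * monom_at x \<alpha>) has_sum ms_eval g x) UNIV"
    unfolding ms_eval_def using f g by (auto intro!: has_sum_infsum abs_summable_summable)
  have "(\<lambda>p. norm (?h p)) summable_on (UNIV \<times> UNIV)"
    unfolding Infinite_Sum.abs_summable_on_Sigma_iff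
  proof (intro conjI ballI)
    fix \<beta> show "(\<lambda>\<gamma>. norm (?h (\<beta>, \<gamma>))) summable_on UNIV"
      using summable_on_cmult_right[OF g, of "norm (f \<beta> * monom_at x \<beta>)"] by (simp add: norm_mult)
  next
    have "(\<lambda>\<beta>. norm (f \<beta> * monom_at x \<beta>) * (\<Sum>\<^sub>\<infinity>\<gamma>. norm (g \<gamma> * monom_at x \<gamma>))) summable_on UNIV"
      by (intro summable_on_cmult_left f)
    also have "(\<lambda>\<beta>. norm (f \<beta> * monom_at x \<beta>) * (\<Sum>\<^sub>\<infinity>\<gamma>. norm (g \<gamma> * monom_at x \<gamma>)))
        = (\<lambda>\<beta>. \<Sum>\<^sub>\<infinity>\<gamma>. norm (?h (\<beta>, \<gamma>)))"
      using g by (subst infsum_cmult_right[symmetric]) (auto simp: norm_mult)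
    finally show "(\<lambda>\<beta>. norm (\<Sum>\<^sub>\<infinity>\<gamma>. norm (?h (\<beta>, \<gamma>)))) summable_on UNIV"
      by (rule iffD1[OF summable_on_iff_abs_summable_on_real])
  qed
  then have sm: "?h summable_on (UNIV \<times> UNIV)" by (rule abs_summable_summable)
  have h1: "(?h has_sum (ms_eval f x * ms_eval g x)) (UNIV \<times> UNIV)"
  proof (rule has_sum_SigmaI[OF _ _ sm])
    show "((\<lambda>\<gamma>. ?h (\<beta>, \<gamma>)) has_sum (f \<beta> * monom_at x \<beta> * ms_eval g x)) UNIV" for \<beta>
      using has_sum_cmult_right[OF gs] by simp
    show "((\<lambda>\<beta>. f \<beta> * monom_at x \<beta> * ms_eval g x) has_sum (ms_eval f x * ms_eval g x)) UNIV"
      by (rule has_sum_cmult_left[OF fs])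
  qed
  let ?D = "\<lambda>\<alpha>. {(\<beta>, \<gamma>). \<beta> + \<gamma> = (\<alpha> :: nat ^ 'd)}"
  have h2: "((\<lambda>(\<alpha>, p). ?h p) has_sum (ms_eval f x * ms_eval g x)) (Sigma UNIV ?D)"
    by (rule iffD1[OF has_sum_reindex_bij_witness[where i = snd and j = "\<lambda>p. (fst p + snd p, p)"] h1])
       auto
  show ?thesis
  proof (rule has_sum_SigmaD[OF h2])
    fix \<alpha> :: "nat ^ 'd"
    have "((\<lambda>p. ?h p) has_sum (\<Sum>p\<in>?D \<alpha>. ?h p)) (?D \<alpha>)"
      by (rule has_sum_finite[OF finite_multiindex_decompositions])
    also have "(\<Sum>p\<in>?D \<alpha>. ?h p) = ms_mult f g \<alpha> * monom_at x \<alpha>"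
      unfolding ms_mult_def sum_distrib_right
      by (intro sum.cong) (auto simp: monom_at_add mult_ac)
    finally show "((\<lambda>p. case (\<alpha>, p) of (\<alpha>, p) \<Rightarrow> ?h p) has_sum (ms_mult f g \<alpha> * monom_at x \<alpha>)) (?D \<alpha>)"
      by simp
  qed
qed

lemma vfield_has_sum:
  fixes f :: "('d::finite) mseries"
  assumes "0 < r" and f: "\<And>\<alpha>. norm (f \<alpha>) * r ^ mdeg \<alpha> \<le> C"
    and a: "\<And>j \<alpha>. norm (a j \<alpha>) * r ^ mdeg \<alpha> \<le> C"
    and x: "\<And>i. norm (x $ i) < r / 2"
  shows "((\<lambda>\<alpha>. vfield a f \<alpha> * monom_at x \<alpha>) has_sum
      (\<Sum>j\<in>UNIV. ms_eval (a j) x * ms_eval (ms_pderiv j f) x)) UNIV"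
proof -
  have x': "norm (x $ i) < r" for i
    using x[of i] \<open>0 < r\<close> by linarith
  have "((\<lambda>\<alpha>. ms_mult (a j) (ms_pderiv j f) \<alpha> * monom_at x \<alpha>) has_sum
      (ms_eval (a j) x * ms_eval (ms_pderiv j f) x)) UNIV" for j
    by (rule mult_has_sum[OF bounded_coeffs_has_sum(1)[OF \<open>0 < r\<close> a x']
          bounded_coeffs_has_sum(1)[OF _ pderiv_bounded_coeffs[OF \<open>0 < r\<close> f] x]])
       (use \<open>0 < r\<close> in auto)
  then have "((\<lambda>\<alpha>. \<Sum>j\<in>UNIV. ms_mult (a j) (ms_pderiv j f) \<alpha> * monom_at x \<alpha>) has_sum
      (\<Sum>j\<in>UNIV. ms_eval (a j) x * ms_eval (ms_pderiv j f) x)) UNIV"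
    by (intro has_sum_finite_sum) auto
  then show ?thesis
    by (simp add: vfield_def sum_distrib_right)
qed

text \<open>For \<open>\<alpha>\<^sub>j = 0\<close> the truncated exponent \<open>\<alpha>\<^sub>j - 1\<close> is harmless, as the term has the factor \<open>\<alpha>\<^sub>j\<close>.\<close>

lemma monom_at_chain:
  fixes \<gamma> :: "complex \<Rightarrow> complex ^ 'd::finite"
  assumes "\<And>i. ((\<lambda>t. \<gamma> t $ i) has_field_derivative \<gamma>' i) (at t)"
  shows "((\<lambda>t. monom_at (\<gamma> t) \<alpha>) has_field_derivative
      (\<Sum>j\<in>UNIV. \<gamma>' j * (of_nat (\<alpha> $ j) * (\<Prod>i\<in>UNIV. (\<gamma> t $ i) ^ (if i = j then \<alpha> $ i - 1 else \<alpha> $ i))))) (at t)"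
proof -
  have "((\<lambda>t. monom_at (\<gamma> t) \<alpha>) has_field_derivative
      (\<Sum>j\<in>UNIV. (of_nat (\<alpha> $ j) * (\<gamma>' j * (\<gamma> t $ j) ^ (\<alpha> $ j - 1))) *
        (\<Prod>i\<in>UNIV - {j}. (\<gamma> t $ i) ^ (\<alpha> $ i)))) (at t)"
    unfolding monom_at_def
    by (rule has_field_derivative_prod) (use DERIV_power[OF assms] in \<open>simp add: mult.assoc\<close>)
  also have "(\<Sum>j\<in>UNIV. (of_nat (\<alpha> $ j) * (\<gamma>' j * (\<gamma> t $ j) ^ (\<alpha> $ j - 1))) *
        (\<Prod>i\<in>UNIV - {j}. (\<gamma> t $ i) ^ (\<alpha> $ i))) =
      (\<Sum>j\<in>UNIV. \<gamma>' j * (of_nat (\<alpha> $ j) * (\<Prod>i\<in>UNIV. (\<gamma> t $ i) ^ (if i = j then \<alpha> $ i - 1 else \<alpha> $ i))))"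
  proof (intro sum.cong refl)
    fix j
    have "(\<Prod>i\<in>UNIV. (\<gamma> t $ i) ^ (if i = j then \<alpha> $ i - 1 else \<alpha> $ i))
        = (\<gamma> t $ j) ^ (\<alpha> $ j - 1) * (\<Prod>i\<in>UNIV - {j}. (\<gamma> t $ i) ^ (\<alpha> $ i))"
      by (subst prod.remove[of _ j]) (auto intro!: prod.cong)
    then show "(of_nat (\<alpha> $ j) * (\<gamma>' j * (\<gamma> t $ j) ^ (\<alpha> $ j - 1))) * (\<Prod>i\<in>UNIV - {j}. (\<gamma> t $ i) ^ (\<alpha> $ i))
        = \<gamma>' j * (of_nat (\<alpha> $ j) * (\<Prod>i\<in>UNIV. (\<gamma> t $ i) ^ (if i = j then \<alpha> $ i - 1 else \<alpha> $ i)))"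
      by simp
  qed
  finally show ?thesis .
qed

lemma pderiv_shifted_has_sum:
  fixes f :: "('d::finite) mseries"
  assumes "((\<lambda>\<alpha>. ms_pderiv j f \<alpha> * monom_at x \<alpha>) has_sum s) UNIV"
  shows "((\<lambda>\<alpha>. f \<alpha> * (of_nat (\<alpha> $ j) * (\<Prod>i\<in>UNIV. (x $ i) ^ (if i = j then \<alpha> $ i - 1 else \<alpha> $ i)))) has_sum s) UNIV"
proof -
  let ?g = "\<lambda>\<alpha>. f \<alpha> * (of_nat (\<alpha> $ j) * (\<Prod>i\<in>UNIV. (x $ i) ^ (if i = j then \<alpha> $ i - 1 else \<alpha> $ i)))"
  let ?e = "\<lambda>\<alpha> :: nat ^ 'd. \<alpha> + axis j 1"
  have "inj ?e" by (auto simp: inj_on_def vec_eq_iff)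
  have "?g (?e \<alpha>) = ms_pderiv j f \<alpha> * monom_at x \<alpha>" for \<alpha>
    by (auto simp: ms_pderiv_def monom_at_def axis_def intro!: prod.cong)
  then have "(?g has_sum s) (range ?e)"
    using assms by (subst has_sum_reindex[OF \<open>inj ?e\<close>]) (simp only: o_def)
  also have "(?g has_sum s) (range ?e) \<longleftrightarrow> (?g has_sum s) UNIV"
  proof (rule has_sum_cong_neutral)
    fix \<alpha> assume "\<alpha> \<in> UNIV - range ?e"
    then have "\<alpha> \<noteq> ?e (\<chi> i. if i = j then \<alpha> $ i - 1 else \<alpha> $ i)" by auto
    then have "\<alpha> $ j = 0"
      by (auto simp: vec_eq_iff axis_def split: if_splits)
    then show "?g \<alpha> = 0" by simp
  qed auto
  finally show ?thesis .
qed

text \<open>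
  Chain rule along holomorphic curves. The partial sums converge uniformly along the curve, so
  their derivatives converge to the derivative of the sum; on the other hand they converge to the
  termwise differentiated series.
\<close>

lemma ms_eval_chain:
  fixes f :: "('d::finite) mseries"
  assumes "0 < r" and f: "\<And>\<alpha>. norm (f \<alpha>) * r ^ mdeg \<alpha> \<le> C"
    and "open S" "z \<in> S" and \<gamma>: "\<And>i. (\<lambda>t. \<gamma> t $ i) holomorphic_on S"
    and \<gamma>r: "\<And>i. norm (\<gamma> z $ i) < r / 2"
  shows "((\<lambda>t. ms_eval f (\<gamma> t)) has_field_derivative
      (\<Sum>j\<in>UNIV. deriv (\<lambda>t. \<gamma> t $ j) z * ms_eval (ms_pderiv j f) (\<gamma> z))) (at z)"
proof -
  define T where "T = {t \<in> S. \<forall>i. norm (\<gamma> t $ i) < r / 2}"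
  have "T = S \<inter> (\<Inter>i. {t \<in> S. norm (\<gamma> t $ i) \<in> {..<r / 2}})"
    by (auto simp: T_def)
  moreover have "open {t \<in> S. norm (\<gamma> t $ i) \<in> {..<r / 2}}" for i
  proof -
    have "continuous_on S (\<lambda>t. norm (\<gamma> t $ i))"
      by (intro continuous_intros holomorphic_on_imp_continuous_on \<gamma>)
    then have "open (S \<inter> (\<lambda>t. norm (\<gamma> t $ i)) -` {..<r / 2})"
      using continuous_open_preimage[OF _ \<open>open S\<close> open_lessThan] by blast
    then show ?thesis by (simp add: Int_def vimage_def)
  qed
  ultimately have "open T" using \<open>open S\<close> by (auto simp del: mem_Collect_eq lessThan_iff intro!: open_Int open_INT)
  moreover have "z \<in> T" using assms by (auto simp: T_def)
  ultimately obtain e where e: "0 < e" "cball z e \<subseteq> T"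
    by (meson open_contains_cball)
  let ?F = "finite_subsets_at_top (UNIV :: (nat ^ 'd) set)"
  let ?D = "\<lambda>t j \<alpha>. of_nat (\<alpha> $ j) * (\<Prod>i\<in>UNIV. (\<gamma> t $ i) ^ (if i = j then \<alpha> $ i - 1 else \<alpha> $ i))"
  have ul: "uniform_limit (cball z e) (\<lambda>A t. \<Sum>\<alpha>\<in>A. f \<alpha> * monom_at (\<gamma> t) \<alpha>) (\<lambda>t. ms_eval f (\<gamma> t)) ?F"
    unfolding ms_eval_def
  proof (rule Weierstrass_m_test_general[where M = "\<lambda>\<alpha>. norm (f \<alpha>) * (r / 2) ^ mdeg \<alpha>"])
    fix \<alpha> t assume "t \<in> cball z e"
    then have "norm (\<gamma> t $ i) \<le> r / 2" for i
      using e by (auto simp: T_def less_imp_le)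
    then show "norm (f \<alpha> * monom_at (\<gamma> t) \<alpha>) \<le> norm (f \<alpha>) * (r / 2) ^ mdeg \<alpha>"
      by (auto simp: norm_mult intro!: mult_left_mono norm_monom_at_le)
  qed (rule bounded_coeffs_abs_summable[OF \<open>0 < r\<close> f]; use \<open>0 < r\<close> in auto)
  have der: "((\<lambda>t. \<Sum>\<alpha>\<in>A. f \<alpha> * monom_at (\<gamma> t) \<alpha>) has_field_derivative
      (\<Sum>\<alpha>\<in>A. f \<alpha> * (\<Sum>j\<in>UNIV. deriv (\<lambda>t. \<gamma> t $ j) w * ?D w j \<alpha>))) (at w)" if "w \<in> cball z e" for A w
  proof -
    have "w \<in> S" using that e by (auto simp: T_def)
    then have "((\<lambda>t. \<gamma> t $ i) has_field_derivative deriv (\<lambda>t. \<gamma> t $ i) w) (at w)" for i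
      using holomorphic_derivI[OF \<gamma> \<open>open S\<close>] by blast
    then show ?thesis
      by (intro DERIV_sum DERIV_cmult monom_at_chain)
  qed
  have ev: "eventually (\<lambda>A. continuous_on (cball z e) (\<lambda>t. \<Sum>\<alpha>\<in>A. f \<alpha> * monom_at (\<gamma> t) \<alpha>) \<and>
      (\<forall>w\<in>ball z e. ((\<lambda>t. \<Sum>\<alpha>\<in>A. f \<alpha> * monom_at (\<gamma> t) \<alpha>) has_field_derivative
      (\<Sum>\<alpha>\<in>A. f \<alpha> * (\<Sum>j\<in>UNIV. deriv (\<lambda>t. \<gamma> t $ j) w * ?D w j \<alpha>))) (at w))) ?F"
  proof (intro always_eventually allI conjI ballI)
    fix A
    show "continuous_on (cball z e) (\<lambda>t. \<Sum>\<alpha>\<in>A. f \<alpha> * monom_at (\<gamma> t) \<alpha>)"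
      using der DERIV_isCont continuous_at_imp_continuous_on by blast
  qed (use der in auto)
  obtain g' where g': "\<And>w. w \<in> ball z e \<Longrightarrow> ((\<lambda>t. ms_eval f (\<gamma> t)) has_field_derivative g' w) (at w) \<and>
      ((\<lambda>A. \<Sum>\<alpha>\<in>A. f \<alpha> * (\<Sum>j\<in>UNIV. deriv (\<lambda>t. \<gamma> t $ j) w * ?D w j \<alpha>)) \<longlongrightarrow> g' w) ?F"
    by (rule has_complex_derivative_uniform_limit[OF ev ul]) (use e in auto)
  have "((\<lambda>\<alpha>. f \<alpha> * (\<Sum>j\<in>UNIV. deriv (\<lambda>t. \<gamma> t $ j) z * ?D z j \<alpha>)) has_sum
      (\<Sum>j\<in>UNIV. deriv (\<lambda>t. \<gamma> t $ j) z * ms_eval (ms_pderiv j f) (\<gamma> z))) UNIV"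
  proof -
    have "((\<lambda>\<alpha>. \<Sum>j\<in>UNIV. deriv (\<lambda>t. \<gamma> t $ j) z * (f \<alpha> * ?D z j \<alpha>)) has_sum
      (\<Sum>j\<in>UNIV. deriv (\<lambda>t. \<gamma> t $ j) z * ms_eval (ms_pderiv j f) (\<gamma> z))) UNIV"
      by (intro has_sum_finite_sum has_sum_cmult_right pderiv_shifted_has_sum
           bounded_coeffs_has_sum(2)[OF _ pderiv_bounded_coeffs[OF \<open>0 < r\<close> f] \<gamma>r])
         (use \<open>0 < r\<close> in auto)
    then show ?thesis by (simp add: sum_distrib_left mult_ac)
  qed
  then have "((\<lambda>A. \<Sum>\<alpha>\<in>A. f \<alpha> * (\<Sum>j\<in>UNIV. deriv (\<lambda>t. \<gamma> t $ j) z * ?D z j \<alpha>)) \<longlongrightarrow>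
      (\<Sum>j\<in>UNIV. deriv (\<lambda>t. \<gamma> t $ j) z * ms_eval (ms_pderiv j f) (\<gamma> z))) ?F"
    by (simp add: has_sum_def)
  then have "g' z = (\<Sum>j\<in>UNIV. deriv (\<lambda>t. \<gamma> t $ j) z * ms_eval (ms_pderiv j f) (\<gamma> z))"
    using g'[of z] e(1) by (intro tendsto_unique[OF finite_subsets_at_top_neq_bot]) auto
  then show ?thesis using g'[of z] e(1) by simp
qed

lemma ms_eval_at_0:
  fixes f :: "('d::finite) mseries"
  shows "ms_eval f 0 = f 0"
proof -
  have m: "monom_at (0 :: complex ^ 'd) \<alpha> = (if \<alpha> = 0 then 1 else 0)" for \<alpha>
    by (auto simp: monom_at_def vec_eq_iff power_0_left)
  have "((\<lambda>\<alpha>. f \<alpha> * monom_at 0 \<alpha>) has_sum f 0) {0}"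
    using has_sum_finite[of "{0}" "\<lambda>\<alpha>. f \<alpha> * monom_at 0 \<alpha>"] by (simp add: m)
  then have "((\<lambda>\<alpha>. f \<alpha> * monom_at 0 \<alpha>) has_sum f 0) UNIV"
    by (rule iffD1[OF has_sum_cong_neutral, rotated -1]) (auto simp: m)
  then show ?thesis unfolding ms_eval_def by (rule infsumI)
qed

lemma norm_vector_smult: "norm (c *s v) = norm c * norm (v :: complex ^ 'n)"
  by (simp add: norm_vec_def norm_mult L2_set_right_distrib)

text \<open>
  Identity theorem: if the sum vanishes near the origin, so do the sums of all derived series, and
  every coefficient is a multiple of the value at the origin of an iterated derivative.
\<close>

lemma ms_eval_eq_0_imp_eq_0:
  fixes f :: "('d::finite) mseries"
  assumes "f \<in> conv_series" "eventually (\<lambda>x. ms_eval f x = 0) (nhds 0)"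
  shows "f \<alpha> = 0"
  using assms
proof (induction "mdeg \<alpha>" arbitrary: f \<alpha>)
  case 0
  have "\<alpha> = 0" using 0(1) by (simp add: mdeg_def vec_eq_iff)
  then show ?case
    using eventually_nhds_x_imp_x[OF 0(3)] by (simp add: ms_eval_at_0)
next
  case (Suc n)
  obtain j where j: "\<alpha> $ j \<noteq> 0"
  proof -
    have "\<exists>i. \<alpha> $ i \<noteq> 0"
    proof (rule ccontr)
      assume "\<nexists>i. \<alpha> $ i \<noteq> 0"
      then have "mdeg \<alpha> = 0" by (simp add: mdeg_def)
      then show False using Suc(2) by simp
    qed
    then obtain i where "\<alpha> $ i \<noteq> 0" ..
    then show ?thesis using that by blast
  qed
  define \<beta> where "\<beta> = (\<chi> i. if i = j then \<alpha> $ i - 1 else \<alpha> $ i)"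
  have \<alpha>: "\<alpha> = \<beta> + axis j 1" using j by (auto simp: \<beta>_def vec_eq_iff axis_def)
  obtain r C where r: "0 < r" "\<And>\<alpha>. norm (f \<alpha>) * r ^ mdeg \<alpha> \<le> C"
    using Suc(3) unfolding conv_series_iff_bounded_coeffs by blast
  obtain e where e: "0 < e" "\<And>x. dist x 0 < e \<Longrightarrow> ms_eval f x = 0"
    using Suc(4) unfolding eventually_nhds_metric by blast
  have "ms_eval (ms_pderiv j f) x = 0" if "dist x 0 < min e (r / 2)" for x
  proof -
    let ?\<gamma> = "\<lambda>t. x + t *s axis j 1"
    have d: "((\<lambda>t. ?\<gamma> t $ i) has_field_derivative (if i = j then 1 else 0)) (at 0)" for i
      by (auto simp: axis_def intro!: derivative_eq_intros)
    have "((\<lambda>t. ms_eval f (?\<gamma> t)) has_field_derivative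
      (\<Sum>i\<in>UNIV. deriv (\<lambda>t. ?\<gamma> t $ i) 0 * ms_eval (ms_pderiv i f) (?\<gamma> 0))) (at 0)"
    proof (rule ms_eval_chain[OF r open_UNIV])
      show "(\<lambda>t. ?\<gamma> t $ i) holomorphic_on UNIV" for i
        by (auto intro!: holomorphic_intros)
      show "norm (?\<gamma> 0 $ i) < r / 2" for i
        using that norm_component_less[of x "r / 2" i] by (auto simp: dist_norm)
    qed auto
    also have "(\<Sum>i\<in>UNIV. deriv (\<lambda>t. ?\<gamma> t $ i) 0 * ms_eval (ms_pderiv i f) (?\<gamma> 0))
        = (\<Sum>i\<in>UNIV. if i = j then ms_eval (ms_pderiv i f) x else 0)"
      unfolding DERIV_imp_deriv[OF d] by (intro sum.cong refl) simp
    also have "\<dots> = ms_eval (ms_pderiv j f) x"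
      by simp
    finally have 1: "((\<lambda>t. ms_eval f (?\<gamma> t)) has_field_derivative ms_eval (ms_pderiv j f) x) (at 0)" .
    have "((\<lambda>t. norm t * norm (axis j 1 :: complex ^ 'd)) \<longlongrightarrow> 0 * norm (axis j 1 :: complex ^ 'd)) (nhds (0::complex))"
      by (intro tendsto_intros tendsto_norm_zero filterlim_ident)
    then have "eventually (\<lambda>t. norm t * norm (axis j 1 :: complex ^ 'd) < e - norm x) (nhds (0::complex))"
      by (rule order_tendstoD) (use that in \<open>auto simp: dist_norm\<close>)
    then have "eventually (\<lambda>t. 0 = ms_eval f (?\<gamma> t)) (nhds 0)"
    proof (rule eventually_mono)
      fix t :: complex assume "norm t * norm (axis j 1 :: complex ^ 'd) < e - norm x"
      then have "dist (?\<gamma> t) 0 < e"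
        using norm_triangle_ineq[of x "t *s axis j 1"] by (simp add: dist_norm norm_vector_smult)
      then show "0 = ms_eval f (?\<gamma> t)" using e(2)[of "?\<gamma> t"] by simp
    qed
    then have "((\<lambda>t. 0) has_field_derivative ms_eval (ms_pderiv j f) x) (at 0)"
      using 1 by (subst DERIV_cong_ev[OF refl _ refl])
    then show ?thesis using DERIV_unique[OF DERIV_const] by metis
  qed
  then have "eventually (\<lambda>x. ms_eval (ms_pderiv j f) x = 0) (nhds 0)"
    unfolding eventually_nhds_metric using e(1) r(1) by (intro exI[of _ "min e (r / 2)"]) auto
  moreover have "n = mdeg \<beta>"
    using Suc(2) unfolding \<alpha> mdeg_add mdeg_axis by simp
  ultimately have "ms_pderiv j f \<beta> = 0"
    by (intro Suc(1) pderiv_conv_series Suc(3))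
  then show "f \<alpha> = 0" unfolding \<alpha> ms_pderiv_def by (simp add: add_eq_0_iff_both_eq_0 del: of_nat_Suc of_nat_add)
qed

section \<open>Separately holomorphic functions\<close>

lemma uniform_limit_le_null_sequence:
  assumes "\<And>n x. x \<in> S \<Longrightarrow> dist (f n x) (l x) \<le> B n" "B \<longlonglongrightarrow> 0"
  shows "uniform_limit S f l sequentially"
proof (rule uniform_limitI)
  fix e :: real assume "0 < e"
  with assms(2) have "eventually (\<lambda>n. B n < e) sequentially"
    by (rule order_tendstoD)
  then show "eventually (\<lambda>n. \<forall>x\<in>S. dist (f n x) (l x) < e) sequentially"
    by eventually_elim (use assms(1) le_less_trans in blast)
qed

lemma holomorphic_uniform_limit_on_open:
  assumes "open S" "\<And>n. f n holomorphic_on S" "uniform_limit S f g sequentially"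
  shows "g holomorphic_on S"
proof (rule holomorphic_uniform_sequence[OF assms(1,2)])
  fix x assume "x \<in> S"
  then obtain d where "0 < d" "cball x d \<subseteq> S"
    using \<open>open S\<close> by (meson open_contains_cball)
  then show "\<exists>d>0. cball x d \<subseteq> S \<and> uniform_limit (cball x d) f g sequentially"
    using uniform_limit_on_subset[OF assms(3)] by blast
qed

definition taylor_coeff :: "(complex \<Rightarrow> complex) \<Rightarrow> nat \<Rightarrow> complex" where
  "taylor_coeff f n = (deriv ^^ n) f 0 / fact n"

lemma taylor_coeff_bound:
  assumes "0 < r" "f holomorphic_on ball 0 r" and f: "\<And>s. s \<in> ball 0 r \<Longrightarrow> norm (f s) \<le> M"
  shows "norm (taylor_coeff f n) * r ^ n \<le> M"
proof -
  have le: "norm (taylor_coeff f n) * t ^ n \<le> M" if "0 < t" "t < r" for t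
  proof -
    have "norm ((deriv ^^ n) f 0) \<le> fact n * M / t ^ n"
    proof (rule Cauchy_inequality)
      show "f holomorphic_on ball 0 t" "continuous_on (cball 0 t) f"
        using that by (auto intro!: holomorphic_on_imp_continuous_on holomorphic_on_subset[OF assms(2)])
    qed (use that f in auto)
    then show ?thesis
      using that by (simp add: taylor_coeff_def norm_divide field_simps)
  qed
  have "((\<lambda>t. norm (taylor_coeff f n) * t ^ n) \<longlongrightarrow> norm (taylor_coeff f n) * r ^ n) (at_left r)"
    by (intro tendsto_intros)
  then show ?thesis
  proof (rule tendsto_upperbound)
    show "eventually (\<lambda>t. norm (taylor_coeff f n) * t ^ n \<le> M) (at_left r)"
      using eventually_at_left_real[OF \<open>0 < r\<close>] by eventually_elim (auto intro: le)
  qed auto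
qed

lemma taylor_sums:
  assumes "f holomorphic_on ball 0 r" "s \<in> ball 0 r"
  shows "(\<lambda>n. taylor_coeff f n * s ^ n) sums f s"
  using holomorphic_power_series[OF assms] by (simp add: taylor_coeff_def)

lemma taylor_tail:
  assumes "0 < r" "f holomorphic_on ball 0 r" and f: "\<And>s. s \<in> ball 0 r \<Longrightarrow> norm (f s) \<le> M"
    and q: "0 \<le> q" "q < 1" and s: "norm s \<le> q * r"
  shows "norm (f s - (\<Sum>m<n. taylor_coeff f m * s ^ m)) \<le> M * q ^ n / (1 - q)"
proof -
  have "q * r < 1 * r"
    using q \<open>0 < r\<close> by (intro mult_strict_right_mono) auto
  then have "norm s < r" using s by simp
  have "0 \<le> M" using \<open>0 < r\<close> by (intro order_trans[OF norm_ge_zero f[of 0]]) simp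
  have le: "norm (taylor_coeff f m * s ^ m) \<le> M * q ^ m" for m
  proof -
    have "norm (taylor_coeff f m * s ^ m) \<le> norm (taylor_coeff f m) * (q * r) ^ m"
      using s by (auto simp: norm_mult norm_power intro!: mult_left_mono power_mono)
    also have "\<dots> = norm (taylor_coeff f m) * r ^ m * q ^ m"
      by (simp add: power_mult_distrib)
    also have "\<dots> \<le> M * q ^ m"
      using q by (intro mult_right_mono taylor_coeff_bound assms) auto
    finally show ?thesis .
  qed
  have "(\<lambda>m. taylor_coeff f m * s ^ m) sums f s"
    using taylor_sums[OF assms(2)] \<open>norm s < r\<close> by simp
  then have "(\<lambda>m. taylor_coeff f (m + n) * s ^ (m + n)) sums (f s - (\<Sum>m<n. taylor_coeff f m * s ^ m))"
    by (rule sums_split_initial_segment)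
  moreover have g: "(\<lambda>m. M * q ^ n * q ^ m) sums (M * q ^ n * (1 / (1 - q)))"
    using q by (intro sums_mult geometric_sums) auto
  moreover have "norm (\<Sum>m. taylor_coeff f (m + n) * s ^ (m + n)) \<le> (\<Sum>m. M * q ^ n * q ^ m)"
  proof (rule norm_suminf_le)
    show "norm (taylor_coeff f (m + n) * s ^ (m + n)) \<le> M * q ^ n * q ^ m" for m
      using le[of "m + n"] by (simp add: power_add mult_ac)
  qed (use g in \<open>auto simp: sums_iff\<close>)
  ultimately show ?thesis by (simp add: sums_iff)
qed

text \<open>
  The Taylor coefficients in one variable depend holomorphically on the other: \<open>c\<^sub>n\<close> is the limit,
  uniformly in the parameter, of the quotients \<open>(f s - \<Sum>\<^sub>m\<^sub><\<^sub>n c\<^sub>m s\<^sup>m) / s\<^sup>n\<close> as \<open>s\<close> tends to \<open>0\<close>.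
\<close>

lemma holomorphic_taylor_coeff:
  assumes "open U" "0 < r"
    and hs: "\<And>\<zeta>. \<zeta> \<in> U \<Longrightarrow> f \<zeta> holomorphic_on ball 0 r"
    and h\<zeta>: "\<And>s. s \<in> ball 0 r \<Longrightarrow> (\<lambda>\<zeta>. f \<zeta> s) holomorphic_on U"
    and M: "\<And>\<zeta> s. \<zeta> \<in> U \<Longrightarrow> s \<in> ball 0 r \<Longrightarrow> norm (f \<zeta> s) \<le> M"
  shows "(\<lambda>\<zeta>. taylor_coeff (f \<zeta>) n) holomorphic_on U"
proof (induction n rule: less_induct)
  case (less n)
  define q :: "nat \<Rightarrow> real" where "q k = 1 / (real k + 2)" for k
  have q: "0 < q k" "q k \<le> 1 / 2" for k by (auto simp: q_def field_simps)
  define s :: "nat \<Rightarrow> complex" where "s k = of_real (q k * r)" for k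
  have s: "s k \<noteq> 0" "norm (s k) = q k * r" for k
    using q[of k] \<open>0 < r\<close> unfolding s_def by (auto simp: norm_mult)
  have sr: "s k \<in> ball 0 r" for k
  proof -
    have "q k * r < 1 * r"
      using q[of k] \<open>0 < r\<close> by (intro mult_strict_right_mono) auto
    then show ?thesis by (simp add: s)
  qed
  let ?g = "\<lambda>k \<zeta>. (f \<zeta> (s k) - (\<Sum>m<n. taylor_coeff (f \<zeta>) m * s k ^ m)) / s k ^ n"
  show ?case
  proof (rule holomorphic_uniform_limit_on_open[OF \<open>open U\<close>])
    show "?g k holomorphic_on U" for k
      using s(1)[of k] sr[of k] by (intro holomorphic_intros h\<zeta> less) auto
    show "uniform_limit U ?g (\<lambda>\<zeta>. taylor_coeff (f \<zeta>) n) sequentially"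
    proof (rule uniform_limit_le_null_sequence)
      fix k \<zeta> assume "\<zeta> \<in> U"
      have "0 \<le> M" by (rule order_trans[OF norm_ge_zero M[OF \<open>\<zeta> \<in> U\<close> sr[of k]]])
      have "?g k \<zeta> - taylor_coeff (f \<zeta>) n = (f \<zeta> (s k) - (\<Sum>m<Suc n. taylor_coeff (f \<zeta>) m * s k ^ m)) / s k ^ n"
        using s[of k] by (simp add: field_simps)
      then have "dist (?g k \<zeta>) (taylor_coeff (f \<zeta>) n) =
          norm (f \<zeta> (s k) - (\<Sum>m<Suc n. taylor_coeff (f \<zeta>) m * s k ^ m)) / (q k * r) ^ n"
        by (simp add: dist_norm norm_divide norm_power s)
      also have "\<dots> \<le> (M * q k ^ Suc n / (1 - q k)) / (q k * r) ^ n"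
        using q[of k] s[of k] \<open>0 < r\<close> \<open>\<zeta> \<in> U\<close>
        by (intro divide_right_mono taylor_tail[OF \<open>0 < r\<close> hs M]) auto
      also have "\<dots> = (M / r ^ n) * q k * (1 / (1 - q k))"
        using q[of k] \<open>0 < r\<close> by (simp add: power_mult_distrib)
      also have "\<dots> \<le> (M / r ^ n) * q k * 2"
        using q[of k] \<open>0 < r\<close> \<open>0 \<le> M\<close> by (intro mult_left_mono) (auto simp: field_simps)
      finally show "dist (?g k \<zeta>) (taylor_coeff (f \<zeta>) n) \<le> (M / r ^ n) * q k * 2" .
    next
      have "(\<lambda>k. 1 / (real k + 2)) \<longlonglongrightarrow> 0"
        using LIMSEQ_ignore_initial_segment[OF lim_1_over_n, of 2] by (simp add: add.commute)
      then have "q \<longlonglongrightarrow> 0" by (simp add: q_def[abs_def])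
      then show "(\<lambda>k. (M / r ^ n) * q k * 2) \<longlonglongrightarrow> 0"
        using \<open>0 < r\<close> by (auto intro!: tendsto_mult_left_zero tendsto_mult_right_zero)
    qed
  qed
qed

text \<open>
  On the diagonal \<open>s = \<sigma>(\<zeta>)\<close> the Taylor series in \<open>s\<close> is a locally uniform limit of functions that are
  holomorphic in \<open>\<zeta>\<close>.
\<close>

lemma holomorphic_diagonal:
  assumes "open U" "0 < r"
    and hs: "\<And>\<zeta>. \<zeta> \<in> U \<Longrightarrow> f \<zeta> holomorphic_on ball 0 r"
    and h\<zeta>: "\<And>s. s \<in> ball 0 r \<Longrightarrow> (\<lambda>\<zeta>. f \<zeta> s) holomorphic_on U"
    and M: "\<And>\<zeta> s. \<zeta> \<in> U \<Longrightarrow> s \<in> ball 0 r \<Longrightarrow> norm (f \<zeta> s) \<le> M"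
    and \<sigma>: "\<sigma> holomorphic_on U" "\<sigma> ` U \<subseteq> ball 0 r"
  shows "(\<lambda>\<zeta>. f \<zeta> (\<sigma> \<zeta>)) holomorphic_on U"
proof -
  have "\<exists>V. open V \<and> z \<in> V \<and> V \<subseteq> U \<and> (\<lambda>\<zeta>. f \<zeta> (\<sigma> \<zeta>)) holomorphic_on V" if z: "z \<in> U" for z
  proof -
    obtain t where t: "norm (\<sigma> z) < t" "t < r"
    proof -
      have "norm (\<sigma> z) < r" using \<sigma>(2) z by auto
      then show ?thesis using dense[of "norm (\<sigma> z)" r] that by blast
    qed
    define V where "V = U \<inter> \<sigma> -` ball 0 t"
    have "open V" unfolding V_def
      by (rule continuous_open_preimage[OF holomorphic_on_imp_continuous_on[OF \<sigma>(1)] \<open>open U\<close> open_ball])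
    have "0 < t" by (rule le_less_trans[OF norm_ge_zero t(1)])
    have "(\<lambda>\<zeta>. f \<zeta> (\<sigma> \<zeta>)) holomorphic_on V"
    proof (rule holomorphic_uniform_limit_on_open[OF \<open>open V\<close>])
      let ?g = "\<lambda>n \<zeta>. \<Sum>m<n. taylor_coeff (f \<zeta>) m * \<sigma> \<zeta> ^ m"
      show "?g n holomorphic_on V" for n
        by (rule holomorphic_on_subset[of _ U])
           (auto simp: V_def intro!: holomorphic_intros holomorphic_taylor_coeff[OF \<open>open U\<close> \<open>0 < r\<close> hs h\<zeta> M] \<sigma>)
      show "uniform_limit V ?g (\<lambda>\<zeta>. f \<zeta> (\<sigma> \<zeta>)) sequentially"
      proof (rule uniform_limit_le_null_sequence)
        fix n \<zeta> assume "\<zeta> \<in> V"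
        then show "dist (?g n \<zeta>) (f \<zeta> (\<sigma> \<zeta>)) \<le> M * (t / r) ^ n / (1 - t / r)"
          unfolding dist_commute[of "?g n \<zeta>"] unfolding dist_norm
          using t \<open>0 < t\<close> by (intro taylor_tail[OF \<open>0 < r\<close> hs M]) (auto simp: V_def)
      next
        have "(\<lambda>n. (t / r) ^ n) \<longlonglongrightarrow> 0"
          using t \<open>0 < t\<close> by (intro LIMSEQ_power_zero) auto
        then show "(\<lambda>n. M * (t / r) ^ n / (1 - t / r)) \<longlonglongrightarrow> 0"
          using t \<open>0 < t\<close> by (auto intro!: tendsto_eq_intros)
      qed
    qed
    then show ?thesis using \<open>open V\<close> that t by (intro exI[of _ V]) (auto simp: V_def)
  qed
  then have "(\<lambda>\<zeta>. f \<zeta> (\<sigma> \<zeta>)) field_differentiable (at z)" if "z \<in> U" for z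
    using that holomorphic_on_imp_differentiable_at by meson
  then show ?thesis
    using field_differentiable_at_within holomorphic_on_def by blast
qed

definition upd :: "'a ^ 'd \<Rightarrow> 'd \<Rightarrow> 'a \<Rightarrow> 'a ^ 'd::finite" where
  "upd x j c = (\<chi> i. if i = j then c else x $ i)"

lemma upd_nth [simp]: "upd x j c $ i = (if i = j then c else x $ i)"
  by (simp add: upd_def)

lemma upd_upd [simp]: "upd (upd x j c) j d = upd x j d"
  by (simp add: vec_eq_iff)

lemma upd_triv [simp]: "upd x j (x $ j) = x"
  by (simp add: vec_eq_iff)

lemma upd_commute: "i \<noteq> j \<Longrightarrow> upd (upd x i c) j d = upd (upd x j d) i c"
  by (simp add: vec_eq_iff)

lemma mdeg_upd: "mdeg \<alpha> = mdeg (upd \<alpha> j 0) + \<alpha> $ j"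
proof -
  have "mdeg \<alpha> = \<alpha> $ j + (\<Sum>i\<in>UNIV - {j}. \<alpha> $ i)"
    unfolding mdeg_def by (rule sum.remove) auto
  moreover have "mdeg (upd \<alpha> j 0) = upd \<alpha> j 0 $ j + (\<Sum>i\<in>UNIV - {j}. upd \<alpha> j 0 $ i)"
    unfolding mdeg_def by (rule sum.remove) auto
  moreover have "(\<Sum>i\<in>UNIV - {j}. upd \<alpha> j 0 $ i) = (\<Sum>i\<in>UNIV - {j}. \<alpha> $ i)"
    by (intro sum.cong) auto
  ultimately show ?thesis by simp
qed

lemma monom_at_upd: "monom_at x \<alpha> = monom_at (upd x j 0) (upd \<alpha> j 0) * (x $ j) ^ (\<alpha> $ j)"
proof -
  have "monom_at x \<alpha> = (x $ j) ^ (\<alpha> $ j) * (\<Prod>i\<in>UNIV - {j}. (x $ i) ^ (\<alpha> $ i))"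
    unfolding monom_at_def by (rule prod.remove) auto
  moreover have "monom_at (upd x j 0) (upd \<alpha> j 0)
      = (upd x j 0 $ j) ^ (upd \<alpha> j 0 $ j) * (\<Prod>i\<in>UNIV - {j}. (upd x j 0 $ i) ^ (upd \<alpha> j 0 $ i))"
    unfolding monom_at_def by (rule prod.remove) auto
  moreover have "(\<Prod>i\<in>UNIV - {j}. (upd x j 0 $ i) ^ (upd \<alpha> j 0 $ i)) = (\<Prod>i\<in>UNIV - {j}. (x $ i) ^ (\<alpha> $ i))"
    by (intro prod.cong) auto
  ultimately show ?thesis by simp
qed

text \<open>
  Expansion one variable at a time: the Taylor coefficients with respect to \<open>x\<^sub>j\<close> are again
  bounded and separately holomorphic in the remaining variables.
\<close>

lemma separately_holomorphic_expansion:
  fixes g :: "complex ^ 'd::finite \<Rightarrow> complex" and S :: "'d set"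
  assumes "finite S" "0 < r"
    and "\<And>x. (\<And>i. norm (x $ i) < r) \<Longrightarrow> norm (g x) \<le> M"
    and "\<And>x j. (\<And>i. norm (x $ i) < r) \<Longrightarrow> (\<lambda>\<zeta>. g (upd x j \<zeta>)) holomorphic_on ball 0 r"
  shows "\<exists>c :: 'd mseries. (\<forall>\<alpha>. norm (c \<alpha>) * r ^ mdeg \<alpha> \<le> M) \<and>
    (\<forall>\<alpha> i. i \<notin> S \<longrightarrow> \<alpha> $ i \<noteq> 0 \<longrightarrow> c \<alpha> = 0) \<and>
    (\<forall>x. (\<forall>i. norm (x $ i) < r) \<longrightarrow> (\<forall>i. i \<notin> S \<longrightarrow> x $ i = 0) \<longrightarrow>
      ((\<lambda>\<alpha>. c \<alpha> * monom_at x \<alpha>) has_sum g x) UNIV)"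
  using assms(1,3,4)
proof (induction S arbitrary: g M rule: finite_induct)
  case empty
  define c :: "'d mseries" where "c = (\<lambda>\<alpha>. if \<alpha> = 0 then g 0 else 0)"
  have M: "norm (g 0) \<le> M" using \<open>0 < r\<close> by (intro empty) auto
  moreover have "norm (c \<alpha>) * r ^ mdeg \<alpha> \<le> M" for \<alpha>
    using M order_trans[OF norm_ge_zero M] by (auto simp: c_def mdeg_def)
  moreover have "((\<lambda>\<alpha>. c \<alpha> * monom_at x \<alpha>) has_sum g x) UNIV" if "\<And>i. norm (x $ i) < r" "\<And>i. x $ i = 0" for x
  proof -
    have "x = 0" using that(2) by (simp add: vec_eq_iff)
    have "((\<lambda>\<alpha>. c \<alpha> * monom_at x \<alpha>) has_sum ms_eval c x) UNIV"
      by (rule bounded_coeffs_has_sum(2)[OF \<open>0 < r\<close> calculation(2) that(1)])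
    then show ?thesis by (simp add: ms_eval_at_0 \<open>x = 0\<close>) (simp add: c_def)
  qed
  ultimately show ?case
    by (intro exI[of _ c]) (auto simp: c_def vec_eq_iff)
next
  case (insert j S)
  define g' where "g' n x = taylor_coeff (\<lambda>\<zeta>. g (upd x j \<zeta>)) n" for n x
  have upd_small: "norm (upd x k \<zeta> $ i) < r" if "\<And>i. norm (x $ i) < r" "\<zeta> \<in> ball 0 r" for x k i \<zeta>
    using that by auto
  have g'_bound: "norm (g' n x) \<le> M / r ^ n" if "\<And>i. norm (x $ i) < r" for n x
  proof -
    have "norm (g' n x) * r ^ n \<le> M"
      unfolding g'_def
      by (intro taylor_coeff_bound \<open>0 < r\<close> insert.prems upd_small that)
    then show ?thesis using \<open>0 < r\<close> by (simp add: field_simps)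
  qed
  have g'_hol: "(\<lambda>\<zeta>. g' n (upd x k \<zeta>)) holomorphic_on ball 0 r" if x: "\<And>i. norm (x $ i) < r" for n x k
  proof (cases "k = j")
    case True
    then show ?thesis by (simp add: g'_def)
  next
    case False
    show ?thesis unfolding g'_def
    proof (rule holomorphic_taylor_coeff[OF open_ball \<open>0 < r\<close>])
      show "(\<lambda>\<zeta>. g (upd (upd x k \<omega>) j \<zeta>)) holomorphic_on ball 0 r" if "\<omega> \<in> ball 0 r" for \<omega>
        by (intro insert.prems upd_small x that)
      show "(\<lambda>\<omega>. g (upd (upd x k \<omega>) j \<zeta>)) holomorphic_on ball 0 r" if "\<zeta> \<in> ball 0 r" for \<zeta>
        unfolding upd_commute[OF False] by (intro insert.prems upd_small x that)
      show "norm (g (upd (upd x k \<omega>) j \<zeta>)) \<le> M" if "\<omega> \<in> ball 0 r" "\<zeta> \<in> ball 0 r" for \<omega> \<zeta>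
        by (intro insert.prems upd_small x that)
    qed
  qed
  have "\<forall>n. \<exists>c :: 'd mseries. (\<forall>\<alpha>. norm (c \<alpha>) * r ^ mdeg \<alpha> \<le> M / r ^ n) \<and>
    (\<forall>\<alpha> i. i \<notin> S \<longrightarrow> \<alpha> $ i \<noteq> 0 \<longrightarrow> c \<alpha> = 0) \<and>
    (\<forall>x. (\<forall>i. norm (x $ i) < r) \<longrightarrow> (\<forall>i. i \<notin> S \<longrightarrow> x $ i = 0) \<longrightarrow>
      ((\<lambda>\<alpha>. c \<alpha> * monom_at x \<alpha>) has_sum g' n x) UNIV)"
    by (intro allI insert.IH g'_bound g'_hol)
  then obtain C :: "nat \<Rightarrow> 'd mseries" where
    C1: "\<And>n \<alpha>. norm (C n \<alpha>) * r ^ mdeg \<alpha> \<le> M / r ^ n" and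
    C2: "\<And>n \<alpha> i. i \<notin> S \<Longrightarrow> \<alpha> $ i \<noteq> 0 \<Longrightarrow> C n \<alpha> = 0" and
    C3: "\<And>n x. (\<And>i. norm (x $ i) < r) \<Longrightarrow> (\<And>i. i \<notin> S \<Longrightarrow> x $ i = 0) \<Longrightarrow>
      ((\<lambda>\<alpha>. C n \<alpha> * monom_at x \<alpha>) has_sum g' n x) UNIV"
    by metis
  define c where "c \<alpha> = C (\<alpha> $ j) (upd \<alpha> j 0)" for \<alpha>
  have c1: "norm (c \<alpha>) * r ^ mdeg \<alpha> \<le> M" for \<alpha>
  proof -
    have "norm (c \<alpha>) * r ^ mdeg \<alpha> = norm (c \<alpha>) * r ^ mdeg (upd \<alpha> j 0) * r ^ (\<alpha> $ j)"
      by (simp add: mdeg_upd[of \<alpha> j] power_add)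
    also have "\<dots> \<le> M / r ^ (\<alpha> $ j) * r ^ (\<alpha> $ j)"
      unfolding c_def using \<open>0 < r\<close> by (intro mult_right_mono C1) auto
    finally show ?thesis using \<open>0 < r\<close> by simp
  qed
  have c2: "c \<alpha> = 0" if "i \<notin> insert j S" "\<alpha> $ i \<noteq> 0" for \<alpha> i
    unfolding c_def using that by (intro C2[of i]) auto
  have c3: "((\<lambda>\<alpha>. c \<alpha> * monom_at x \<alpha>) has_sum g x) UNIV"
    if x: "\<And>i. norm (x $ i) < r" and x0: "\<And>i. i \<notin> insert j S \<Longrightarrow> x $ i = 0" for x
  proof -
    define B :: "(nat ^ 'd) set" where "B = {\<beta>. \<beta> $ j = 0}"
    let ?x = "upd x j 0"
    let ?h = "\<lambda>(n, \<beta>). C n \<beta> * monom_at ?x \<beta> * x $ j ^ n"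
    have bij: "bij_betw (\<lambda>(n, \<beta>). upd \<beta> j n) (UNIV \<times> B) UNIV"
      by (rule bij_betwI[where g = "\<lambda>\<alpha>. (\<alpha> $ j, upd \<alpha> j 0)"])
         (auto simp: B_def vec_eq_iff)
    have h: "(\<lambda>p. c (case p of (n, \<beta>) \<Rightarrow> upd \<beta> j n) * monom_at x (case p of (n, \<beta>) \<Rightarrow> upd \<beta> j n)) p = ?h p"
      if pB: "p \<in> UNIV \<times> B" for p
    proof -
      obtain n \<beta> where p: "p = (n, \<beta>)" "\<beta> $ j = 0" using pB by (cases p) (auto simp: B_def)
      then have "upd \<beta> j 0 = \<beta>" by (metis upd_triv)
      then show ?thesis using p monom_at_upd[of x "upd \<beta> j n" j] by (simp add: c_def)
    qed
    have "(\<lambda>\<alpha>. c \<alpha> * monom_at x \<alpha>) summable_on UNIV"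
      by (rule abs_summable_summable[OF bounded_coeffs_has_sum(1)[OF \<open>0 < r\<close> c1 x]])
    then have sm: "?h summable_on (UNIV \<times> B)"
      by (subst (asm) summable_on_reindex_bij_betw[OF bij, symmetric]) (subst (asm) summable_on_cong[OF h], auto)
    have "(?h has_sum g x) (UNIV \<times> B)"
    proof (rule has_sum_SigmaI[OF _ _ sm])
      fix n
      have "((\<lambda>\<beta>. C n \<beta> * monom_at ?x \<beta>) has_sum g' n ?x) UNIV"
        using x x0 \<open>0 < r\<close> by (intro C3) auto
      also have "((\<lambda>\<beta>. C n \<beta> * monom_at ?x \<beta>) has_sum g' n ?x) UNIV \<longleftrightarrow>
          ((\<lambda>\<beta>. C n \<beta> * monom_at ?x \<beta>) has_sum g' n ?x) B"
        using insert.hyps by (intro has_sum_cong_neutral) (auto simp: B_def C2)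
      finally show "((\<lambda>\<beta>. ?h (n, \<beta>)) has_sum g' n ?x * x $ j ^ n) B"
        using has_sum_cmult_left by fastforce
    next
      have hol: "(\<lambda>\<zeta>. g (upd x j \<zeta>)) holomorphic_on ball 0 r"
        by (intro insert.prems x)
      have sums: "(\<lambda>n. g' n ?x * x $ j ^ n) sums g x"
        using taylor_sums[OF hol, of "x $ j"] x by (simp add: g'_def)
      have "summable (\<lambda>n. norm (g' n ?x * x $ j ^ n))"
      proof (rule summable_comparison_test')
        show "summable (\<lambda>n. M * (norm (x $ j) / r) ^ n)"
          using x \<open>0 < r\<close> by (intro summable_mult summable_geometric) auto
        fix n
        have "norm (g' n ?x) * norm (x $ j) ^ n \<le> M / r ^ n * norm (x $ j) ^ n"
          using x \<open>0 < r\<close> by (intro mult_right_mono g'_bound) auto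
        then show "norm (norm (g' n ?x * x $ j ^ n)) \<le> M * (norm (x $ j) / r) ^ n"
          by (simp add: norm_mult norm_power power_divide)
      qed
      then show "((\<lambda>n. g' n ?x * x $ j ^ n) has_sum g x) UNIV"
        using sums by (rule norm_summable_imp_has_sum)
    qed
    then show ?thesis
      by (subst has_sum_reindex_bij_betw[OF bij, symmetric]) (subst has_sum_cong[OF h], auto)
  qed
  show ?case
    by (intro exI[of _ c] conjI allI impI) (auto intro: c1 c2 c3)
qed

corollary separately_holomorphic_conv_series:
  fixes g :: "complex ^ 'd::finite \<Rightarrow> complex"
  assumes "0 < r"
    and "\<And>x. (\<And>i. norm (x $ i) < r) \<Longrightarrow> norm (g x) \<le> M"
    and "\<And>x j. (\<And>i. norm (x $ i) < r) \<Longrightarrow> (\<lambda>\<zeta>. g (upd x j \<zeta>)) holomorphic_on ball 0 r"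
  shows "\<exists>c \<in> conv_series. \<forall>x. (\<forall>i. norm (x $ i) < r) \<longrightarrow> ms_eval c x = g x"
proof -
  obtain c :: "'d mseries" where c: "\<And>\<alpha>. norm (c \<alpha>) * r ^ mdeg \<alpha> \<le> M"
    "\<And>x. (\<forall>i. norm (x $ i) < r) \<Longrightarrow> ((\<lambda>\<alpha>. c \<alpha> * monom_at x \<alpha>) has_sum g x) UNIV"
    using separately_holomorphic_expansion[of "UNIV :: 'd set" r g M, OF finite assms] by auto
  have "c \<in> conv_series"
    unfolding conv_series_iff_bounded_coeffs using c(1) \<open>0 < r\<close> by blast
  moreover have "ms_eval c x = g x" if "\<forall>i. norm (x $ i) < r" for x
    unfolding ms_eval_def by (rule infsumI[OF c(2)[OF that]])
  ultimately show ?thesis by blast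
qed

section \<open>The singular linear equation in one variable\<close>

definition vec_holomorphic :: "(complex \<Rightarrow> complex ^ 'n) \<Rightarrow> complex set \<Rightarrow> bool" where
  "vec_holomorphic v S \<longleftrightarrow> (\<forall>i. (\<lambda>s. v s $ i) holomorphic_on S)"

definition vec_deriv :: "(complex \<Rightarrow> complex ^ 'n) \<Rightarrow> complex \<Rightarrow> complex ^ 'n" where
  "vec_deriv v s = (\<chi> i. deriv (\<lambda>s. v s $ i) s)"

definition sep_holomorphic ::
    "complex set \<Rightarrow> complex set \<Rightarrow> (complex \<Rightarrow> complex \<Rightarrow> complex ^ 'n) \<Rightarrow> bool" where
  "sep_holomorphic U V f \<longleftrightarrow>
     (\<forall>\<zeta>\<in>U. vec_holomorphic (f \<zeta>) V) \<and> (\<forall>s\<in>V. vec_holomorphic (\<lambda>\<zeta>. f \<zeta> s) U)"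

lemma vec_holomorphic_continuous:
  fixes v :: "complex \<Rightarrow> complex ^ 'n::finite"
  assumes "vec_holomorphic v S"
  shows "continuous_on S v"
proof -
  have "continuous_on S (\<lambda>s. \<chi> i. v s $ i)"
    using assms unfolding vec_holomorphic_def
    by (intro continuous_on_vec_lambda holomorphic_on_imp_continuous_on) auto
  then show ?thesis by simp
qed

lemma vec_holomorphic_deriv:
  assumes "vec_holomorphic v S" "open S"
  shows "vec_holomorphic (vec_deriv v) S"
  using assms by (simp add: vec_holomorphic_def vec_deriv_def holomorphic_deriv)

lemma has_field_derivative_vec_deriv:
  assumes "vec_holomorphic v S" "open S" "s \<in> S"
  shows "((\<lambda>s. v s $ i) has_field_derivative vec_deriv v s $ i) (at s)"
  using assms holomorphic_derivI[of "\<lambda>s. v s $ i" S s UNIV] by (auto simp: vec_holomorphic_def vec_deriv_def)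

lemma vec_derivI:
  assumes "\<And>i. ((\<lambda>s. v s $ i) has_field_derivative d $ i) (at s)"
  shows "vec_deriv v s = d"
  using assms by (simp add: vec_deriv_def vec_eq_iff DERIV_imp_deriv)

lemma norm_vec_le_sum: "norm (v :: complex ^ 'n::finite) \<le> (\<Sum>i\<in>UNIV. norm (v $ i))"
  unfolding norm_vec_def by (rule L2_set_le_sum) auto

lemma norm_vec_le_card:
  assumes "\<And>i. norm (v $ i) \<le> B"
  shows "norm (v :: complex ^ 'n::finite) \<le> real CARD('n) * B"
  using order_trans[OF norm_vec_le_sum sum_bounded_above[of UNIV "\<lambda>i. norm (v $ i)" B]] assms by simp

lemma matrix_vector_norm_bound:
  fixes A :: "complex ^ 'n ^ 'n::finite"
  shows "\<exists>B>0. \<forall>w. norm (A *v w) \<le> B * norm w"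
proof -
  define B where "B = 1 + (\<Sum>i\<in>UNIV. \<Sum>j\<in>UNIV. norm (A $ i $ j))"
  have "norm (A *v w) \<le> B * norm w" for w
  proof -
    have "norm ((A *v w) $ i) \<le> (\<Sum>j\<in>UNIV. norm (A $ i $ j)) * norm w" for i
    proof -
      have "norm ((A *v w) $ i) \<le> (\<Sum>j\<in>UNIV. norm (A $ i $ j * w $ j))"
        unfolding matrix_vector_mult_def by (simp add: norm_sum)
      also have "\<dots> \<le> (\<Sum>j\<in>UNIV. norm (A $ i $ j) * norm w)"
        by (intro sum_mono) (simp add: norm_mult mult_left_mono norm_component_le)
      finally show ?thesis by (simp add: sum_distrib_right)
    qed
    then have "norm (A *v w) \<le> (\<Sum>i\<in>UNIV. (\<Sum>j\<in>UNIV. norm (A $ i $ j)) * norm w)"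
      by (intro order_trans[OF norm_vec_le_sum sum_mono])
    also have "\<dots> \<le> B * norm w"
      unfolding B_def sum_distrib_right[symmetric] by (simp add: distrib_right)
    finally show ?thesis .
  qed
  moreover have "B > 0" unfolding B_def by (smt (verit) norm_ge_zero sum_nonneg)
  ultimately show ?thesis by blast
qed

lemma vec_holomorphic_factor_zero:
  assumes "vec_holomorphic g (ball 0 r)" "g 0 = 0"
  shows "\<exists>h. vec_holomorphic h (ball 0 r) \<and> (\<forall>s\<in>ball 0 r. g s = s *s h s)"
proof -
  define h where "h s = (\<chi> i. if s = 0 then deriv (\<lambda>s. g s $ i) 0 else g s $ i / s)" for s
  have "vec_holomorphic h (ball 0 r)"
    unfolding vec_holomorphic_def
  proof
    fix i
    show "(\<lambda>s. h s $ i) holomorphic_on ball 0 r"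
      using pole_lemma_open[of "\<lambda>s. g s $ i" "ball 0 r" 0] assms
      by (simp add: vec_holomorphic_def h_def cong: if_cong)
  qed
  moreover have "g s = s *s h s" for s
    using assms(2) by (auto simp: vec_eq_iff h_def)
  ultimately show ?thesis by blast
qed

text \<open>
  Uniqueness. If \<open>w = s\<^sup>n g\<close> then dividing the estimate by \<open>s\<^sup>n\<close> and letting \<open>s\<close> tend to \<open>0\<close> gives
  \<open>|n g(0) - \<nu> g(0)| \<le> \<epsilon> |g(0)|\<close>, hence \<open>g(0) = 0\<close>, and another factor \<open>s\<close> splits off. So \<open>w\<close> vanishes to
  infinite order.
\<close>

lemma singular_equation_unique:
  fixes w :: "complex \<Rightarrow> complex ^ 'n::finite"
  assumes "0 < r" and w: "vec_holomorphic w (ball 0 r)"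
    and \<kappa>: "\<And>(n::nat) z. norm (of_nat n *s z - \<nu> *v z) \<ge> \<kappa> * norm z"
    and "\<epsilon> < \<kappa>"
    and eq: "\<And>s. s \<in> ball 0 r \<Longrightarrow> norm (s *s vec_deriv w s - \<nu> *v w s) \<le> \<epsilon> * norm (w s)"
    and s: "s \<in> ball 0 r"
  shows "w s = 0"
proof -
  have factor: "\<exists>g. vec_holomorphic g (ball 0 r) \<and> (\<forall>s\<in>ball 0 r. w s = s ^ n *s g s)" for n
  proof (induction n)
    case 0
    then show ?case using w by (intro exI[of _ w]) auto
  next
    case (Suc n)
    then obtain g where g: "vec_holomorphic g (ball 0 r)" and wg: "\<And>s. s \<in> ball 0 r \<Longrightarrow> w s = s ^ n *s g s"
      by blast
    define \<phi> where "\<phi> s = norm (of_nat n *s g s + s *s vec_deriv g s - \<nu> *v g s) - \<epsilon> * norm (g s)" for s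
    have \<phi>_le: "\<phi> s \<le> 0" if s: "s \<in> ball 0 r" "s \<noteq> 0" for s
    proof -
      have "vec_deriv w s = of_nat n *s (s ^ (n - 1) *s g s) + s ^ n *s vec_deriv g s"
      proof (rule vec_derivI)
        fix i
        have "((\<lambda>s. s ^ n * g s $ i) has_field_derivative
            (of_nat n * (s ^ (n - 1) * g s $ i) + s ^ n * vec_deriv g s $ i)) (at s)"
          by (auto intro!: derivative_eq_intros has_field_derivative_vec_deriv[OF g open_ball s(1)])
        then have "((\<lambda>s. w s $ i) has_field_derivative
            (of_nat n * (s ^ (n - 1) * g s $ i) + s ^ n * vec_deriv g s $ i)) (at s)"
          by (rule has_field_derivative_transform_within_open[OF _ open_ball s(1)]) (simp add: wg)
        then show "((\<lambda>s. w s $ i) has_field_derivative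
            (of_nat n *s (s ^ (n - 1) *s g s) + s ^ n *s vec_deriv g s) $ i) (at s)"
          by (simp add: mult.assoc)
      qed
      moreover have "s * s ^ (n - 1) * of_nat n = s ^ n * of_nat n"
        by (cases n) auto
      ultimately have eq1: "s *s vec_deriv w s - \<nu> *v w s
          = s ^ n *s (of_nat n *s g s + s *s vec_deriv g s - \<nu> *v g s)"
        using wg[OF s(1)]
        by (auto simp add: vec_eq_iff matrix_vector_mult_def sum_distrib_left algebra_simps)
      have "norm s ^ n * norm (of_nat n *s g s + s *s vec_deriv g s - \<nu> *v g s) \<le> \<epsilon> * norm (w s)"
        using eq[OF s(1)] by (simp only: eq1 norm_vector_smult norm_power)
      then have "norm s ^ n * norm (of_nat n *s g s + s *s vec_deriv g s - \<nu> *v g s)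
          \<le> norm s ^ n * (\<epsilon> * norm (g s))"
        unfolding wg[OF s(1)] norm_vector_smult norm_power by (simp only: mult_ac)
      then show ?thesis
        using s(2) by (simp add: \<phi>_def)
    qed
    have "continuous_on (ball 0 r) (\<lambda>s. \<chi> i. of_nat n * g s $ i + s * vec_deriv g s $ i - (\<Sum>j\<in>UNIV. \<nu> $ i $ j * g s $ j))"
      using g vec_holomorphic_deriv[OF g open_ball] unfolding vec_holomorphic_def
      by (intro continuous_on_vec_lambda holomorphic_on_imp_continuous_on holomorphic_intros) auto
    also have "(\<lambda>s. \<chi> i. of_nat n * g s $ i + s * vec_deriv g s $ i - (\<Sum>j\<in>UNIV. \<nu> $ i $ j * g s $ j))
        = (\<lambda>s. of_nat n *s g s + s *s vec_deriv g s - \<nu> *v g s)"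
      by (simp add: vec_eq_iff matrix_vector_mult_def fun_eq_iff)
    finally have cont: "continuous_on (ball 0 r) (\<lambda>s. of_nat n *s g s + s *s vec_deriv g s - \<nu> *v g s)" .
    have "continuous_on (ball 0 r) \<phi>"
      unfolding \<phi>_def
      by (intro continuous_on_diff continuous_on_norm cont continuous_on_mult continuous_on_const
          vec_holomorphic_continuous g)
    then have "isCont \<phi> 0"
      using \<open>0 < r\<close> by (simp add: continuous_on_eq_continuous_at)
    then have "\<phi> \<midarrow>0\<rightarrow> \<phi> 0" by (simp add: isCont_def)
    then have "\<phi> 0 \<le> 0"
    proof (rule tendsto_upperbound)
      show "eventually (\<lambda>s. \<phi> s \<le> 0) (at 0)"
        unfolding eventually_at using \<open>0 < r\<close> by (intro exI[of _ r]) (auto intro!: \<phi>_le)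
    qed auto
    then have "\<kappa> * norm (g 0) \<le> \<epsilon> * norm (g 0)"
      using \<kappa>[of "g 0" n] by (simp add: \<phi>_def)
    then have "g 0 = 0"
      using \<open>\<epsilon> < \<kappa>\<close> by (simp add: mult_le_cancel_right)
    then obtain h where h: "vec_holomorphic h (ball 0 r)" "\<And>s. s \<in> ball 0 r \<Longrightarrow> g s = s *s h s"
      using vec_holomorphic_factor_zero[OF g] by blast
    have "w s = s ^ Suc n *s h s" if "s \<in> ball 0 r" for s
      using wg[OF that] h(2)[OF that] by (simp add: vec_eq_iff)
    with h(1) show ?case by blast
  qed
  have "w s $ i = 0" for i
  proof (rule ccontr)
    assume nz: "w s $ i \<noteq> 0"
    let ?f = "\<lambda>s. w s $ i"
    have hol: "?f holomorphic_on ball 0 r" using w by (simp add: vec_holomorphic_def)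
    have "?f 0 = 0"
      using factor[of 1] \<open>0 < r\<close> by auto
    then have nc: "\<not> ?f constant_on ball 0 r"
      using nz s \<open>0 < r\<close> unfolding constant_on_def by (metis centre_in_ball)
    have "0 \<in> ball 0 r" using \<open>0 < r\<close> by simp
    obtain g \<rho> n where n: "0 < n" "0 < \<rho>" "ball 0 \<rho> \<subseteq> ball (0::complex) r" "g holomorphic_on ball 0 \<rho>"
      "\<And>s. s \<in> ball 0 \<rho> \<Longrightarrow> ?f s = (s - 0) ^ n * g s" "\<And>s. s \<in> ball 0 \<rho> \<Longrightarrow> g s \<noteq> 0"
      by (rule holomorphic_factor_zero_nonconstant
          [OF hol open_ball connected_ball \<open>0 \<in> ball 0 r\<close> \<open>?f 0 = 0\<close> nc]) (rule that)
    obtain h where h: "vec_holomorphic h (ball 0 r)" "\<And>s. s \<in> ball 0 r \<Longrightarrow> w s = s ^ Suc n *s h s"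
      using factor[of "Suc n"] by blast
    have "g s = s * h s $ i" if "s \<in> ball 0 \<rho> - {0}" for s
      using n(5)[of s] h(2)[of s] n(3) that by auto
    then have ev: "eventually (\<lambda>s. s * h s $ i = g s) (at 0)"
      unfolding eventually_at using n(2) by (intro exI[of _ \<rho>]) (auto simp: dist_commute)
    have "isCont (\<lambda>s. h s $ i) 0"
      using holomorphic_on_imp_continuous_on[of "\<lambda>s. h s $ i" "ball 0 r"] h(1) \<open>0 < r\<close>
      by (simp add: vec_holomorphic_def continuous_on_eq_continuous_at)
    then have "(\<lambda>s. s * h s $ i) \<midarrow>0\<rightarrow> 0 * h 0 $ i"
      by (intro tendsto_mult tendsto_ident_at) (simp only: isCont_def)
    then have "g \<midarrow>0\<rightarrow> 0"
      using ev by (simp add: filterlim_cong[OF refl refl ev])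
    moreover have "g \<midarrow>0\<rightarrow> g 0"
      using holomorphic_on_imp_continuous_on[OF n(4)] \<open>0 < \<rho>\<close>
      by (simp add: continuous_on_eq_continuous_at isCont_def)
    ultimately have "g 0 = 0"
      using tendsto_unique[OF at_neq_bot] by blast
    then show False using n(6)[of 0] n(2) by simp
  qed
  then show ?thesis by (simp add: vec_eq_iff)
qed

text \<open>
  The operator \<open>s d/ds - \<nu>\<close> multiplies the coefficient of \<open>s\<^sup>n\<close> by \<open>n - \<nu>\<close>; this is its inverse on
  power series.
\<close>

definition euler_inv ::
    "complex ^ 'n ^ 'n \<Rightarrow> (complex \<Rightarrow> complex ^ 'n) \<Rightarrow> complex \<Rightarrow> complex ^ 'n::finite" where
  "euler_inv \<nu> f s = (\<chi> i. \<Sum>n. (matrix_inv (mat (of_nat n) - \<nu>) *v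
     (\<chi> k. taylor_coeff (\<lambda>s. f s $ k) n)) $ i * s ^ n)"

lemma mat_vector_mult: "mat c *v v = c *s (v :: 'a::comm_semiring_1 ^ 'n::finite)"
proof -
  have "(\<Sum>j\<in>UNIV. (if i = j then c else 0) * v $ j) = (\<Sum>j\<in>UNIV. if i = j then c * v $ j else 0)" for i
    by (intro sum.cong) auto
  then show ?thesis
    by (simp add: vec_eq_iff matrix_vector_mult_def mat_def)
qed

lemma matrix_inv_bound:
  fixes \<nu> :: "complex ^ 'n ^ 'n::finite"
  assumes "0 < c" and c: "\<And>z. norm (a *s z - \<nu> *v z) \<ge> c * norm z"
  defines "R \<equiv> matrix_inv (mat a - \<nu>)"
  shows "a *s (R *v z) - \<nu> *v (R *v z) = z" and "norm (R *v z) \<le> norm z / c"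
proof -
  have A: "(mat a - \<nu>) *v z = a *s z - \<nu> *v z" for z
    by (simp add: matrix_vector_mult_diff_rdistrib mat_vector_mult)
  have "z = 0" if "(mat a - \<nu>) *v z = 0" for z
    using c[of z] that \<open>0 < c\<close> by (simp add: A mult_le_0_iff)
  then have "inj ((*v) (mat a - \<nu>))"
    by (simp add: vec.inj_iff_eq_0)
  then have "invertible (mat a - \<nu>)"
    by (simp add: invertible_left_inverse matrix_left_invertible_injective)
  then have "(mat a - \<nu>) ** R = mat 1"
    unfolding R_def matrix_inv_def invertible_def by (rule someI2_ex) auto
  then have "(mat a - \<nu>) *v (R *v z) = z"
    by (simp add: matrix_vector_mul_assoc)
  then show *: "a *s (R *v z) - \<nu> *v (R *v z) = z" by (simp add: A)
  show "norm (R *v z) \<le> norm z / c"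
    using c[of "R *v z"] \<open>0 < c\<close> by (simp add: * field_simps)
qed

lemma power_series_deriv_sums:
  fixes a :: "nat \<Rightarrow> complex"
  assumes "\<And>s. s \<in> ball 0 r \<Longrightarrow> (\<lambda>n. a n * s ^ n) sums f s" "s \<in> ball 0 r"
  shows "(\<lambda>n. of_nat n * a n * s ^ (n - 1)) sums deriv f s" "f field_differentiable (at s)"
proof -
  obtain t where t: "norm s < t" "t < r"
    using dense[of "norm s" r] assms(2) by auto
  then have "0 < t" using le_less_trans norm_ge_zero by blast
  have "summable (\<lambda>n. a n * of_real t ^ n)"
    using assms(1)[of "of_real t"] t \<open>0 < t\<close> by (auto simp: sums_iff)
  then obtain g g' where g: "\<And>z. norm z < t \<Longrightarrow> (\<lambda>n. a n * z ^ n) sums g z"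
    "\<And>z. norm z < t \<Longrightarrow> (\<lambda>n. of_nat n * a n * z ^ (n - 1)) sums g' z"
    "\<And>z. norm z < t \<Longrightarrow> (g has_field_derivative g' z) (at z)"
    using power_series_and_derivative_0[of a t] by auto
  have "g z = f z" if "z \<in> ball 0 t" for z
    using g(1)[of z] assms(1)[of z] that t by (auto intro: sums_unique2)
  then have "(f has_field_derivative g' s) (at s)"
    using has_field_derivative_transform_within_open[OF g(3)[OF t(1)] open_ball[of 0 t]] t by auto
  then show "(\<lambda>n. of_nat n * a n * s ^ (n - 1)) sums deriv f s" "f field_differentiable (at s)"
    using g(2)[OF t(1)] by (auto simp: DERIV_imp_deriv field_differentiable_def)
qed

text \<open>Division of the coefficients by \<open>n + 1\<close> turns \<open>f\<close> into its average \<open>s\<^sup>-\<^sup>1 \<integral>\<^sub>0\<^sup>s f\<close>.\<close>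

lemma taylor_average_bound:
  assumes "0 < r" "f holomorphic_on ball 0 r" and M: "\<And>s. s \<in> ball 0 r \<Longrightarrow> norm (f s) \<le> M"
    and "s \<in> ball 0 r" and a: "(\<lambda>n. taylor_coeff f n / of_nat (Suc n) * s ^ n) sums A"
  shows "norm A \<le> M"
proof (cases "s = 0")
  case True
  have "(\<lambda>n. taylor_coeff f n / of_nat (Suc n) * s ^ n) sums (taylor_coeff f 0 / of_nat (Suc 0))"
    using powser_sums_zero[of "\<lambda>n. taylor_coeff f n / of_nat (Suc n)"] True by simp
  then have "A = f 0"
    using sums_unique2[OF a] by (simp add: taylor_coeff_def)
  then show ?thesis using M[of 0] \<open>0 < r\<close> by simp
next
  case False
  obtain g where g: "\<And>z. z \<in> ball 0 r \<Longrightarrow> (g has_field_derivative f z) (at z)"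
  proof -
    obtain g0 where "\<And>z. z \<in> ball 0 r \<Longrightarrow> (g0 has_field_derivative f z) (at z within ball 0 r)"
      using holomorphic_convex_primitive'[OF convex_ball open_ball assms(2)] by auto
    then show ?thesis using that[of g0] by (metis at_within_open open_ball)
  qed
  define b where "b n = taylor_coeff g n" for n
  have hol: "g holomorphic_on ball 0 r"
    using g by (meson field_differentiable_def holomorphic_onI field_differentiable_at_within)
  have bs: "(\<lambda>n. b n * z ^ n) sums g z" if "z \<in> ball 0 r" for z
    unfolding b_def using taylor_sums[OF hol that] .
  have b: "b (Suc n) = taylor_coeff f n / of_nat (Suc n)" for n
  proof -
    have "(deriv ^^ n) (deriv g) 0 = (deriv ^^ n) f 0"
      by (rule higher_deriv_transform_within_open[of _ "ball 0 r"])
         (use g hol \<open>0 < r\<close> assms(2) in \<open>auto simp: holomorphic_deriv DERIV_imp_deriv\<close>)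
    then have "(deriv ^^ Suc n) g 0 = (deriv ^^ n) f 0"
      by (simp add: funpow_Suc_right del: funpow.simps)
    then show ?thesis by (simp add: b_def taylor_coeff_def)
  qed
  have "b 0 = g 0" by (simp add: b_def taylor_coeff_def)
  have "(\<lambda>n. b (Suc n) * s ^ Suc n) sums (g s - b 0 * s ^ 0)"
    using sums_split_initial_segment[OF bs[OF assms(4)], of 1] by simp
  moreover have "(\<lambda>n. b (Suc n) * s ^ Suc n) sums (s * A)"
    using sums_mult[OF a, of s] by (simp add: b mult_ac)
  ultimately have "s * A = g s - g 0"
    using sums_unique2 \<open>b 0 = g 0\<close> by (metis mult.right_neutral power_0)
  moreover have "norm (g s - g 0) \<le> M * norm (s - 0)"
  proof (rule field_differentiable_bound[OF convex_ball])
    show "(g has_field_derivative f z) (at z within ball 0 r)" if "z \<in> ball 0 r" for z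
      using g[OF that] has_field_derivative_at_within by blast
  qed (use assms M in auto)
  ultimately have "norm s * norm A \<le> norm s * M"
    by (simp add: norm_mult[symmetric] mult.commute)
  then show ?thesis using False by simp
qed

lemma taylor_coeff_diff:
  assumes "0 < r" "f holomorphic_on ball 0 r" "g holomorphic_on ball 0 r"
  shows "taylor_coeff (\<lambda>s. f s - g s) n = taylor_coeff f n - taylor_coeff g n"
  using higher_deriv_diff[OF assms(2,3) open_ball, of 0 n] \<open>0 < r\<close>
  by (simp add: taylor_coeff_def diff_divide_distrib)

text \<open>
  The factor \<open>n + 1\<close> in the bound holds automatically for large \<open>n\<close>. It makes the multipliers
  \<open>(n - \<nu>)\<^sup>-\<^sup>1\<close> decay like \<open>1 / n\<close>.
\<close>

locale nonresonant =
  fixes \<nu> :: "complex ^ 'n ^ 'n::finite" and \<kappa> :: real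
  assumes \<kappa>_pos: "0 < \<kappa>"
    and nonresonant: "\<And>(n::nat) z. norm (of_nat n *s z - \<nu> *v z) \<ge> \<kappa> * (real n + 1) * norm z"
begin

abbreviation resolvent :: "nat \<Rightarrow> complex ^ 'n ^ 'n" where
  "resolvent n \<equiv> matrix_inv (mat (of_nat n) - \<nu>)"

abbreviation tc :: "(complex \<Rightarrow> complex ^ 'n) \<Rightarrow> nat \<Rightarrow> complex ^ 'n" where
  "tc f n \<equiv> (\<chi> k. taylor_coeff (\<lambda>s. f s $ k) n)"

lemma resolvent_solves: "of_nat n *s (resolvent n *v z) - \<nu> *v (resolvent n *v z) = z"
  and resolvent_bound: "norm (resolvent n *v z) \<le> norm z / (\<kappa> * (real n + 1))"
  using matrix_inv_bound[of "\<kappa> * (real n + 1)" "of_nat n" \<nu>, OF _ nonresonant] \<kappa>_pos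
  by (auto simp: add_pos_pos)

lemma resolvent_bound': "norm (resolvent n *v z) \<le> norm z / \<kappa>"
proof -
  have "norm z / (\<kappa> * (real n + 1)) \<le> norm z / \<kappa>"
    using \<kappa>_pos by (intro divide_left_mono) auto
  then show ?thesis using resolvent_bound order_trans by blast
qed

lemma nonresonant': "norm (of_nat n *s z - \<nu> *v z) \<ge> \<kappa> * norm z"
proof -
  have "\<kappa> * 1 * norm z \<le> \<kappa> * (real n + 1) * norm z"
    using \<kappa>_pos by (intro mult_right_mono mult_left_mono) auto
  then show ?thesis using nonresonant[of n z] by simp
qed

lemma tc_bound:
  assumes "0 < r" "vec_holomorphic f (ball 0 r)" "\<And>s. s \<in> ball 0 r \<Longrightarrow> norm (f s) \<le> M"
  shows "norm (tc f n) * r ^ n \<le> real CARD('n) * M"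
proof -
  have "norm (taylor_coeff (\<lambda>s. f s $ k) n) \<le> M / r ^ n" for k
  proof -
    have "norm (taylor_coeff (\<lambda>s. f s $ k) n) * r ^ n \<le> M"
      using assms by (intro taylor_coeff_bound) (auto simp: vec_holomorphic_def intro!: norm_component_le)
    then show ?thesis using \<open>0 < r\<close> by (simp add: field_simps)
  qed
  then have "norm (tc f n) \<le> real CARD('n) * (M / r ^ n)"
    by (intro norm_vec_le_card) simp
  then show ?thesis using \<open>0 < r\<close> by (simp add: field_simps)
qed

lemma euler_inv_term_bound:
  assumes "0 < r" "vec_holomorphic f (ball 0 r)" "\<And>s. s \<in> ball 0 r \<Longrightarrow> norm (f s) \<le> M"
  shows "norm ((resolvent n *v tc f n) $ i * s ^ n) \<le> real CARD('n) * M / \<kappa> * (norm s / r) ^ n"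
proof -
  have "norm ((resolvent n *v tc f n) $ i * s ^ n) \<le> norm (tc f n) / \<kappa> * norm s ^ n"
    unfolding norm_mult norm_power
    by (intro mult_right_mono norm_component_le resolvent_bound') auto
  also have "\<dots> = norm (tc f n) * r ^ n * (norm s / r) ^ n / \<kappa>"
    using \<open>0 < r\<close> by (simp add: power_divide)
  also have "\<dots> \<le> real CARD('n) * M * (norm s / r) ^ n / \<kappa>"
    using \<kappa>_pos \<open>0 < r\<close> by (intro divide_right_mono mult_right_mono tc_bound assms) auto
  finally show ?thesis by simp
qed

lemma euler_inv_sums:
  assumes "0 < r" "vec_holomorphic f (ball 0 r)" "\<And>s. s \<in> ball 0 r \<Longrightarrow> norm (f s) \<le> M"
    and s: "s \<in> ball 0 r"
  shows "(\<lambda>n. (resolvent n *v tc f n) $ i * s ^ n) sums (euler_inv \<nu> f s $ i)"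
proof -
  have "summable (\<lambda>n. (resolvent n *v tc f n) $ i * s ^ n)"
  proof (rule summable_comparison_test')
    show "summable (\<lambda>n. real CARD('n) * M / \<kappa> * (norm s / r) ^ n)"
      using s \<open>0 < r\<close> by (intro summable_mult summable_geometric) auto
  qed (rule euler_inv_term_bound[OF assms(1-3)])
  then show ?thesis by (simp add: euler_inv_def summable_sums)
qed

lemma euler_inv_holomorphic:
  assumes "0 < r" "vec_holomorphic f (ball 0 r)" "\<And>s. s \<in> ball 0 r \<Longrightarrow> norm (f s) \<le> M"
  shows "vec_holomorphic (euler_inv \<nu> f) (ball 0 r)"
  unfolding vec_holomorphic_def
proof
  fix i
  show "(\<lambda>s. euler_inv \<nu> f s $ i) holomorphic_on ball 0 r"
    using power_series_holomorphic[of 0 r "\<lambda>n. (resolvent n *v tc f n) $ i" "\<lambda>s. euler_inv \<nu> f s $ i"]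
      euler_inv_sums[OF assms] by simp
qed

lemma euler_inv_solves:
  assumes "0 < r" "vec_holomorphic f (ball 0 r)" "\<And>s. s \<in> ball 0 r \<Longrightarrow> norm (f s) \<le> M"
    and s: "s \<in> ball 0 r"
  shows "s *s vec_deriv (euler_inv \<nu> f) s = \<nu> *v euler_inv \<nu> f s + f s"
proof -
  have "s * deriv (\<lambda>s. euler_inv \<nu> f s $ i) s - (\<nu> *v euler_inv \<nu> f s) $ i = f s $ i" for i
  proof -
    let ?a = "\<lambda>i n. (resolvent n *v tc f n) $ i"
    have "(\<lambda>n. of_nat n * ?a i n * s ^ (n - 1)) sums deriv (\<lambda>s. euler_inv \<nu> f s $ i) s"
      by (rule power_series_deriv_sums[OF euler_inv_sums[OF assms(1-3)] s])
    then have "(\<lambda>n. s * (of_nat n * ?a i n * s ^ (n - 1))) sums (s * deriv (\<lambda>s. euler_inv \<nu> f s $ i) s)"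
      by (rule sums_mult)
    also have "(\<lambda>n. s * (of_nat n * ?a i n * s ^ (n - 1))) = (\<lambda>n. of_nat n * ?a i n * s ^ n)"
    proof
      fix n show "s * (of_nat n * ?a i n * s ^ (n - 1)) = of_nat n * ?a i n * s ^ n"
        by (cases n) auto
    qed
    finally have 1: "(\<lambda>n. of_nat n * ?a i n * s ^ n) sums (s * deriv (\<lambda>s. euler_inv \<nu> f s $ i) s)" .
    have 2: "(\<lambda>n. \<Sum>j\<in>UNIV. \<nu> $ i $ j * (?a j n * s ^ n)) sums (\<Sum>j\<in>UNIV. \<nu> $ i $ j * euler_inv \<nu> f s $ j)"
      by (intro sums_sum sums_mult euler_inv_sums[OF assms])
    have "(\<lambda>n. of_nat n * ?a i n * s ^ n - (\<Sum>j\<in>UNIV. \<nu> $ i $ j * (?a j n * s ^ n))) =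
        (\<lambda>n. taylor_coeff (\<lambda>s. f s $ i) n * s ^ n)"
    proof
      fix n
      have "(of_nat n *s (resolvent n *v tc f n) - \<nu> *v (resolvent n *v tc f n)) $ i = tc f n $ i"
        by (simp only: resolvent_solves)
      then have "of_nat n * ?a i n - (\<Sum>j\<in>UNIV. \<nu> $ i $ j * ?a j n) = taylor_coeff (\<lambda>s. f s $ i) n"
        by (simp add: matrix_vector_mult_def[of \<nu>])
      then show "of_nat n * ?a i n * s ^ n - (\<Sum>j\<in>UNIV. \<nu> $ i $ j * (?a j n * s ^ n)) =
          taylor_coeff (\<lambda>s. f s $ i) n * s ^ n"
        by (simp add: left_diff_distrib[symmetric] sum_distrib_right[symmetric] mult.assoc[symmetric])
    qed
    with sums_diff[OF 1 2] have "(\<lambda>n. taylor_coeff (\<lambda>s. f s $ i) n * s ^ n) sums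
        (s * deriv (\<lambda>s. euler_inv \<nu> f s $ i) s - (\<Sum>j\<in>UNIV. \<nu> $ i $ j * euler_inv \<nu> f s $ j))"
      by simp
    moreover have "(\<lambda>n. taylor_coeff (\<lambda>s. f s $ i) n * s ^ n) sums f s $ i"
      using assms(2) s by (intro taylor_sums) (auto simp: vec_holomorphic_def)
    ultimately show ?thesis
      using sums_unique2 by (fastforce simp: matrix_vector_mult_def)
  qed
  then show ?thesis by (simp add: vec_eq_iff vec_deriv_def algebra_simps)
qed

lemma euler_inv_diff:
  assumes "0 < r" "vec_holomorphic f (ball 0 r)" "\<And>s. s \<in> ball 0 r \<Longrightarrow> norm (f s) \<le> M"
    "vec_holomorphic g (ball 0 r)" "\<And>s. s \<in> ball 0 r \<Longrightarrow> norm (g s) \<le> M'" "s \<in> ball 0 r"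
  shows "euler_inv \<nu> (\<lambda>s. f s - g s) s = euler_inv \<nu> f s - euler_inv \<nu> g s"
proof -
  have "tc (\<lambda>s. f s - g s) n = tc f n - tc g n" for n
    using assms by (auto simp: vec_eq_iff vec_holomorphic_def intro!: taylor_coeff_diff)
  then have "(resolvent n *v tc (\<lambda>s. f s - g s) n) $ i * s ^ n
      = (resolvent n *v tc f n) $ i * s ^ n - (resolvent n *v tc g n) $ i * s ^ n" for n i
    by (simp add: matrix_vector_mult_diff_distrib left_diff_distrib)
  then have "(\<lambda>n. (resolvent n *v tc (\<lambda>s. f s - g s) n) $ i * s ^ n) sums (euler_inv \<nu> f s $ i - euler_inv \<nu> g s $ i)" for i
    using sums_diff[OF euler_inv_sums[OF assms(1-3,6)] euler_inv_sums[OF assms(1,4-6)]] by simp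
  then show ?thesis
    unfolding euler_inv_def[of \<nu> "\<lambda>s. f s - g s"] by (simp add: vec_eq_iff sums_iff)
qed

text \<open>
  The supremum bound does not depend on the radius. Up to \<open>O(n\<^sup>-\<^sup>2)\<close>, for which Cauchy's estimates of
  the Taylor coefficients suffice, the operator with multipliers \<open>(n - \<nu>)\<^sup>-\<^sup>1\<close> is the averaging
  operator with multipliers \<open>1 / (n + 1)\<close>.
\<close>

lemma euler_inv_bound:
  "\<exists>K>0. \<forall>r f M s. 0 < r \<longrightarrow> vec_holomorphic f (ball 0 r) \<longrightarrow> (\<forall>s\<in>ball 0 r. norm (f s) \<le> M) \<longrightarrow>
     s \<in> ball 0 r \<longrightarrow> norm (euler_inv \<nu> f s) \<le> K * M"
proof -
  obtain B where B: "0 < B" "\<And>w. norm (\<nu> *v w) \<le> B * norm w"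
    using matrix_vector_norm_bound by blast
  define Z :: real where "Z = (\<Sum>n. 1 / (real n + 1) ^ 2)"
  have Z: "(\<lambda>n. 1 / (real n + 1) ^ 2) sums Z"
  proof -
    have "summable (\<lambda>n. 1 / (real (Suc n)) ^ 2)"
      using inverse_power_summable[of 2, where 'a = real] summable_Suc_iff[of "\<lambda>n. inverse (real n ^ 2)"]
      by (simp add: field_simps)
    then show ?thesis unfolding Z_def by (intro summable_sums) (simp add: add.commute)
  qed
  have "0 \<le> Z" using sums_le[OF _ sums_zero Z] by simp
  define C where "C = (1 + B) / \<kappa> * real CARD('n)"
  have "0 \<le> C" using B \<kappa>_pos by (simp add: C_def)
  define K where "K = real CARD('n) * (1 + C * Z)"
  have "norm (euler_inv \<nu> f s) \<le> K * M"
    if r: "0 < r" and f: "vec_holomorphic f (ball 0 r)" and M: "\<And>s. s \<in> ball 0 r \<Longrightarrow> norm (f s) \<le> M"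
      and s: "s \<in> ball 0 r" for r f M s
  proof -
    have "0 \<le> M" using \<open>0 < r\<close> by (intro order_trans[OF norm_ge_zero M[of 0]]) simp
    have "norm (euler_inv \<nu> f s $ i) \<le> (1 + C * Z) * M" for i
    proof -
      define q where "q n = ((resolvent n *v tc f n) $ i - taylor_coeff (\<lambda>s. f s $ i) n / of_nat (Suc n)) * s ^ n" for n
      have q: "norm (q n) \<le> C * M * (1 / (real n + 1) ^ 2)" for n
      proof -
        let ?t = "tc f n"
        define w where "w = resolvent n *v ?t - (1 / of_nat (Suc n)) *s ?t"
        have "of_nat (Suc n) *s w = resolvent n *v (?t + \<nu> *v ?t)"
        proof -
          have e1: "resolvent n *v (of_nat n *s ?t - \<nu> *v ?t) = ?t"
          proof -
            let ?z = "resolvent n *v (of_nat n *s ?t - \<nu> *v ?t)"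
            have "of_nat n *s (?z - ?t) - \<nu> *v (?z - ?t) = 0"
              using resolvent_solves[of n "of_nat n *s ?t - \<nu> *v ?t"]
              by (simp add: matrix_vector_mult_diff_distrib vec.scale_right_diff_distrib algebra_simps)
            then have "\<kappa> * norm (?z - ?t) \<le> 0"
              using nonresonant'[of "?z - ?t" n] by simp
            then show ?thesis using \<kappa>_pos by (simp add: mult_le_0_iff)
          qed
          have "of_nat (Suc n) *s w = of_nat (Suc n) *s (resolvent n *v ?t) - ?t"
            by (simp add: w_def vec_eq_iff field_simps del: of_nat_Suc)
          also have "\<dots> = resolvent n *v (of_nat (Suc n) *s ?t) - resolvent n *v (of_nat n *s ?t - \<nu> *v ?t)"
            by (simp only: e1 vector_scalar_commute)
          also have "\<dots> = resolvent n *v (of_nat (Suc n) *s ?t - (of_nat n *s ?t - \<nu> *v ?t))"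
            by (simp only: matrix_vector_mult_diff_distrib)
          also have "of_nat (Suc n) *s ?t - (of_nat n *s ?t - \<nu> *v ?t) = ?t + \<nu> *v ?t"
            by (simp add: vec_eq_iff algebra_simps)
          finally show ?thesis .
        qed
        then have "real (Suc n) * norm w = norm (resolvent n *v (?t + \<nu> *v ?t))"
          using norm_vector_smult[of "of_nat (Suc n)" w] by (simp only: norm_of_nat)
        then have "(real n + 1) * norm w = norm (resolvent n *v (?t + \<nu> *v ?t))"
          by (simp add: add.commute)
        also have "\<dots> \<le> norm (?t + \<nu> *v ?t) / (\<kappa> * (real n + 1))"
          by (rule resolvent_bound)
        also have "\<dots> \<le> ((1 + B) * norm ?t) / (\<kappa> * (real n + 1))"
          using \<kappa>_pos B(2)[of ?t] norm_triangle_ineq[of ?t "\<nu> *v ?t"]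
          by (intro divide_right_mono) (auto simp: algebra_simps)
        finally have "norm w * (real n + 1) \<le> ((1 + B) * norm ?t) / (\<kappa> * (real n + 1))"
          by (simp only: mult.commute)
        then have "norm w \<le> ((1 + B) * norm ?t) / (\<kappa> * (real n + 1)) / (real n + 1)"
          by (subst pos_le_divide_eq) auto
        also have "\<dots> = (1 + B) / \<kappa> * norm ?t / (real n + 1) ^ 2"
          by (simp add: power2_eq_square divide_divide_eq_left mult.assoc)
        finally have w1: "norm w \<le> (1 + B) / \<kappa> * norm ?t / (real n + 1) ^ 2" .
        have "norm (q n) = norm (w $ i) * norm s ^ n"
          by (simp add: q_def w_def norm_mult norm_power)
        also have "\<dots> \<le> norm w * r ^ n"
          using s by (intro mult_mono power_mono norm_component_le order_refl) auto
        also have "\<dots> \<le> ((1 + B) / \<kappa> * norm ?t / (real n + 1) ^ 2) * r ^ n"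
          using r by (intro mult_right_mono w1) auto
        also have "\<dots> = (1 + B) / \<kappa> * (norm ?t * r ^ n) / (real n + 1) ^ 2"
          by simp
        also have "\<dots> \<le> (1 + B) / \<kappa> * (real CARD('n) * M) / (real n + 1) ^ 2"
          using B \<kappa>_pos by (intro divide_right_mono mult_left_mono tc_bound[OF r f M]) auto
        finally show ?thesis by (simp add: C_def)
      qed
      have sq: "summable q" "norm (suminf q) \<le> C * M * Z"
      proof -
        have g: "(\<lambda>n. C * M * (1 / (real n + 1) ^ 2)) sums (C * M * Z)"
          by (rule sums_mult[OF Z])
        show "summable q"
          by (rule summable_comparison_test'[OF sums_summable[OF g] q])
        show "norm (suminf q) \<le> C * M * Z"
          using norm_suminf_le[OF q sums_summable[OF g]] sums_unique[OF g] by simp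
      qed
      have "(\<lambda>n. (resolvent n *v tc f n) $ i * s ^ n - q n) sums (euler_inv \<nu> f s $ i - suminf q)"
        by (intro sums_diff euler_inv_sums[OF r f M s] summable_sums sq)
      then have sums: "(\<lambda>n. taylor_coeff (\<lambda>s. f s $ i) n / of_nat (Suc n) * s ^ n) sums (euler_inv \<nu> f s $ i - suminf q)"
        by (simp add: q_def left_diff_distrib del: of_nat_Suc)
      have "norm (euler_inv \<nu> f s $ i - suminf q) \<le> M"
      proof (rule taylor_average_bound[OF r _ _ s sums])
        show "(\<lambda>s. f s $ i) holomorphic_on ball 0 r"
          using f by (simp add: vec_holomorphic_def)
        show "norm (f s $ i) \<le> M" if "s \<in> ball 0 r" for s
          by (rule norm_component_le[OF M[OF that]])
      qed
      then show ?thesis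
        using sq(2) norm_triangle_sub[of "euler_inv \<nu> f s $ i" "suminf q"] by (simp add: algebra_simps)
    qed
    then have "norm (euler_inv \<nu> f s) \<le> real CARD('n) * ((1 + C * Z) * M)"
      by (rule norm_vec_le_card)
    then show ?thesis by (simp add: K_def)
  qed
  moreover have "0 < K"
    using \<open>0 \<le> C\<close> \<open>0 \<le> Z\<close> by (simp add: K_def add_pos_nonneg)
  ultimately show ?thesis by (intro exI[of _ K] conjI allI impI) auto
qed

lemma euler_inv_sep_holomorphic:
  assumes "open U" "0 < r" and f: "sep_holomorphic U (ball 0 r) f"
    and M: "\<And>\<zeta> s. \<zeta> \<in> U \<Longrightarrow> s \<in> ball 0 r \<Longrightarrow> norm (f \<zeta> s) \<le> M"
  shows "sep_holomorphic U (ball 0 r) (\<lambda>\<zeta>. euler_inv \<nu> (f \<zeta>))"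
  unfolding sep_holomorphic_def
proof (intro conjI ballI)
  fix \<zeta> assume "\<zeta> \<in> U"
  then show "vec_holomorphic (euler_inv \<nu> (f \<zeta>)) (ball 0 r)"
    using f M by (intro euler_inv_holomorphic[OF \<open>0 < r\<close>]) (auto simp: sep_holomorphic_def)
next
  fix s :: complex assume s: "s \<in> ball 0 r"
  have fs: "vec_holomorphic (f \<zeta>) (ball 0 r)" if "\<zeta> \<in> U" for \<zeta>
    using f that by (auto simp: sep_holomorphic_def)
  show "vec_holomorphic (\<lambda>\<zeta>. euler_inv \<nu> (f \<zeta>) s) U"
    unfolding vec_holomorphic_def
  proof
    fix i
    let ?a = "\<lambda>\<zeta> n. (resolvent n *v tc (f \<zeta>) n) $ i * s ^ n"
    show "(\<lambda>\<zeta>. euler_inv \<nu> (f \<zeta>) s $ i) holomorphic_on U"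
    proof (rule holomorphic_uniform_limit_on_open[OF \<open>open U\<close>])
      fix N
      have "(\<lambda>\<zeta>. taylor_coeff (\<lambda>s. f \<zeta> s $ k) n) holomorphic_on U" for k n
        using f M
        by (intro holomorphic_taylor_coeff[OF \<open>open U\<close> \<open>0 < r\<close>, where M = M])
           (auto simp: sep_holomorphic_def vec_holomorphic_def intro!: norm_component_le)
      then show "(\<lambda>\<zeta>. \<Sum>n<N. ?a \<zeta> n) holomorphic_on U"
        unfolding matrix_vector_mult_def by (auto intro!: holomorphic_intros)
    next
      define q where "q = norm s / r"
      have q: "0 \<le> q" "q < 1" using s \<open>0 < r\<close> by (auto simp: q_def)
      define D where "D = real CARD('n) * M / \<kappa>"
      show "uniform_limit U (\<lambda>N \<zeta>. \<Sum>n<N. ?a \<zeta> n) (\<lambda>\<zeta>. euler_inv \<nu> (f \<zeta>) s $ i) sequentially"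
      proof (rule uniform_limit_le_null_sequence)
        fix N \<zeta> assume "\<zeta> \<in> U"
        have "(\<lambda>n. ?a \<zeta> (n + N)) sums (euler_inv \<nu> (f \<zeta>) s $ i - (\<Sum>n<N. ?a \<zeta> n))"
          by (intro sums_split_initial_segment euler_inv_sums[OF \<open>0 < r\<close> fs M s] \<open>\<zeta> \<in> U\<close>)
        moreover have "norm (\<Sum>n. ?a \<zeta> (n + N)) \<le> (\<Sum>n. D * q ^ N * q ^ n)"
        proof (rule norm_suminf_le)
          show "norm (?a \<zeta> (n + N)) \<le> D * q ^ N * q ^ n" for n
            using euler_inv_term_bound[OF \<open>0 < r\<close> fs M, OF \<open>\<zeta> \<in> U\<close> \<open>\<zeta> \<in> U\<close>, of "n + N" i s]
            by (simp add: D_def q_def power_add mult_ac)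
          show "summable (\<lambda>n. D * q ^ N * q ^ n)"
            using q by (intro summable_mult summable_geometric) auto
        qed
        moreover have "(\<lambda>n. D * q ^ N * q ^ n) sums (D * q ^ N * (1 / (1 - q)))"
          using q by (intro sums_mult geometric_sums) auto
        ultimately show "dist (\<Sum>n<N. ?a \<zeta> n) (euler_inv \<nu> (f \<zeta>) s $ i) \<le> D * q ^ N * (1 / (1 - q))"
          by (simp add: sums_iff dist_norm norm_minus_commute)
      next
        have "(\<lambda>N. q ^ N) \<longlonglongrightarrow> 0" using q by (intro LIMSEQ_power_zero) auto
        then show "(\<lambda>N. D * q ^ N * (1 / (1 - q))) \<longlonglongrightarrow> 0"
          using tendsto_mult[OF tendsto_mult[OF tendsto_const[of D] \<open>(\<lambda>N. q ^ N) \<longlonglongrightarrow> 0\<close>] tendsto_const[of "1 / (1 - q)"]]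
          by simp
      qed
    qed
  qed
qed

end

section \<open>The nonlinear singular equation with parameters\<close>

lemma geometric_differences_limit:
  fixes x :: "nat \<Rightarrow> 'a::banach"
  assumes "\<And>k. norm (x (Suc k) - x k) \<le> c * (1 / 2) ^ k"
  shows "\<exists>l. \<forall>k. norm (l - x k) \<le> 2 * c * (1 / 2) ^ k"
proof -
  define y where "y k = x (Suc k) - x k" for k
  have "summable (\<lambda>k. c * (1 / 2) ^ k :: real)"
    by (intro summable_mult summable_geometric) auto
  then have "summable y"
    by (rule summable_comparison_test') (simp add: y_def assms)
  define l where "l = x 0 + suminf y"
  have "norm (l - x k) \<le> 2 * c * (1 / 2) ^ k" for k
  proof -
    have "(\<Sum>j<k. y j) = x k - x 0"
      unfolding y_def by (rule sum_lessThan_telescope)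
    then have "l - x k = (\<Sum>j. y (j + k))"
      using suminf_split_initial_segment[OF \<open>summable y\<close>, of k] by (simp add: l_def)
    have g: "(\<lambda>j. c * (1 / 2) ^ k * (1 / 2) ^ j) sums (c * (1 / 2) ^ k * (1 / (1 - 1 / 2) :: real))"
      by (intro sums_mult geometric_sums) auto
    have "norm (\<Sum>j. y (j + k)) \<le> (\<Sum>j. c * (1 / 2) ^ k * (1 / 2) ^ j)"
    proof (rule norm_suminf_le)
      show "norm (y (j + k)) \<le> c * (1 / 2) ^ k * (1 / 2) ^ j" for j
        using assms[of "j + k"] by (simp add: y_def power_add mult_ac)
    qed (use g in \<open>simp add: sums_iff\<close>)
    also have "\<dots> = 2 * c * (1 / 2) ^ k"
      using sums_unique[OF g] by simp
    finally show ?thesis using \<open>l - x k = _\<close> by simp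
  qed
  then show ?thesis by blast
qed

lemma vec_holomorphic_uniform_limit:
  assumes "open S" "\<And>k. vec_holomorphic (f k) S"
    and "\<And>k s. s \<in> S \<Longrightarrow> norm (g s - f k s) \<le> B k" "B \<longlonglongrightarrow> 0"
  shows "vec_holomorphic g S"
  unfolding vec_holomorphic_def
proof
  fix i
  show "(\<lambda>s. g s $ i) holomorphic_on S"
  proof (rule holomorphic_uniform_limit_on_open[OF \<open>open S\<close>])
    show "(\<lambda>s. f k s $ i) holomorphic_on S" for k
      using assms(2) by (simp add: vec_holomorphic_def)
    show "uniform_limit S (\<lambda>k s. f k s $ i) (\<lambda>s. g s $ i) sequentially"
      using assms(4)
    proof (rule uniform_limit_le_null_sequence[rotated])
      fix k s assume "s \<in> S"
      then show "dist (f k s $ i) (g s $ i) \<le> B k"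
        using norm_component_le[OF assms(3), of s k i] by (simp add: dist_norm norm_minus_commute)
    qed
  qed
qed

lemma sep_holomorphic_diagonal:
  assumes "open U" "0 < r" "sep_holomorphic U (ball 0 r) f"
    and M: "\<And>\<zeta> s. \<zeta> \<in> U \<Longrightarrow> s \<in> ball 0 r \<Longrightarrow> norm (f \<zeta> s) \<le> M"
    and "\<sigma> holomorphic_on U" "\<sigma> ` U \<subseteq> ball 0 r"
  shows "vec_holomorphic (\<lambda>\<zeta>. f \<zeta> (\<sigma> \<zeta>)) U"
  unfolding vec_holomorphic_def
proof
  fix i
  show "(\<lambda>\<zeta>. f \<zeta> (\<sigma> \<zeta>) $ i) holomorphic_on U"
  proof (rule holomorphic_diagonal[where f = "\<lambda>\<zeta> s. f \<zeta> s $ i", OF assms(1,2) _ _ _ assms(5,6)])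
    show "norm (f \<zeta> s $ i) \<le> M" if "\<zeta> \<in> U" "s \<in> ball 0 r" for \<zeta> s
      by (rule norm_component_le[OF M[OF that]])
  qed (use assms(3) in \<open>auto simp: sep_holomorphic_def vec_holomorphic_def\<close>)
qed

context nonresonant
begin

text \<open>
  A Lipschitz constant \<open>\<epsilon>\<^sub>0\<close> of the nonlinearity for which the solution operator is a contraction with
  factor \<open>1 / 2\<close> on every disc, and for which solutions are unique.
\<close>

definition \<epsilon>\<^sub>0 :: real where
  "\<epsilon>\<^sub>0 = (SOME \<epsilon>. 0 < \<epsilon> \<and> \<epsilon> < \<kappa> \<and> (\<forall>r f M s. 0 < r \<longrightarrow> vec_holomorphic f (ball 0 r) \<longrightarrow>
     (\<forall>s\<in>ball 0 r. norm (f s) \<le> M) \<longrightarrow> s \<in> ball 0 r \<longrightarrow> \<epsilon> * norm (euler_inv \<nu> f s) \<le> M / 2))"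

lemma \<epsilon>\<^sub>0: "0 < \<epsilon>\<^sub>0" "\<epsilon>\<^sub>0 < \<kappa>"
  and \<epsilon>\<^sub>0_bound: "\<lbrakk>0 < r; vec_holomorphic f (ball 0 r); \<And>s. s \<in> ball 0 r \<Longrightarrow> norm (f s) \<le> M; s \<in> ball 0 r\<rbrakk>
    \<Longrightarrow> \<epsilon>\<^sub>0 * norm (euler_inv \<nu> f s) \<le> M / 2"
proof -
  obtain K where K: "0 < K" "\<And>r f M s. 0 < r \<Longrightarrow> vec_holomorphic f (ball 0 r) \<Longrightarrow>
      (\<forall>s\<in>ball 0 r. norm (f s) \<le> M) \<Longrightarrow> s \<in> ball 0 r \<Longrightarrow> norm (euler_inv \<nu> f s) \<le> K * M"
    using euler_inv_bound by blast
  define \<epsilon> where "\<epsilon> = min (\<kappa> / 2) (1 / (2 * K))"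
  have "0 < \<epsilon>" "\<epsilon> < \<kappa>" "\<epsilon> * K \<le> 1 / 2"
    using K(1) \<kappa>_pos by (auto simp: \<epsilon>_def min_def field_simps)
  moreover have "\<epsilon> * norm (euler_inv \<nu> f s) \<le> M / 2"
    if "0 < r" "vec_holomorphic f (ball 0 r)" "\<forall>s\<in>ball 0 r. norm (f s) \<le> M" "s \<in> ball 0 r" for r f M s
  proof -
    have "0 \<le> M" using that by (intro order_trans[OF norm_ge_zero, of "f s"]) auto
    have "\<epsilon> * norm (euler_inv \<nu> f s) \<le> \<epsilon> * (K * M)"
      using \<open>0 < \<epsilon>\<close> by (intro mult_left_mono K(2)[OF that]) auto
    also have "\<dots> \<le> 1 / 2 * M"
      unfolding mult.assoc[symmetric] by (intro mult_right_mono \<open>\<epsilon> * K \<le> 1 / 2\<close> \<open>0 \<le> M\<close>)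
    finally show ?thesis by simp
  qed
  ultimately have "\<exists>\<epsilon>. 0 < \<epsilon> \<and> \<epsilon> < \<kappa> \<and> (\<forall>r f M s. 0 < r \<longrightarrow> vec_holomorphic f (ball 0 r) \<longrightarrow>
     (\<forall>s\<in>ball 0 r. norm (f s) \<le> M) \<longrightarrow> s \<in> ball 0 r \<longrightarrow> \<epsilon> * norm (euler_inv \<nu> f s) \<le> M / 2)"
    by blast
  from someI_ex[OF this]
  have "0 < \<epsilon>\<^sub>0 \<and> \<epsilon>\<^sub>0 < \<kappa> \<and> (\<forall>r f M s. 0 < r \<longrightarrow> vec_holomorphic f (ball 0 r) \<longrightarrow>
     (\<forall>s\<in>ball 0 r. norm (f s) \<le> M) \<longrightarrow> s \<in> ball 0 r \<longrightarrow> \<epsilon>\<^sub>0 * norm (euler_inv \<nu> f s) \<le> M / 2)"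
    unfolding \<epsilon>\<^sub>0_def .
  then show "0 < \<epsilon>\<^sub>0" "\<epsilon>\<^sub>0 < \<kappa>" "\<lbrakk>0 < r; vec_holomorphic f (ball 0 r);
      \<And>s. s \<in> ball 0 r \<Longrightarrow> norm (f s) \<le> M; s \<in> ball 0 r\<rbrakk> \<Longrightarrow> \<epsilon>\<^sub>0 * norm (euler_inv \<nu> f s) \<le> M / 2"
    by blast+
qed

lemma briot_bouquet_unique:
  assumes "0 < r" "vec_holomorphic v (ball 0 r)" "vec_holomorphic v' (ball 0 r)"
    and eq: "\<And>s. s \<in> ball 0 r \<Longrightarrow> s *s vec_deriv v s = \<nu> *v v s + h s"
      "\<And>s. s \<in> ball 0 r \<Longrightarrow> s *s vec_deriv v' s = \<nu> *v v' s + h' s"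
    and lip: "\<And>s. s \<in> ball 0 r \<Longrightarrow> norm (h s - h' s) \<le> \<epsilon>\<^sub>0 * norm (v s - v' s)"
    and s: "s \<in> ball 0 r"
  shows "v s = v' s"
proof -
  have "v s - v' s = 0"
  proof (rule singular_equation_unique[OF \<open>0 < r\<close> _ nonresonant' \<epsilon>\<^sub>0(2) _ s])
    show "vec_holomorphic (\<lambda>s. v s - v' s) (ball 0 r)"
      using assms(2,3) by (auto simp: vec_holomorphic_def intro!: holomorphic_intros)
    fix s :: complex assume s: "s \<in> ball 0 r"
    have "vec_deriv (\<lambda>s. v s - v' s) s = vec_deriv v s - vec_deriv v' s"
      using has_field_derivative_vec_deriv[OF assms(2) open_ball s]
        has_field_derivative_vec_deriv[OF assms(3) open_ball s]
      by (intro vec_derivI) (auto intro!: derivative_intros)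
    then have "s *s vec_deriv (\<lambda>s. v s - v' s) s - \<nu> *v (v s - v' s) = h s - h' s"
      using eq[OF s] by (simp add: vec.scale_right_diff_distrib matrix_vector_mult_diff_distrib)
    then show "norm (s *s vec_deriv (\<lambda>s. v s - v' s) s - \<nu> *v (v s - v' s)) \<le> \<epsilon>\<^sub>0 * norm (v s - v' s)"
      using lip[OF s] by simp
  qed
  then show ?thesis by simp
qed

text \<open>
  Existence, by Picard iteration of \<open>v \<mapsto> euler_inv \<nu> (h v)\<close>, a contraction by the choice of
  \<open>\<epsilon>\<^sub>0\<close>. All iterates are separately holomorphic and converge uniformly.
\<close>

lemma briot_bouquet:
  assumes "open U" "0 < r" "0 < \<rho>"
    and lip: "\<And>\<zeta> s v v'. \<zeta> \<in> U \<Longrightarrow> s \<in> ball 0 r \<Longrightarrow> norm v \<le> \<rho> \<Longrightarrow> norm v' \<le> \<rho> \<Longrightarrow>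
      norm (h \<zeta> s v - h \<zeta> s v') \<le> \<epsilon>\<^sub>0 * norm (v - v')"
    and small: "\<And>\<zeta> s. \<zeta> \<in> U \<Longrightarrow> s \<in> ball 0 r \<Longrightarrow> norm (h \<zeta> s 0) \<le> \<epsilon>\<^sub>0 * \<rho>"
    and hol: "\<And>v. sep_holomorphic U (ball 0 r) v \<Longrightarrow>
      (\<And>\<zeta> s. \<zeta> \<in> U \<Longrightarrow> s \<in> ball 0 r \<Longrightarrow> norm (v \<zeta> s) \<le> \<rho>) \<Longrightarrow>
      sep_holomorphic U (ball 0 r) (\<lambda>\<zeta> s. h \<zeta> s (v \<zeta> s))"
  shows "\<exists>v. sep_holomorphic U (ball 0 r) v \<and> (\<forall>\<zeta>\<in>U. \<forall>s\<in>ball 0 r.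
    norm (v \<zeta> s) \<le> \<rho> \<and> s *s vec_deriv (v \<zeta>) s = \<nu> *v v \<zeta> s + h \<zeta> s (v \<zeta> s))"
proof -
  define T where "T v \<zeta> = euler_inv \<nu> (\<lambda>s. h \<zeta> s (v \<zeta> s))" for v \<zeta>
  define ok where "ok v \<longleftrightarrow> sep_holomorphic U (ball 0 r) v \<and> (\<forall>\<zeta>\<in>U. \<forall>s\<in>ball 0 r. norm (v \<zeta> s) \<le> \<rho>)"
    for v :: "complex \<Rightarrow> complex \<Rightarrow> complex ^ 'n"
  have ok_hol: "sep_holomorphic U (ball 0 r) (\<lambda>\<zeta> s. h \<zeta> s (v \<zeta> s))" if "ok v" for v
    using that by (intro hol) (auto simp: ok_def)
  have ok_holv: "vec_holomorphic (\<lambda>s. h \<zeta> s (v \<zeta> s)) (ball 0 r)" if "ok v" "\<zeta> \<in> U" for v \<zeta>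
    using ok_hol[OF that(1)] that(2) by (auto simp: sep_holomorphic_def)
  have ok_bound: "norm (h \<zeta> s (v \<zeta> s)) \<le> 2 * \<epsilon>\<^sub>0 * \<rho>" if "ok v" "\<zeta> \<in> U" "s \<in> ball 0 r" for v \<zeta> s
  proof -
    have v: "norm (v \<zeta> s) \<le> \<rho>" using that by (auto simp: ok_def)
    have "norm (h \<zeta> s (v \<zeta> s) - h \<zeta> s 0) \<le> \<epsilon>\<^sub>0 * norm (v \<zeta> s - 0)"
      using \<open>0 < \<rho>\<close> by (intro lip that v) auto
    also have "\<dots> \<le> \<epsilon>\<^sub>0 * \<rho>" using \<epsilon>\<^sub>0(1) v by simp
    finally show ?thesis
      using small[OF that(2,3)] norm_triangle_sub[of "h \<zeta> s (v \<zeta> s)" "h \<zeta> s 0"] by simp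
  qed
  have T_ok: "ok (T v)" if "ok v" for v
    unfolding ok_def
  proof (intro conjI ballI)
    show "sep_holomorphic U (ball 0 r) (T v)"
      unfolding T_def by (rule euler_inv_sep_holomorphic[OF \<open>open U\<close> \<open>0 < r\<close> ok_hol[OF that] ok_bound[OF that]])
    fix \<zeta> s assume "\<zeta> \<in> U" "s \<in> ball (0::complex) r"
    then have "\<epsilon>\<^sub>0 * norm (T v \<zeta> s) \<le> (2 * \<epsilon>\<^sub>0 * \<rho>) / 2"
      unfolding T_def using that by (intro \<epsilon>\<^sub>0_bound[OF \<open>0 < r\<close>] ok_holv ok_bound)
    then show "norm (T v \<zeta> s) \<le> \<rho>" using \<epsilon>\<^sub>0(1) by simp
  qed
  have T_lip: "norm (T v \<zeta> s - T v' \<zeta> s) \<le> B / 2"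
    if "ok v" "ok v'" "\<zeta> \<in> U" "s \<in> ball 0 r" and B: "\<And>s. s \<in> ball 0 r \<Longrightarrow> norm (v \<zeta> s - v' \<zeta> s) \<le> B"
    for v v' \<zeta> s B
  proof -
    have "\<epsilon>\<^sub>0 * norm (euler_inv \<nu> (\<lambda>s. h \<zeta> s (v \<zeta> s) - h \<zeta> s (v' \<zeta> s)) s) \<le> (\<epsilon>\<^sub>0 * B) / 2"
    proof (rule \<epsilon>\<^sub>0_bound[OF \<open>0 < r\<close> _ _ that(4)])
      show "vec_holomorphic (\<lambda>s. h \<zeta> s (v \<zeta> s) - h \<zeta> s (v' \<zeta> s)) (ball 0 r)"
        using ok_holv[OF that(1,3)] ok_holv[OF that(2,3)]
        by (auto simp: vec_holomorphic_def intro!: holomorphic_intros)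
      fix s :: complex assume s: "s \<in> ball 0 r"
      have "norm (h \<zeta> s (v \<zeta> s) - h \<zeta> s (v' \<zeta> s)) \<le> \<epsilon>\<^sub>0 * norm (v \<zeta> s - v' \<zeta> s)"
        using that(1-3) s by (intro lip) (auto simp: ok_def)
      also have "\<dots> \<le> \<epsilon>\<^sub>0 * B" using \<epsilon>\<^sub>0(1) B[OF s] by simp
      finally show "norm (h \<zeta> s (v \<zeta> s) - h \<zeta> s (v' \<zeta> s)) \<le> \<epsilon>\<^sub>0 * B" .
    qed
    moreover have "euler_inv \<nu> (\<lambda>s. h \<zeta> s (v \<zeta> s) - h \<zeta> s (v' \<zeta> s)) s = T v \<zeta> s - T v' \<zeta> s"
      unfolding T_def
      by (rule euler_inv_diff[OF \<open>0 < r\<close> ok_holv[OF that(1,3)] ok_bound[OF that(1,3)]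
            ok_holv[OF that(2,3)] ok_bound[OF that(2,3)] that(4)])
    ultimately show ?thesis using \<epsilon>\<^sub>0(1) by simp
  qed
  define V where "V k = (T ^^ k) (\<lambda>_ _. 0)" for k
  have V_ok: "ok (V k)" for k
  proof (induction k)
    case 0
    then show ?case using \<open>0 < \<rho>\<close>
      by (auto simp: V_def ok_def sep_holomorphic_def vec_holomorphic_def)
  next
    case (Suc k)
    then show ?case using T_ok by (simp add: V_def)
  qed
  have V_diff: "norm (V (Suc k) \<zeta> s - V k \<zeta> s) \<le> \<rho> * (1 / 2) ^ k" if "\<zeta> \<in> U" "s \<in> ball 0 r" for k \<zeta> s
    using that
  proof (induction k arbitrary: s)
    case 0
    then show ?case using V_ok[of 1] by (simp add: V_def ok_def)
  next
    case (Suc k)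
    have "norm (T (V (Suc k)) \<zeta> s - T (V k) \<zeta> s) \<le> (\<rho> * (1 / 2) ^ k) / 2"
      using Suc by (intro T_lip V_ok) auto
    then show ?case by (simp add: V_def)
  qed
  have "\<exists>l. \<forall>k. norm (l - V k \<zeta> s) \<le> 2 * \<rho> * (1 / 2) ^ k" if "\<zeta> \<in> U" "s \<in> ball 0 r" for \<zeta> s
    by (rule geometric_differences_limit[of "\<lambda>k. V k \<zeta> s" \<rho>]) (rule V_diff[OF that])
  then obtain v where v: "\<And>\<zeta> s k. \<zeta> \<in> U \<Longrightarrow> s \<in> ball 0 r \<Longrightarrow> norm (v \<zeta> s - V k \<zeta> s) \<le> 2 * \<rho> * (1 / 2) ^ k"
    by metis
  have lim0: "(\<lambda>k. 2 * \<rho> * (1 / 2) ^ k) \<longlonglongrightarrow> 0"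
    using tendsto_mult[OF tendsto_const[of "2 * \<rho>"] LIMSEQ_power_zero[of "1 / 2 :: real"]] by simp
  have V_lim: "(\<lambda>k. V k \<zeta> s) \<longlonglongrightarrow> v \<zeta> s" if "\<zeta> \<in> U" "s \<in> ball 0 r" for \<zeta> s
  proof -
    have "(\<lambda>k. V k \<zeta> s - v \<zeta> s) \<longlonglongrightarrow> 0"
      by (rule Lim_null_comparison[OF _ lim0]) (use v[OF that] in \<open>simp add: norm_minus_commute\<close>)
    then show ?thesis by (simp add: LIM_zero_iff)
  qed
  have v_ok: "ok v"
    unfolding ok_def sep_holomorphic_def
  proof (intro conjI ballI)
    fix \<zeta> assume "\<zeta> \<in> U"
    then show "vec_holomorphic (v \<zeta>) (ball 0 r)"
      using V_ok by (intro vec_holomorphic_uniform_limit[OF open_ball _ v lim0])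
        (auto simp: ok_def sep_holomorphic_def)
  next
    fix s :: complex assume "s \<in> ball 0 r"
    then show "vec_holomorphic (\<lambda>\<zeta>. v \<zeta> s) U"
      using V_ok by (intro vec_holomorphic_uniform_limit[OF \<open>open U\<close> _ v lim0])
        (auto simp: ok_def sep_holomorphic_def)
  next
    fix \<zeta> s assume *: "\<zeta> \<in> U" "s \<in> ball (0::complex) r"
    show "norm (v \<zeta> s) \<le> \<rho>"
      by (rule tendsto_upperbound[OF tendsto_norm[OF V_lim[OF *]]])
         (use V_ok * in \<open>auto simp: ok_def\<close>)
  qed
  have fix_v: "T v \<zeta> s = v \<zeta> s" if "\<zeta> \<in> U" "s \<in> ball 0 r" for \<zeta> s
  proof -
    have "(\<lambda>k. V (Suc k) \<zeta> s - T v \<zeta> s) \<longlonglongrightarrow> 0"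
    proof (rule Lim_null_comparison[OF _ lim0], intro always_eventually allI)
      fix k
      have "norm (T v \<zeta> s - T (V k) \<zeta> s) \<le> (2 * \<rho> * (1 / 2) ^ k) / 2"
        using that by (intro T_lip v_ok V_ok v)
      also have "\<dots> \<le> 2 * \<rho> * (1 / 2) ^ k" using \<open>0 < \<rho>\<close> by simp
      finally show "norm (V (Suc k) \<zeta> s - T v \<zeta> s) \<le> 2 * \<rho> * (1 / 2) ^ k"
        by (simp add: V_def norm_minus_commute)
    qed
    then have "(\<lambda>k. V (Suc k) \<zeta> s) \<longlonglongrightarrow> T v \<zeta> s" by (simp add: LIM_zero_iff)
    moreover have "(\<lambda>k. V (Suc k) \<zeta> s) \<longlonglongrightarrow> v \<zeta> s"
      using V_lim[OF that] by (rule LIMSEQ_Suc)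
    ultimately show ?thesis by (rule LIMSEQ_unique)
  qed
  have "s *s vec_deriv (v \<zeta>) s = \<nu> *v v \<zeta> s + h \<zeta> s (v \<zeta> s)" if "\<zeta> \<in> U" "s \<in> ball 0 r" for \<zeta> s
  proof -
    have "vec_holomorphic (T v \<zeta>) (ball 0 r)"
      using T_ok[OF v_ok] that by (auto simp: ok_def sep_holomorphic_def)
    then have "vec_deriv (v \<zeta>) s = vec_deriv (T v \<zeta>) s"
      by (intro vec_derivI has_field_derivative_transform_within_open[OF
            has_field_derivative_vec_deriv[OF _ open_ball that(2)] open_ball that(2)])
         (auto simp: fix_v[OF that(1)])
    then show ?thesis
      using euler_inv_solves[OF \<open>0 < r\<close> ok_holv[OF v_ok that(1)] ok_bound[OF v_ok that(1)] that(2)]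
        fix_v[OF that] by (simp add: T_def)
  qed
  then show ?thesis using v_ok unfolding ok_def by (intro exI[of _ v]) auto
qed

text \<open>
  With parameters in \<open>\<complex>\<^sup>d\<close>: the solution is found separately for each parameter, and uniqueness
  identifies it along a holomorphic curve of parameters with the solution for that curve.
\<close>

lemma briot_bouquet_parametric:
  fixes G :: "complex ^ 'd \<Rightarrow> complex \<Rightarrow> complex ^ 'n \<Rightarrow> complex ^ 'n"
  assumes "0 < r" "0 < \<rho>"
    and lip: "\<And>x s v v'. x \<in> X \<Longrightarrow> s \<in> ball 0 r \<Longrightarrow> norm v \<le> \<rho> \<Longrightarrow> norm v' \<le> \<rho> \<Longrightarrow>
      norm (G x s v - G x s v') \<le> \<epsilon>\<^sub>0 * norm (v - v')"
    and small: "\<And>x s. x \<in> X \<Longrightarrow> s \<in> ball 0 r \<Longrightarrow> norm (G x s 0) \<le> \<epsilon>\<^sub>0 * \<rho>"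
    and hol: "\<And>U x v. open U \<Longrightarrow> vec_holomorphic x U \<Longrightarrow> x ` U \<subseteq> X \<Longrightarrow> sep_holomorphic U (ball 0 r) v \<Longrightarrow>
      (\<And>\<zeta> s. \<zeta> \<in> U \<Longrightarrow> s \<in> ball 0 r \<Longrightarrow> norm (v \<zeta> s) \<le> \<rho>) \<Longrightarrow>
      sep_holomorphic U (ball 0 r) (\<lambda>\<zeta> s. G (x \<zeta>) s (v \<zeta> s))"
  obtains Y :: "complex ^ 'd \<Rightarrow> complex \<Rightarrow> complex ^ 'n" where
    "\<And>x. x \<in> X \<Longrightarrow> vec_holomorphic (Y x) (ball 0 r)"
    "\<And>x s. x \<in> X \<Longrightarrow> s \<in> ball 0 r \<Longrightarrow> norm (Y x s) \<le> \<rho>"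
    "\<And>x s. x \<in> X \<Longrightarrow> s \<in> ball 0 r \<Longrightarrow> s *s vec_deriv (Y x) s = \<nu> *v Y x s + G x s (Y x s)"
    "\<And>U x. open U \<Longrightarrow> vec_holomorphic x U \<Longrightarrow> x ` U \<subseteq> X \<Longrightarrow> sep_holomorphic U (ball 0 r) (\<lambda>\<zeta>. Y (x \<zeta>))"
proof -
  have family: "\<exists>v. sep_holomorphic U (ball 0 r) v \<and> (\<forall>\<zeta>\<in>U. \<forall>s\<in>ball 0 r.
      norm (v \<zeta> s) \<le> \<rho> \<and> s *s vec_deriv (v \<zeta>) s = \<nu> *v v \<zeta> s + G (x \<zeta>) s (v \<zeta> s))"
    if "open U" "vec_holomorphic x U" "x ` U \<subseteq> X" for U and x :: "complex \<Rightarrow> complex ^ 'd"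
    using that by (intro briot_bouquet \<open>0 < r\<close> \<open>0 < \<rho>\<close> lip small hol) auto
  have "\<exists>y. vec_holomorphic y (ball 0 r) \<and> (\<forall>s\<in>ball 0 r.
      norm (y s) \<le> \<rho> \<and> s *s vec_deriv y s = \<nu> *v y s + G x s (y s))" if "x \<in> X" for x
    using family[of UNIV "\<lambda>_. x"] that by (fastforce simp: vec_holomorphic_def[of "\<lambda>_. x"] sep_holomorphic_def)
  then obtain Y where Y: "\<And>x. x \<in> X \<Longrightarrow> vec_holomorphic (Y x) (ball 0 r)"
    "\<And>x s. x \<in> X \<Longrightarrow> s \<in> ball 0 r \<Longrightarrow> norm (Y x s) \<le> \<rho>"
    "\<And>x s. x \<in> X \<Longrightarrow> s \<in> ball 0 r \<Longrightarrow> s *s vec_deriv (Y x) s = \<nu> *v Y x s + G x s (Y x s)"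
    by metis
  have "sep_holomorphic U (ball 0 r) (\<lambda>\<zeta>. Y (x \<zeta>))"
    if U: "open U" "vec_holomorphic x U" "x ` U \<subseteq> X" for U x
  proof -
    obtain v where v: "sep_holomorphic U (ball 0 r) v" "\<And>\<zeta> s. \<zeta> \<in> U \<Longrightarrow> s \<in> ball 0 r \<Longrightarrow> norm (v \<zeta> s) \<le> \<rho>"
      "\<And>\<zeta> s. \<zeta> \<in> U \<Longrightarrow> s \<in> ball 0 r \<Longrightarrow> s *s vec_deriv (v \<zeta>) s = \<nu> *v v \<zeta> s + G (x \<zeta>) s (v \<zeta> s)"
      using family[OF U] by blast
    have eq: "Y (x \<zeta>) s = v \<zeta> s" if "\<zeta> \<in> U" "s \<in> ball 0 r" for \<zeta> s
    proof (rule briot_bouquet_unique[OF \<open>0 < r\<close> _ _ Y(3) v(3) _ that(2)])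
      show "x \<zeta> \<in> X" using that U by auto
      then show "vec_holomorphic (Y (x \<zeta>)) (ball 0 r)" by (rule Y)
      show "vec_holomorphic (v \<zeta>) (ball 0 r)" using v(1) that by (auto simp: sep_holomorphic_def)
      show "norm (G (x \<zeta>) s (Y (x \<zeta>) s) - G (x \<zeta>) s (v \<zeta> s)) \<le> \<epsilon>\<^sub>0 * norm (Y (x \<zeta>) s - v \<zeta> s)"
        if "s \<in> ball 0 r" for s
        using that \<open>\<zeta> \<in> U\<close> \<open>x \<zeta> \<in> X\<close> by (intro lip Y v)
    qed (use that in auto)
    show ?thesis
      unfolding sep_holomorphic_def
    proof (intro conjI ballI)
      fix \<zeta> assume "\<zeta> \<in> U"
      then show "vec_holomorphic (Y (x \<zeta>)) (ball 0 r)" using U(3) by (intro Y) auto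
    next
      fix s :: complex assume s: "s \<in> ball 0 r"
      have "vec_holomorphic (\<lambda>\<zeta>. v \<zeta> s) U" using v(1) s by (auto simp: sep_holomorphic_def)
      then show "vec_holomorphic (\<lambda>\<zeta>. Y (x \<zeta>) s) U"
        unfolding vec_holomorphic_def using eq s by (auto cong: holomorphic_cong)
    qed
  qed
  then show ?thesis using Y by (intro that)
qed

end

section \<open>The flow of a holomorphic vector field\<close>

text \<open>
  Holomorphy in several variables is tested along holomorphic curves. This notion passes trivially
  through compositions, and the arguments below differentiate in one variable only.
\<close>

definition curve_holomorphic_on ::
    "(complex ^ 'd \<Rightarrow> complex ^ 'n) \<Rightarrow> (complex ^ 'd) set \<Rightarrow> bool" where
  "curve_holomorphic_on f A \<longleftrightarrow> (\<forall>V \<gamma>. open V \<longrightarrow> vec_holomorphic \<gamma> V \<longrightarrow> \<gamma> ` V \<subseteq> A \<longrightarrow>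
     vec_holomorphic (\<lambda>t. f (\<gamma> t)) V)"

lemma curve_holomorphic_onD:
  "\<lbrakk>curve_holomorphic_on f A; open V; vec_holomorphic \<gamma> V; \<gamma> ` V \<subseteq> A\<rbrakk> \<Longrightarrow> vec_holomorphic (\<lambda>t. f (\<gamma> t)) V"
  by (auto simp: curve_holomorphic_on_def)

lemma vec_holomorphic_const: "vec_holomorphic (\<lambda>_. c) S"
  by (simp add: vec_holomorphic_def)

lemma vec_holomorphic_add:
  "vec_holomorphic f S \<Longrightarrow> vec_holomorphic g S \<Longrightarrow> vec_holomorphic (\<lambda>s. f s + g s) S"
  by (auto simp: vec_holomorphic_def intro!: holomorphic_intros)

lemma vec_holomorphic_diff:
  "vec_holomorphic f S \<Longrightarrow> vec_holomorphic g S \<Longrightarrow> vec_holomorphic (\<lambda>s. f s - g s) S"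
  by (auto simp: vec_holomorphic_def intro!: holomorphic_intros)

lemma vec_holomorphic_smult:
  "c holomorphic_on S \<Longrightarrow> vec_holomorphic g S \<Longrightarrow> vec_holomorphic (\<lambda>s. c s *s g s) S"
  by (auto simp: vec_holomorphic_def intro!: holomorphic_intros)

lemma vec_holomorphic_matrix:
  "vec_holomorphic g S \<Longrightarrow> vec_holomorphic (\<lambda>s. A *v g s) S"
  by (auto simp: vec_holomorphic_def matrix_vector_mult_def intro!: holomorphic_intros)

lemma vec_holomorphic_subset:
  "vec_holomorphic f T \<Longrightarrow> S \<subseteq> T \<Longrightarrow> vec_holomorphic f S"
  by (auto simp: vec_holomorphic_def intro: holomorphic_on_subset)

lemma vec_holomorphic_compose:
  assumes "vec_holomorphic f T" "\<sigma> holomorphic_on S" "\<sigma> ` S \<subseteq> T"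
  shows "vec_holomorphic (\<lambda>s. f (\<sigma> s)) S"
  using assms holomorphic_on_compose_gen[OF assms(2) _ assms(3)]
  by (auto simp: vec_holomorphic_def o_def)

text \<open>Cauchy's estimate along the complex line through two points.\<close>

lemma lipschitz_of_bounded_holomorphic:
  fixes f :: "complex ^ 'n::finite \<Rightarrow> complex ^ 'm::finite"
  assumes "0 < \<rho>" and f: "curve_holomorphic_on f (ball 0 (2 * \<rho>))"
    and M: "\<And>z. z \<in> ball 0 (2 * \<rho>) \<Longrightarrow> norm (f z) \<le> M"
    and a: "norm a \<le> \<rho>" and b: "norm b \<le> \<rho>"
  shows "norm (f a - f b) \<le> real CARD('m) * (2 * M / \<rho>) * norm (a - b)"
proof (cases "a = b")
  case False
  define \<delta> where "\<delta> = norm (a - b)"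
  have "0 < \<delta>" using False by (simp add: \<delta>_def)
  define L where "L t = b + t *s (a - b)" for t
  define V where "V = L -` ball 0 (2 * \<rho>)"
  have Lhol: "vec_holomorphic L S" for S
    unfolding L_def by (intro vec_holomorphic_add vec_holomorphic_const vec_holomorphic_smult holomorphic_on_ident)
  have "open V"
    unfolding V_def by (rule open_vimage[OF open_ball vec_holomorphic_continuous[OF Lhol]])
  have fL: "vec_holomorphic (\<lambda>t. f (L t)) V"
    by (rule curve_holomorphic_onD[OF f \<open>open V\<close> Lhol]) (auto simp: V_def)
  have seg: "norm (L t) \<le> \<rho>" if t: "t \<in> closed_segment 0 1" for t
  proof -
    obtain u where u: "0 \<le> u" "u \<le> 1" "t = of_real u"
      using t by (auto simp: in_segment scaleR_conv_of_real)
    have "L t = (1 - t) *s b + t *s a"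
      by (simp add: L_def vec_eq_iff algebra_simps)
    then have "norm (L t) \<le> norm (1 - t) * norm b + norm t * norm a"
      using norm_triangle_ineq[of "(1 - t) *s b" "t *s a"] by (simp only: norm_vector_smult)
    also have "norm (1 - t) = 1 - u" using u norm_of_real[of "1 - u", where 'a = complex] by simp
    also have "norm t = u" using u by simp
    also have "(1 - u) * norm b + u * norm a \<le> (1 - u) * \<rho> + u * \<rho>"
      using u a b by (intro add_mono mult_left_mono) auto
    finally show ?thesis by (simp add: algebra_simps)
  qed
  have disc: "cball t (\<rho> / (2 * \<delta>)) \<subseteq> V" if t: "t \<in> closed_segment 0 1" for t
  proof
    fix z assume "z \<in> cball t (\<rho> / (2 * \<delta>))"
    then have "norm (z - t) * \<delta> \<le> \<rho> / 2"
      using \<open>0 < \<delta>\<close> by (simp add: dist_norm norm_minus_commute field_simps)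
    moreover have "L z = L t + (z - t) *s (a - b)"
      by (simp add: L_def vec_eq_iff algebra_simps)
    then have "norm (L z) \<le> norm (L t) + norm (z - t) * \<delta>"
      using norm_triangle_ineq[of "L t" "(z - t) *s (a - b)"] by (simp only: norm_vector_smult \<delta>_def)
    ultimately have "norm (L z) \<le> \<rho> + \<rho> / 2"
      using seg[OF t] by linarith
    then show "z \<in> V" using \<open>0 < \<rho>\<close> by (simp add: V_def)
  qed
  have "norm (f a $ i - f b $ i) \<le> (2 * M / \<rho>) * \<delta>" for i
  proof -
    let ?\<phi> = "\<lambda>t. f (L t) $ i"
    have \<phi>: "?\<phi> holomorphic_on V" using fL by (simp add: vec_holomorphic_def)
    have "norm (?\<phi> 1 - ?\<phi> 0) \<le> (2 * M / \<rho> * \<delta>) * norm (1 - 0 :: complex)"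
    proof (rule field_differentiable_bound[where S = "closed_segment 0 1" and f' = "deriv ?\<phi>"])
      fix t :: complex assume t: "t \<in> closed_segment 0 1"
      have "t \<in> V" using disc[OF t] \<open>0 < \<rho>\<close> \<open>0 < \<delta>\<close> by auto
      then show "(?\<phi> has_field_derivative deriv ?\<phi> t) (at t within closed_segment 0 1)"
        by (rule holomorphic_derivI[OF \<phi> \<open>open V\<close>])
      have "norm ((deriv ^^ 1) ?\<phi> t) \<le> fact 1 * M / (\<rho> / (2 * \<delta>)) ^ 1"
      proof (rule Cauchy_inequality)
        show "?\<phi> holomorphic_on ball t (\<rho> / (2 * \<delta>))" "continuous_on (cball t (\<rho> / (2 * \<delta>))) ?\<phi>"
          using disc[OF t] ball_subset_cball
          by (auto intro!: holomorphic_on_imp_continuous_on holomorphic_on_subset[OF \<phi>])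
        show "norm (?\<phi> z) \<le> M" if "norm (t - z) = \<rho> / (2 * \<delta>)" for z
        proof -
          have "z \<in> V" using disc[OF t] that by (auto simp: dist_norm)
          then show ?thesis by (intro norm_component_le M) (simp add: V_def)
        qed
      qed (use \<open>0 < \<rho>\<close> \<open>0 < \<delta>\<close> in auto)
      then show "norm (deriv ?\<phi> t) \<le> 2 * M / \<rho> * \<delta>"
        using \<open>0 < \<rho>\<close> \<open>0 < \<delta>\<close> by (simp add: field_simps)
    qed auto
    then show ?thesis by (simp add: L_def)
  qed
  then have "norm (f a - f b) \<le> real CARD('m) * ((2 * M / \<rho>) * \<delta>)"
    by (intro norm_vec_le_card) simp
  then show ?thesis by (simp add: \<delta>_def)
qed simp

lemma nonresonant_minus_one: "nonresonant (mat (- 1) :: complex ^ 'd ^ 'd::finite) 1"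
proof
  fix n :: nat and z :: "complex ^ 'd"
  have "of_nat n *s z - mat (- 1) *v z = of_nat (Suc n) *s z"
    by (simp add: mat_vector_mult vec_eq_iff algebra_simps)
  then have "norm (of_nat n *s z - mat (- 1) *v z) = real (Suc n) * norm z"
    by (simp only: norm_vector_smult norm_of_nat)
  then show "1 * (real n + 1) * norm z \<le> norm (of_nat n *s z - mat (- 1) *v z)"
    by (simp add: add.commute)
qed simp

text \<open>
  For \<open>w = s g\<close> the differential inequality \<open>|w'| \<le> \<Lambda> |w|\<close> reads \<open>|s g' + g| \<le> \<Lambda> |s| |g|\<close>, a singular
  equation with matrix \<open>-1\<close>.
\<close>

lemma ode_unique:
  fixes w :: "complex \<Rightarrow> complex ^ 'd::finite"
  assumes "0 < r" "vec_holomorphic w (ball 0 r)" "w 0 = 0"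
    and le: "\<And>s. s \<in> ball 0 r \<Longrightarrow> norm (vec_deriv w s) \<le> \<Lambda> * norm (w s)"
    and "0 \<le> \<Lambda>" "\<Lambda> * r < 1" and s: "s \<in> ball 0 r"
  shows "w s = 0"
proof -
  interpret nonresonant "mat (- 1) :: complex ^ 'd ^ 'd" 1 by (rule nonresonant_minus_one)
  obtain g where g: "vec_holomorphic g (ball 0 r)" "\<And>s. s \<in> ball 0 r \<Longrightarrow> w s = s *s g s"
    using vec_holomorphic_factor_zero[OF assms(2,3)] by blast
  have "g s = 0"
  proof (rule singular_equation_unique[OF \<open>0 < r\<close> g(1) nonresonant' \<open>\<Lambda> * r < 1\<close> _ s])
    fix s :: complex assume s: "s \<in> ball 0 r"
    have "vec_deriv w s = s *s vec_deriv g s + g s"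
    proof (rule vec_derivI)
      fix i
      have "((\<lambda>s. s * g s $ i) has_field_derivative (s * vec_deriv g s $ i + g s $ i)) (at s)"
        by (auto intro!: derivative_eq_intros has_field_derivative_vec_deriv[OF g(1) open_ball s])
      then have "((\<lambda>s. w s $ i) has_field_derivative (s * vec_deriv g s $ i + g s $ i)) (at s)"
        by (rule has_field_derivative_transform_within_open[OF _ open_ball s]) (simp add: g(2))
      then show "((\<lambda>s. w s $ i) has_field_derivative (s *s vec_deriv g s + g s) $ i) (at s)"
        by simp
    qed
    then have "s *s vec_deriv g s - mat (- 1) *v g s = vec_deriv w s"
      by (simp add: mat_vector_mult vec_eq_iff)
    then have "norm (s *s vec_deriv g s - mat (- 1) *v g s) \<le> \<Lambda> * (norm s * norm (g s))"
      using le[OF s] g(2)[OF s] by (simp add: norm_vector_smult)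
    also have "\<dots> \<le> \<Lambda> * (r * norm (g s))"
      using s \<open>0 \<le> \<Lambda>\<close> by (intro mult_left_mono mult_right_mono) auto
    finally show "norm (s *s vec_deriv g s - mat (- 1) *v g s) \<le> \<Lambda> * r * norm (g s)"
      by (simp add: mult.assoc)
  qed
  then show ?thesis using g(2)[OF s] by simp
qed

locale local_flow =
  fixes b :: "complex ^ 'd::finite \<Rightarrow> complex ^ 'd" and R \<tau> \<delta> C :: real
    and \<Phi> :: "complex \<Rightarrow> complex ^ 'd \<Rightarrow> complex ^ 'd"
  assumes \<tau>_pos: "0 < \<tau>" and \<delta>_pos: "0 < \<delta>" and C_nonneg: "0 \<le> C"
    and flow_hol: "\<And>x. x \<in> ball 0 \<delta> \<Longrightarrow> vec_holomorphic (\<lambda>t. \<Phi> t x) (ball 0 \<tau>)"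
    and flow_deriv: "\<And>x t. x \<in> ball 0 \<delta> \<Longrightarrow> t \<in> ball 0 \<tau> \<Longrightarrow> vec_deriv (\<lambda>t. \<Phi> t x) t = b (\<Phi> t x)"
    and flow_mem: "\<And>x t. x \<in> ball 0 \<delta> \<Longrightarrow> t \<in> ball 0 \<tau> \<Longrightarrow> \<Phi> t x \<in> ball 0 R"
    and flow_0: "\<And>x. \<Phi> 0 x = x"
    and flow_dist: "\<And>x t. x \<in> ball 0 \<delta> \<Longrightarrow> t \<in> ball 0 \<tau> \<Longrightarrow> norm (\<Phi> t x - x) \<le> C * norm t"
    and flow_sep: "\<And>U x. open U \<Longrightarrow> vec_holomorphic x U \<Longrightarrow> x ` U \<subseteq> ball 0 \<delta> \<Longrightarrow>
       sep_holomorphic U (ball 0 \<tau>) (\<lambda>\<zeta> t. \<Phi> t (x \<zeta>))"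
    and flow_add: "\<And>x t\<^sub>0 t r. x \<in> ball 0 \<delta> \<Longrightarrow> 0 < r \<Longrightarrow> norm t\<^sub>0 + r \<le> \<tau> \<Longrightarrow>
       \<Phi> t\<^sub>0 x \<in> ball 0 \<delta> \<Longrightarrow> t \<in> ball 0 r \<Longrightarrow> \<Phi> (t\<^sub>0 + t) x = \<Phi> t (\<Phi> t\<^sub>0 x)"
begin

lemma shrink:
  assumes "0 < \<delta>'" "\<delta>' \<le> \<delta>"
  shows "local_flow b R \<tau> \<delta>' C \<Phi>"
proof
  have sub: "x \<in> ball 0 \<delta>" if "x \<in> ball 0 \<delta>'" for x :: "complex ^ 'd"
    using that assms(2) by simp
  show "sep_holomorphic U (ball 0 \<tau>) (\<lambda>\<zeta> t. \<Phi> t (x \<zeta>))"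
    if "open U" "vec_holomorphic x U" "x ` U \<subseteq> ball 0 \<delta>'" for U x
    using that sub by (intro flow_sep) auto
  show "\<Phi> (t\<^sub>0 + t) x = \<Phi> t (\<Phi> t\<^sub>0 x)"
    if "x \<in> ball 0 \<delta>'" "0 < r" "norm t\<^sub>0 + r \<le> \<tau>" "\<Phi> t\<^sub>0 x \<in> ball 0 \<delta>'" "t \<in> ball 0 r" for x t\<^sub>0 t r
    by (rule flow_add[OF sub[OF that(1)] that(2,3) sub[OF that(4)] that(5)])
  show "\<Phi> t x \<in> ball 0 R" if "x \<in> ball 0 \<delta>'" "t \<in> ball 0 \<tau>" for x t
    by (rule flow_mem[OF sub[OF that(1)] that(2)])
qed (use assms(2) in \<open>auto intro!: assms(1) \<tau>_pos C_nonneg flow_hol flow_deriv flow_dist flow_0\<close>)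

end

text \<open>
  With \<open>\<Phi>\<^sub>t(x) = x + t \<Psi>\<close>, the flow equation becomes \<open>t \<Psi>' = - \<Psi> + b(x + t \<Psi>)\<close>, to which the theory
  of the singular equation applies; the Lipschitz constant in \<open>\<Psi>\<close> is small because of the factor
  \<open>t\<close>.
\<close>

lemma local_flow_exists:
  fixes b :: "complex ^ 'd::finite \<Rightarrow> complex ^ 'd"
  assumes "0 < R" and b: "curve_holomorphic_on b (ball 0 R)"
    and M: "\<And>x. x \<in> ball 0 R \<Longrightarrow> norm (b x) \<le> M"
  shows "\<exists>\<tau> \<delta> C \<Phi>. local_flow b R \<tau> \<delta> C \<Phi>"
proof -
  interpret nonresonant "mat (- 1) :: complex ^ 'd ^ 'd" 1 by (rule nonresonant_minus_one)
  have "0 \<le> M" using \<open>0 < R\<close> by (intro order_trans[OF norm_ge_zero M[of 0]]) simp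
  define \<Lambda> where "\<Lambda> = real CARD('d) * (2 * M / (R / 2))"
  have "0 \<le> \<Lambda>" using \<open>0 \<le> M\<close> \<open>0 < R\<close> by (simp add: \<Lambda>_def)
  have lip: "norm (b x - b x') \<le> \<Lambda> * norm (x - x')" if "norm x \<le> R / 2" "norm x' \<le> R / 2" for x x'
    unfolding \<Lambda>_def using that \<open>0 < R\<close> b M by (intro lipschitz_of_bounded_holomorphic) auto
  define \<rho> where "\<rho> = M / \<epsilon>\<^sub>0 + 1"
  have "0 < \<rho>" using \<open>0 \<le> M\<close> \<epsilon>\<^sub>0(1) by (simp add: \<rho>_def add_nonneg_pos)
  have "M \<le> \<epsilon>\<^sub>0 * \<rho>" using \<epsilon>\<^sub>0(1) by (simp add: \<rho>_def field_simps)
  define \<delta> where "\<delta> = R / 4"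
  define \<tau> where "\<tau> = min (R / (4 * \<rho>)) (\<epsilon>\<^sub>0 / (\<Lambda> + 1))"
  have "0 < \<tau>" "0 < \<delta>" using \<open>0 < R\<close> \<open>0 < \<rho>\<close> \<epsilon>\<^sub>0(1) \<open>0 \<le> \<Lambda>\<close> by (auto simp: \<tau>_def \<delta>_def)
  have \<tau>1: "\<tau> * \<rho> \<le> R / 4"
  proof -
    have "\<tau> * \<rho> \<le> R / (4 * \<rho>) * \<rho>" using \<open>0 < \<rho>\<close> by (intro mult_right_mono) (auto simp: \<tau>_def)
    then show ?thesis using \<open>0 < \<rho>\<close> by simp
  qed
  have \<tau>2: "\<Lambda> * \<tau> \<le> \<epsilon>\<^sub>0"
  proof -
    have "\<Lambda> * \<tau> \<le> (\<Lambda> + 1) * (\<epsilon>\<^sub>0 / (\<Lambda> + 1))"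
      using \<open>0 < \<tau>\<close> \<open>0 \<le> \<Lambda>\<close> by (intro mult_mono) (auto simp: \<tau>_def)
    then show ?thesis using \<open>0 \<le> \<Lambda>\<close> by simp
  qed
  have "\<Lambda> * \<tau> < 1" using \<tau>2 \<epsilon>\<^sub>0(2) by simp
  have near: "norm (x + t *s v) \<le> R / 2"
    if "x \<in> ball 0 \<delta>" "t \<in> ball 0 \<tau>" "norm v \<le> \<rho>" for x v :: "complex ^ 'd" and t
  proof -
    have "norm t * norm v \<le> \<tau> * \<rho>" using that \<open>0 < \<tau>\<close> by (intro mult_mono) auto
    then show ?thesis
      using norm_triangle_ineq[of x "t *s v"] that(1) \<tau>1 by (simp add: norm_vector_smult \<delta>_def)
  qed
  have near': "x + t *s v \<in> ball 0 R"
    if "x \<in> ball 0 \<delta>" "t \<in> ball 0 \<tau>" "norm v \<le> \<rho>" for x v :: "complex ^ 'd" and t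
    using near[OF that] \<open>0 < R\<close> by simp
  define G where "G x t v = b (x + t *s v)" for x v :: "complex ^ 'd" and t
  obtain \<Psi> :: "complex ^ 'd \<Rightarrow> complex \<Rightarrow> complex ^ 'd" where
    \<Psi>1: "\<And>x. x \<in> ball 0 \<delta> \<Longrightarrow> vec_holomorphic (\<Psi> x) (ball 0 \<tau>)" and
    \<Psi>2: "\<And>x s. x \<in> ball 0 \<delta> \<Longrightarrow> s \<in> ball 0 \<tau> \<Longrightarrow> norm (\<Psi> x s) \<le> \<rho>" and
    \<Psi>3: "\<And>x s. x \<in> ball 0 \<delta> \<Longrightarrow> s \<in> ball 0 \<tau> \<Longrightarrow>
      s *s vec_deriv (\<Psi> x) s = mat (- 1) *v \<Psi> x s + G x s (\<Psi> x s)" and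
    \<Psi>4: "\<And>U x. open U \<Longrightarrow> vec_holomorphic x U \<Longrightarrow> x ` U \<subseteq> ball 0 \<delta> \<Longrightarrow>
      sep_holomorphic U (ball 0 \<tau>) (\<lambda>\<zeta>. \<Psi> (x \<zeta>))"
  proof (rule briot_bouquet_parametric[where X = "ball 0 \<delta>" and G = G, OF \<open>0 < \<tau>\<close> \<open>0 < \<rho>\<close>])
    fix x v v' :: "complex ^ 'd" and s :: complex
    assume *: "x \<in> ball 0 \<delta>" "s \<in> ball 0 \<tau>" "norm v \<le> \<rho>" "norm v' \<le> \<rho>"
    have "norm (G x s v - G x s v') \<le> \<Lambda> * norm (s *s (v - v'))"
      using lip[OF near[OF *(1,2,3)] near[OF *(1,2,4)]]
      by (simp add: G_def vec.scale_right_diff_distrib)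
    also have "\<dots> = \<Lambda> * norm s * norm (v - v')"
      by (simp only: norm_vector_smult mult.assoc)
    also have "\<dots> \<le> \<epsilon>\<^sub>0 * norm (v - v')"
      using * \<open>0 \<le> \<Lambda>\<close> by (intro mult_right_mono order_trans[OF _ \<tau>2] mult_left_mono) auto
    finally show "norm (G x s v - G x s v') \<le> \<epsilon>\<^sub>0 * norm (v - v')" .
  next
    fix x :: "complex ^ 'd" and s :: complex
    assume *: "x \<in> ball 0 \<delta>" "s \<in> ball 0 \<tau>"
    have "norm (G x s 0) \<le> M"
      unfolding G_def using \<open>0 < \<rho>\<close> by (intro M near' *) auto
    then show "norm (G x s 0) \<le> \<epsilon>\<^sub>0 * \<rho>" using \<open>M \<le> \<epsilon>\<^sub>0 * \<rho>\<close> by simp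
  next
    fix U and x :: "complex \<Rightarrow> complex ^ 'd" and v :: "complex \<Rightarrow> complex \<Rightarrow> complex ^ 'd"
    assume U: "open U" "vec_holomorphic x U" "x ` U \<subseteq> ball 0 \<delta>" and v: "sep_holomorphic U (ball 0 \<tau>) v"
      "\<And>\<zeta> s. \<zeta> \<in> U \<Longrightarrow> s \<in> ball 0 \<tau> \<Longrightarrow> norm (v \<zeta> s) \<le> \<rho>"
    show "sep_holomorphic U (ball 0 \<tau>) (\<lambda>\<zeta> s. G (x \<zeta>) s (v \<zeta> s))"
      unfolding sep_holomorphic_def
    proof (intro conjI ballI)
      fix \<zeta> assume \<zeta>: "\<zeta> \<in> U"
      show "vec_holomorphic (\<lambda>s. G (x \<zeta>) s (v \<zeta> s)) (ball 0 \<tau>)"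
        unfolding G_def
      proof (rule curve_holomorphic_onD[OF b open_ball])
        show "vec_holomorphic (\<lambda>s. x \<zeta> + s *s v \<zeta> s) (ball 0 \<tau>)"
          using v(1) \<zeta> by (intro vec_holomorphic_add vec_holomorphic_const vec_holomorphic_smult holomorphic_on_ident)
            (auto simp: sep_holomorphic_def)
        show "(\<lambda>s. x \<zeta> + s *s v \<zeta> s) ` ball 0 \<tau> \<subseteq> ball 0 R"
          using U(3) \<zeta> v(2) near' by blast
      qed
    next
      fix s :: complex assume s: "s \<in> ball 0 \<tau>"
      show "vec_holomorphic (\<lambda>\<zeta>. G (x \<zeta>) s (v \<zeta> s)) U"
        unfolding G_def
      proof (rule curve_holomorphic_onD[OF b \<open>open U\<close>])
        show "vec_holomorphic (\<lambda>\<zeta>. x \<zeta> + s *s v \<zeta> s) U"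
          using v(1) s by (intro vec_holomorphic_add U(2) vec_holomorphic_smult holomorphic_on_const)
            (auto simp: sep_holomorphic_def)
        show "(\<lambda>\<zeta>. x \<zeta> + s *s v \<zeta> s) ` U \<subseteq> ball 0 R"
          using U(3) s v(2) near' by blast
      qed
    qed
  qed (rule that)
  define \<Phi> where "\<Phi> t x = x + t *s \<Psi> x t" for t x
  have hol: "vec_holomorphic (\<lambda>t. \<Phi> t x) (ball 0 \<tau>)" if "x \<in> ball 0 \<delta>" for x
    unfolding \<Phi>_def by (intro vec_holomorphic_add vec_holomorphic_const vec_holomorphic_smult holomorphic_on_ident \<Psi>1 that)
  have half: "norm (\<Phi> t x) \<le> R / 2" if "x \<in> ball 0 \<delta>" "t \<in> ball 0 \<tau>" for t x
    unfolding \<Phi>_def using that by (intro near \<Psi>2)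
  have der: "vec_deriv (\<lambda>t. \<Phi> t x) t = b (\<Phi> t x)" if x: "x \<in> ball 0 \<delta>" and t: "t \<in> ball 0 \<tau>" for x t
  proof -
    have "vec_deriv (\<lambda>t. \<Phi> t x) t = t *s vec_deriv (\<Psi> x) t + \<Psi> x t"
      unfolding \<Phi>_def
      by (rule vec_derivI) (auto intro!: derivative_eq_intros has_field_derivative_vec_deriv[OF \<Psi>1[OF x] open_ball t])
    also have "\<dots> = b (\<Phi> t x)"
      using \<Psi>3[OF x t] by (simp add: \<Phi>_def G_def mat_vector_mult vec_eq_iff)
    finally show ?thesis .
  qed
  have "local_flow b R \<tau> \<delta> \<rho> \<Phi>"
  proof
    show "0 < \<tau>" "0 < \<delta>" "0 \<le> \<rho>" by (fact | use \<open>0 < \<rho>\<close> in simp)+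
    show "vec_holomorphic (\<lambda>t. \<Phi> t x) (ball 0 \<tau>)" if "x \<in> ball 0 \<delta>" for x by (rule hol[OF that])
    show "vec_deriv (\<lambda>t. \<Phi> t x) t = b (\<Phi> t x)" if "x \<in> ball 0 \<delta>" "t \<in> ball 0 \<tau>" for x t
      by (rule der[OF that])
    show "\<Phi> t x \<in> ball 0 R" if "x \<in> ball 0 \<delta>" "t \<in> ball 0 \<tau>" for x t
      unfolding \<Phi>_def using that by (intro near' \<Psi>2)
    show "\<Phi> 0 x = x" for x by (simp add: \<Phi>_def)
    show "norm (\<Phi> t x - x) \<le> \<rho> * norm t" if "x \<in> ball 0 \<delta>" "t \<in> ball 0 \<tau>" for x t
      using mult_left_mono[OF \<Psi>2[OF that], of "norm t"] by (simp add: \<Phi>_def norm_vector_smult mult.commute)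
    show "sep_holomorphic U (ball 0 \<tau>) (\<lambda>\<zeta> t. \<Phi> t (x \<zeta>))"
      if U: "open U" "vec_holomorphic x U" "x ` U \<subseteq> ball 0 \<delta>" for U x
      using \<Psi>4[OF U] U(2) unfolding sep_holomorphic_def \<Phi>_def
      by (auto intro!: vec_holomorphic_add vec_holomorphic_const vec_holomorphic_smult)
    show "\<Phi> (t\<^sub>0 + t) x = \<Phi> t (\<Phi> t\<^sub>0 x)"
      if x: "x \<in> ball 0 \<delta>" and "0 < r" and r: "norm t\<^sub>0 + r \<le> \<tau>" and y: "\<Phi> t\<^sub>0 x \<in> ball 0 \<delta>" and t: "t \<in> ball 0 r"
      for x t\<^sub>0 t r
    proof -
      let ?y = "\<Phi> t\<^sub>0 x"
      have sub: "ball 0 r \<subseteq> ball (0::complex) \<tau>" using r norm_ge_zero[of t\<^sub>0] by (intro subset_ball) linarith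
      have sum: "t\<^sub>0 + s \<in> ball 0 \<tau>" if "s \<in> ball 0 r" for s
        using that r norm_triangle_ineq[of t\<^sub>0 s] by simp
      have h1: "vec_holomorphic (\<lambda>s. \<Phi> (t\<^sub>0 + s) x) (ball 0 r)"
        by (intro vec_holomorphic_compose[OF hol[OF x]] holomorphic_intros image_subsetI sum)
      have h2: "vec_holomorphic (\<lambda>s. \<Phi> s ?y) (ball 0 r)"
        by (rule vec_holomorphic_subset[OF hol[OF y] sub])
      have "\<Phi> (t\<^sub>0 + t) x - \<Phi> t ?y = 0"
      proof (rule ode_unique[OF \<open>0 < r\<close> _ _ _ \<open>0 \<le> \<Lambda>\<close> _ t])
        show "vec_holomorphic (\<lambda>s. \<Phi> (t\<^sub>0 + s) x - \<Phi> s ?y) (ball 0 r)"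
          by (intro vec_holomorphic_diff h1 h2)
        show "\<Phi> (t\<^sub>0 + 0) x - \<Phi> 0 ?y = 0" by (simp add: \<Phi>_def[of 0])
        have "\<Lambda> * r \<le> \<Lambda> * \<tau>" using r \<open>0 \<le> \<Lambda>\<close> norm_ge_zero[of t\<^sub>0] by (intro mult_left_mono) linarith+
        then show "\<Lambda> * r < 1" using \<open>\<Lambda> * \<tau> < 1\<close> by simp
        fix s :: complex assume s: "s \<in> ball 0 r"
        have d1: "((\<lambda>s. \<Phi> (t\<^sub>0 + s) x $ i) has_field_derivative vec_deriv (\<lambda>t. \<Phi> t x) (t\<^sub>0 + s) $ i) (at s)" for i
          using has_field_derivative_vec_deriv[OF hol[OF x] open_ball sum[OF s], of i]
          by (simp add: DERIV_shift add.commute)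
        have d2: "((\<lambda>s. \<Phi> s ?y $ i) has_field_derivative vec_deriv (\<lambda>t. \<Phi> t ?y) s $ i) (at s)" for i
          using has_field_derivative_vec_deriv[OF hol[OF y] open_ball, of s i] s sub by blast
        have "vec_deriv (\<lambda>s. \<Phi> (t\<^sub>0 + s) x - \<Phi> s ?y) s = vec_deriv (\<lambda>t. \<Phi> t x) (t\<^sub>0 + s) - vec_deriv (\<lambda>t. \<Phi> t ?y) s"
          by (rule vec_derivI) (use DERIV_diff[OF d1 d2] in simp)
        also have "\<dots> = b (\<Phi> (t\<^sub>0 + s) x) - b (\<Phi> s ?y)"
          using der[OF x sum[OF s]] der[OF y, of s] s sub by auto
        finally show "norm (vec_deriv (\<lambda>s. \<Phi> (t\<^sub>0 + s) x - \<Phi> s ?y) s) \<le> \<Lambda> * norm (\<Phi> (t\<^sub>0 + s) x - \<Phi> s ?y)"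
          using lip[OF half[OF x sum[OF s]] half[OF y, of s]] s sub by auto
      qed
      then show ?thesis by simp
    qed
  qed
  then show ?thesis by blast
qed

section \<open>Systems with a vector field transversal to the zero set of P\<close>

text \<open>
  The function \<open>P\<close> is the time along the flow; the flow is defined for times that are large
  compared with the values of \<open>P\<close>, so that the zero set of \<open>P\<close> and the level sets near it can be reached.
\<close>

locale flow_with_time = local_flow b R "4 * \<sigma>" \<delta> C \<Phi>
  for b :: "complex ^ 'd::finite \<Rightarrow> complex ^ 'd" and R \<sigma> \<delta> C :: real and \<Phi> +
  fixes P :: "complex ^ 'd \<Rightarrow> complex"
  assumes \<delta>_le: "\<delta> \<le> R"
    and P_lt: "\<And>x. x \<in> ball 0 \<delta> \<Longrightarrow> norm (P x) < \<sigma>"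
    and time: "\<And>x t. x \<in> ball 0 \<delta> \<Longrightarrow> t \<in> ball 0 (4 * \<sigma>) \<Longrightarrow> P (\<Phi> t x) = P x + t"
begin

lemma \<sigma>_pos: "0 < \<sigma>"
  using \<tau>_pos by simp

end

locale transversal_field =
  fixes b :: "complex ^ 'd::finite \<Rightarrow> complex ^ 'd" and P :: "complex ^ 'd \<Rightarrow> complex" and R M :: real
  assumes R_pos: "0 < R"
    and b_hol: "curve_holomorphic_on b (ball 0 R)"
    and b_bound: "\<And>x. x \<in> ball 0 R \<Longrightarrow> norm (b x) \<le> M"
    and P_hol: "\<And>V \<gamma>. open V \<Longrightarrow> vec_holomorphic \<gamma> V \<Longrightarrow> \<gamma> ` V \<subseteq> ball 0 R \<Longrightarrow>
      (\<lambda>t. P (\<gamma> t)) holomorphic_on V"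
    and P_deriv: "\<And>V \<gamma> t. open V \<Longrightarrow> vec_holomorphic \<gamma> V \<Longrightarrow> \<gamma> ` V \<subseteq> ball 0 R \<Longrightarrow> t \<in> V \<Longrightarrow>
      vec_deriv \<gamma> t = b (\<gamma> t) \<Longrightarrow> deriv (\<lambda>t. P (\<gamma> t)) t = 1"
    and P_small: "\<And>e. 0 < e \<Longrightarrow> \<exists>d>0. \<forall>x\<in>ball 0 d. norm (P x) < e"
begin

lemma P_0: "P 0 = 0"
proof (rule ccontr)
  assume "P 0 \<noteq> 0"
  then obtain d where "d > 0" "\<forall>x\<in>ball 0 d. norm (P x) < norm (P 0)"
    using P_small[of "norm (P 0)"] by auto
  then show False by auto
qed

lemma flow_with_time_exists: "\<exists>\<sigma> \<delta> C \<Phi>. flow_with_time b R \<sigma> \<delta> C \<Phi> P"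
proof -
  obtain \<tau> \<delta>\<^sub>1 C \<Phi> where "local_flow b R \<tau> \<delta>\<^sub>1 C \<Phi>"
    using local_flow_exists[OF R_pos b_hol b_bound] by blast
  then interpret f: local_flow b R \<tau> \<delta>\<^sub>1 C \<Phi> .
  define \<sigma> where "\<sigma> = \<tau> / 4"
  have \<tau>: "\<tau> = 4 * \<sigma>" by (simp add: \<sigma>_def)
  have "0 < \<sigma>" using f.\<tau>_pos by (simp add: \<sigma>_def)
  obtain d where d: "0 < d" "\<forall>x\<in>ball 0 d. norm (P x) < \<sigma>"
    using P_small[OF \<open>0 < \<sigma>\<close>] by blast
  define \<delta> where "\<delta> = min d (min \<delta>\<^sub>1 R)"
  have \<delta>: "0 < \<delta>" "\<delta> \<le> R" using d(1) f.\<delta>_pos R_pos by (auto simp: \<delta>_def)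
  have sub: "x \<in> ball 0 \<delta>\<^sub>1" if "x \<in> ball 0 \<delta>" for x :: "complex ^ 'd" using that by (simp add: \<delta>_def)
  have time: "P (\<Phi> t x) = P x + t" if x: "x \<in> ball 0 \<delta>" and t: "t \<in> ball 0 \<tau>" for x t
  proof -
    let ?p = "\<lambda>t. P (\<Phi> t x)"
    have im: "(\<lambda>t. \<Phi> t x) ` ball 0 \<tau> \<subseteq> ball 0 R"
      by (intro image_subsetI f.flow_mem sub x)
    have "((\<lambda>t. ?p t - t) has_field_derivative 0) (at t within ball 0 \<tau>)" if t: "t \<in> ball 0 \<tau>" for t
    proof -
      have "(?p has_field_derivative deriv ?p t) (at t within ball 0 \<tau>)"
        by (rule holomorphic_derivI[OF P_hol[OF open_ball f.flow_hol[OF sub[OF x]] im] open_ball t])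
      also have "deriv ?p t = 1"
        by (rule P_deriv[OF open_ball f.flow_hol[OF sub[OF x]] im t f.flow_deriv[OF sub[OF x] t]])
      finally show ?thesis by (auto intro!: derivative_eq_intros)
    qed
    then have "\<exists>c. \<forall>t\<in>ball 0 \<tau>. ?p t - t = c"
      by (rule has_field_derivative_zero_constant[OF convex_ball])
    then obtain c where c: "\<And>t. t \<in> ball 0 \<tau> \<Longrightarrow> ?p t - t = c"
      by blast
    show ?thesis using c[OF t] c[of 0] f.\<tau>_pos f.flow_0 by (simp add: algebra_simps)
  qed
  have "local_flow b R (4 * \<sigma>) \<delta> C \<Phi>"
    using f.shrink[of \<delta>] \<delta>(1) by (simp add: \<delta>_def \<tau>)
  then have "flow_with_time b R \<sigma> \<delta> C \<Phi> P"
    by (rule flow_with_time.intro) (unfold_locales, use \<delta> d(2) time in \<open>auto simp: \<delta>_def \<tau>\<close>)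
  then show ?thesis by blast
qed

end

text \<open>
  The system \<open>P \<cdot> (dy/dt) = F(x, y)\<close> along the integral curves of \<open>b\<close>, with \<open>F\<close> a small perturbation of
  the linear map \<open>\<nu>\<close>.
\<close>

locale transversal_system = transversal_field b P R M + nonresonant \<nu> \<kappa>
  for b :: "complex ^ 'd::finite \<Rightarrow> complex ^ 'd" and P R M
    and \<nu> :: "complex ^ 'n ^ 'n::finite" and \<kappa> +
  fixes F :: "complex ^ 'd \<Rightarrow> complex ^ 'n \<Rightarrow> complex ^ 'n" and \<rho> :: real
  assumes \<rho>_pos: "0 < \<rho>"
    and F_hol: "\<And>V \<gamma> v. open V \<Longrightarrow> vec_holomorphic \<gamma> V \<Longrightarrow> \<gamma> ` V \<subseteq> ball 0 R \<Longrightarrow> vec_holomorphic v V \<Longrightarrow>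
      (\<And>t. t \<in> V \<Longrightarrow> norm (v t) \<le> \<rho>) \<Longrightarrow> vec_holomorphic (\<lambda>t. F (\<gamma> t) (v t)) V"
    and F_lip: "\<And>x v v'. x \<in> ball 0 R \<Longrightarrow> norm v \<le> \<rho> \<Longrightarrow> norm v' \<le> \<rho> \<Longrightarrow>
      norm ((F x v - \<nu> *v v) - (F x v' - \<nu> *v v')) \<le> \<epsilon>\<^sub>0 * norm (v - v')"
    and F_small: "\<And>x. x \<in> ball 0 R \<Longrightarrow> norm (F x 0) \<le> \<epsilon>\<^sub>0 * \<rho>"
    and F_0: "F 0 0 = 0"
begin

text \<open>
  The solution is \<open>y(x) = Y(P(x), x)\<close>, where \<open>Y(\<cdot>, x)\<close> solves the singular equation along the integral
  curve through \<open>x\<close>, parametrised by the value of \<open>P\<close>. The curve \<open>\<gamma>\<close> in the conclusion is this integral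
  curve, and the system is expressed by the derivative of \<open>y\<close> along it.
\<close>

theorem existence:
  "\<exists>\<delta>>0. \<exists>y. (\<forall>x\<in>ball 0 \<delta>. norm (y x) \<le> \<rho>) \<and> curve_holomorphic_on y (ball 0 \<delta>) \<and> y 0 = 0 \<and>
    (\<forall>x\<in>ball 0 \<delta>. \<exists>e>0. \<exists>\<gamma>. vec_holomorphic \<gamma> (ball 0 e) \<and> \<gamma> ` ball 0 e \<subseteq> ball 0 \<delta> \<and> \<gamma> 0 = x \<and>
      vec_deriv \<gamma> 0 = b x \<and> P x *s vec_deriv (\<lambda>t. y (\<gamma> t)) 0 = F x (y x))"
proof -
  obtain \<sigma> \<delta> C \<Phi> where "flow_with_time b R \<sigma> \<delta> C \<Phi> P"
    using flow_with_time_exists by blast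
  then interpret flow_with_time b R \<sigma> \<delta> C \<Phi> P .
  define \<Gamma> where "\<Gamma> s x = \<Phi> (s - P x) x" for s x
  have shift: "s - P x \<in> ball 0 (4 * \<sigma>)" if "x \<in> ball 0 \<delta>" "s \<in> ball 0 \<sigma>" for s x
    using that(2) P_lt[OF that(1)] norm_triangle_ineq4[of s "P x"] \<sigma>_pos by simp
  have \<Gamma>R: "\<Gamma> s x \<in> ball 0 R" if "x \<in> ball 0 \<delta>" "s \<in> ball 0 \<sigma>" for s x
    unfolding \<Gamma>_def by (rule flow_mem[OF that(1) shift[OF that]])
  define G where "G x s v = F (\<Gamma> s x) v - \<nu> *v v" for x s v
  have G_lip: "norm (G x s v - G x s v') \<le> \<epsilon>\<^sub>0 * norm (v - v')"
    if "x \<in> ball 0 \<delta>" "s \<in> ball 0 \<sigma>" "norm v \<le> \<rho>" "norm v' \<le> \<rho>" for x s v v'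
    unfolding G_def by (rule F_lip[OF \<Gamma>R[OF that(1,2)] that(3,4)])
  obtain Y :: "complex ^ 'd \<Rightarrow> complex \<Rightarrow> complex ^ 'n" where
    Y1: "\<And>x. x \<in> ball 0 \<delta> \<Longrightarrow> vec_holomorphic (Y x) (ball 0 \<sigma>)" and
    Y2: "\<And>x s. x \<in> ball 0 \<delta> \<Longrightarrow> s \<in> ball 0 \<sigma> \<Longrightarrow> norm (Y x s) \<le> \<rho>" and
    Y3: "\<And>x s. x \<in> ball 0 \<delta> \<Longrightarrow> s \<in> ball 0 \<sigma> \<Longrightarrow> s *s vec_deriv (Y x) s = \<nu> *v Y x s + G x s (Y x s)" and
    Y4: "\<And>U x. open U \<Longrightarrow> vec_holomorphic x U \<Longrightarrow> x ` U \<subseteq> ball 0 \<delta> \<Longrightarrow>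
      sep_holomorphic U (ball 0 \<sigma>) (\<lambda>\<zeta>. Y (x \<zeta>))"
  proof (rule briot_bouquet_parametric[where X = "ball 0 \<delta>" and G = G, OF \<sigma>_pos \<rho>_pos])
    show "norm (G x s v - G x s v') \<le> \<epsilon>\<^sub>0 * norm (v - v')"
      if "x \<in> ball 0 \<delta>" "s \<in> ball 0 \<sigma>" "norm v \<le> \<rho>" "norm v' \<le> \<rho>" for x s v v'
      by (rule G_lip[OF that])
    show "norm (G x s 0) \<le> \<epsilon>\<^sub>0 * \<rho>" if "x \<in> ball 0 \<delta>" "s \<in> ball 0 \<sigma>" for x s
      using F_small[OF \<Gamma>R[OF that]] by (simp add: G_def)
    fix U and x :: "complex \<Rightarrow> complex ^ 'd" and v :: "complex \<Rightarrow> complex \<Rightarrow> complex ^ 'n"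
    assume U: "open U" "vec_holomorphic x U" "x ` U \<subseteq> ball 0 \<delta>" and v: "sep_holomorphic U (ball 0 \<sigma>) v"
      "\<And>\<zeta> s. \<zeta> \<in> U \<Longrightarrow> s \<in> ball 0 \<sigma> \<Longrightarrow> norm (v \<zeta> s) \<le> \<rho>"
    have xU: "x \<zeta> \<in> ball 0 \<delta>" if "\<zeta> \<in> U" for \<zeta> using U(3) that by auto
    show "sep_holomorphic U (ball 0 \<sigma>) (\<lambda>\<zeta> s. G (x \<zeta>) s (v \<zeta> s))"
      unfolding sep_holomorphic_def
    proof (intro conjI ballI)
      fix \<zeta> assume \<zeta>: "\<zeta> \<in> U"
      have v\<zeta>: "vec_holomorphic (v \<zeta>) (ball 0 \<sigma>)" using v(1) \<zeta> by (auto simp: sep_holomorphic_def)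
      have "vec_holomorphic (\<lambda>s. \<Gamma> s (x \<zeta>)) (ball 0 \<sigma>)"
        unfolding \<Gamma>_def
        by (intro vec_holomorphic_compose[OF flow_hol[OF xU[OF \<zeta>]]] holomorphic_intros image_subsetI shift xU \<zeta>)
      then show "vec_holomorphic (\<lambda>s. G (x \<zeta>) s (v \<zeta> s)) (ball 0 \<sigma>)"
        unfolding G_def using v(2)[OF \<zeta>] \<Gamma>R[OF xU[OF \<zeta>]]
        by (intro vec_holomorphic_diff vec_holomorphic_matrix F_hol open_ball v\<zeta> image_subsetI) auto
    next
      fix s :: complex assume s: "s \<in> ball 0 \<sigma>"
      have vs: "vec_holomorphic (\<lambda>\<zeta>. v \<zeta> s) U" using v(1) s by (auto simp: sep_holomorphic_def)
      have "vec_holomorphic (\<lambda>\<zeta>. \<Phi> (s - P (x \<zeta>)) (x \<zeta>)) U"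
      proof (rule sep_holomorphic_diagonal[OF \<open>open U\<close> _ flow_sep[OF U]])
        show "(\<lambda>\<zeta>. s - P (x \<zeta>)) holomorphic_on U"
          using U(3) \<delta>_le by (intro holomorphic_intros P_hol U(1,2)) force
        show "(\<lambda>\<zeta>. s - P (x \<zeta>)) ` U \<subseteq> ball 0 (4 * \<sigma>)"
          by (intro image_subsetI shift xU s)
        show "norm (\<Phi> t (x \<zeta>)) \<le> R" if "\<zeta> \<in> U" "t \<in> ball 0 (4 * \<sigma>)" for \<zeta> t
          using flow_mem[OF xU[OF that(1)] that(2)] by simp
      qed (use \<sigma>_pos in auto)
      then show "vec_holomorphic (\<lambda>\<zeta>. G (x \<zeta>) s (v \<zeta> s)) U"
        unfolding G_def \<Gamma>_def using v(2)[OF _ s] \<Gamma>R[OF xU s, unfolded \<Gamma>_def]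
        by (intro vec_holomorphic_diff vec_holomorphic_matrix F_hol \<open>open U\<close> vs image_subsetI) auto
    qed
  qed (rule that)
  have P_mem: "P x \<in> ball 0 \<sigma>" if "x \<in> ball 0 \<delta>" for x using P_lt[OF that] by simp
  define y where "y x = Y x (P x)" for x
  have y_bound: "norm (y x) \<le> \<rho>" if "x \<in> ball 0 \<delta>" for x
    unfolding y_def by (rule Y2[OF that P_mem[OF that]])
  have y_hol: "curve_holomorphic_on y (ball 0 \<delta>)"
    unfolding curve_holomorphic_on_def
  proof (intro allI impI)
    fix V and \<gamma> :: "complex \<Rightarrow> complex ^ 'd"
    assume V: "open V" "vec_holomorphic \<gamma> V" "\<gamma> ` V \<subseteq> ball 0 \<delta>"
    show "vec_holomorphic (\<lambda>t. y (\<gamma> t)) V"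
      unfolding y_def
    proof (rule sep_holomorphic_diagonal[OF V(1) \<sigma>_pos Y4[OF V]])
      show "(\<lambda>t. P (\<gamma> t)) holomorphic_on V"
        using V(3) \<delta>_le by (intro P_hol V(1,2)) force
      show "(\<lambda>t. P (\<gamma> t)) ` V \<subseteq> ball 0 \<sigma>"
        using V(3) by (intro image_subsetI P_mem) auto
      show "norm (Y (\<gamma> \<zeta>) s) \<le> \<rho>" if "\<zeta> \<in> V" "s \<in> ball 0 \<sigma>" for \<zeta> s
        using that V(3) by (intro Y2) auto
    qed
  qed
  have y_0: "y 0 = 0"
  proof -
    have "0 \<in> ball 0 \<delta>" using \<delta>_pos by simp
    have "\<nu> *v y 0 + (F 0 (y 0) - \<nu> *v y 0) = 0"
      using Y3[OF \<open>0 \<in> ball 0 \<delta>\<close>, of 0] \<sigma>_pos by (simp add: y_def G_def \<Gamma>_def flow_0 P_0)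
    then have "F 0 (y 0) = 0" by simp
    then have "norm (- (\<nu> *v y 0)) \<le> \<epsilon>\<^sub>0 * norm (y 0)"
      using F_lip[of 0 "y 0" 0] R_pos \<rho>_pos y_bound[OF \<open>0 \<in> ball 0 \<delta>\<close>] F_0 by simp
    then have "\<kappa> * norm (y 0) \<le> \<epsilon>\<^sub>0 * norm (y 0)"
      using nonresonant'[of "y 0" 0] by simp
    then show ?thesis using \<epsilon>\<^sub>0(2) by (simp add: mult_le_cancel_right)
  qed
  have eq: "\<exists>e>0. \<exists>\<gamma>. vec_holomorphic \<gamma> (ball 0 e) \<and> \<gamma> ` ball 0 e \<subseteq> ball 0 \<delta> \<and> \<gamma> 0 = x \<and>
      vec_deriv \<gamma> 0 = b x \<and> P x *s vec_deriv (\<lambda>t. y (\<gamma> t)) 0 = F x (y x)" if x: "x \<in> ball 0 \<delta>" for x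
  proof -
    define e where "e = min \<sigma> ((\<delta> - norm x) / (C + 1))"
    have "0 < e" using x \<sigma>_pos C_nonneg by (simp add: e_def)
    have e\<sigma>: "t \<in> ball 0 \<sigma>" "t \<in> ball 0 (4 * \<sigma>)" if "t \<in> ball 0 e" for t :: complex
      using that \<sigma>_pos by (auto simp: e_def)
    have stay: "\<Phi> t x \<in> ball 0 \<delta>" if t: "t \<in> ball 0 e" for t
    proof -
      have "C * norm t \<le> (C + 1) * norm t" by (simp add: algebra_simps)
      also have "\<dots> < (C + 1) * ((\<delta> - norm x) / (C + 1))"
        using t C_nonneg by (intro mult_strict_left_mono) (auto simp: e_def)
      finally have "C * norm t < \<delta> - norm x" using C_nonneg by simp
      then show ?thesis
        using flow_dist[OF x e\<sigma>(2)[OF t]] norm_triangle_sub[of "\<Phi> t x" x] by simp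
    qed
    \<comment> \<open>\<open>Y\<close> is a first integral: both sides solve the same singular equation in \<open>s\<close>, because
      \<open>\<Gamma>\<close> is constant along the flow.\<close>
    have invariant: "Y (\<Phi> t x) s = Y x s" if t: "t \<in> ball 0 e" and s: "s \<in> ball 0 \<sigma>" for t s
    proof -
      have \<Gamma>_eq: "\<Gamma> s (\<Phi> t x) = \<Gamma> s x" if s: "s \<in> ball 0 \<sigma>" for s
      proof -
        have "norm (s - P (\<Phi> t x)) < 2 * \<sigma>"
          using norm_triangle_ineq4[of s "P (\<Phi> t x)"] s P_lt[OF stay[OF t]] by simp
        then have "\<Phi> (t + (s - P (\<Phi> t x))) x = \<Phi> (s - P (\<Phi> t x)) (\<Phi> t x)"
          using e\<sigma>(1)[OF t] \<sigma>_pos by (intro flow_add[OF x, of "2 * \<sigma>"] stay t) auto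
        then show ?thesis by (simp add: \<Gamma>_def time[OF x e\<sigma>(2)[OF t]])
      qed
      show ?thesis
      proof (rule briot_bouquet_unique[OF \<sigma>_pos Y1[OF stay[OF t]] Y1[OF x] Y3[OF stay[OF t]] Y3[OF x] _ s])
        fix s :: complex assume s: "s \<in> ball 0 \<sigma>"
        have "G (\<Phi> t x) s (Y (\<Phi> t x) s) = G x s (Y (\<Phi> t x) s)"
          by (simp add: G_def \<Gamma>_eq[OF s])
        then show "norm (G (\<Phi> t x) s (Y (\<Phi> t x) s) - G x s (Y x s)) \<le> \<epsilon>\<^sub>0 * norm (Y (\<Phi> t x) s - Y x s)"
          using G_lip[OF x s Y2[OF stay[OF t] s] Y2[OF x s]] by simp
      qed
    qed
    have y_\<Phi>: "y (\<Phi> t x) = Y x (P x + t)" if t: "t \<in> ball 0 e" for t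
      using invariant[OF t P_mem[OF stay[OF t]]] time[OF x e\<sigma>(2)[OF t]] by (simp add: y_def)
    have 0: "0 \<in> ball (0::complex) e" using \<open>0 < e\<close> by simp
    have "vec_deriv (\<lambda>t. y (\<Phi> t x)) 0 = vec_deriv (Y x) (P x)"
    proof (rule vec_derivI)
      fix i
      have "((\<lambda>t. Y x (t + P x) $ i) has_field_derivative vec_deriv (Y x) (P x) $ i) (at 0)"
        using has_field_derivative_vec_deriv[OF Y1[OF x] open_ball P_mem[OF x], of i]
        by (intro iffD1[OF DERIV_shift]) simp
      then show "((\<lambda>t. y (\<Phi> t x) $ i) has_field_derivative vec_deriv (Y x) (P x) $ i) (at 0)"
        by (rule has_field_derivative_transform_within_open[OF _ open_ball 0])
           (simp add: y_\<Phi> add.commute)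
    qed
    then have "P x *s vec_deriv (\<lambda>t. y (\<Phi> t x)) 0 = F x (y x)"
      using Y3[OF x P_mem[OF x]] by (simp add: y_def G_def \<Gamma>_def flow_0)
    moreover have "vec_holomorphic (\<lambda>t. \<Phi> t x) (ball 0 e)"
      by (rule vec_holomorphic_subset[OF flow_hol[OF x]]) (use e\<sigma> in auto)
    moreover have "vec_deriv (\<lambda>t. \<Phi> t x) 0 = b x"
      using flow_deriv[OF x e\<sigma>(2)[OF 0]] by (simp add: flow_0)
    ultimately show ?thesis
      using \<open>0 < e\<close> stay flow_0 by (intro exI[of _ e] conjI exI[of _ "\<lambda>t. \<Phi> t x"]) auto
  qed
  show ?thesis
    using \<delta>_pos y_bound y_hol y_0 eq by (intro exI[of _ \<delta>] conjI exI[of _ y]) auto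
qed

text \<open>
  Restricted to an integral curve parametrised by \<open>P\<close>, both solutions satisfy one and the same singular
  equation. The two solutions are indexed by truth values.
\<close>

theorem uniqueness:
  assumes "0 < \<delta>\<^sub>1" "\<delta>\<^sub>1 \<le> R"
    and y: "\<And>k::bool. curve_holomorphic_on (y k) (ball 0 \<delta>\<^sub>1)"
      "\<And>k x. x \<in> ball 0 \<delta>\<^sub>1 \<Longrightarrow> norm (y k x) \<le> \<rho>"
      "\<And>k V \<gamma> t. open V \<Longrightarrow> vec_holomorphic \<gamma> V \<Longrightarrow> \<gamma> ` V \<subseteq> ball 0 \<delta>\<^sub>1 \<Longrightarrow> t \<in> V \<Longrightarrow>
        vec_deriv \<gamma> t = b (\<gamma> t) \<Longrightarrow> P (\<gamma> t) *s vec_deriv (\<lambda>t. y k (\<gamma> t)) t = F (\<gamma> t) (y k (\<gamma> t))"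
  shows "\<exists>\<delta>>0. \<forall>x\<in>ball 0 \<delta>. y True x = y False x"
proof -
  obtain \<sigma> \<delta> C \<Phi> where "flow_with_time b R \<sigma> \<delta> C \<Phi> P"
    using flow_with_time_exists by blast
  then interpret flow_with_time b R \<sigma> \<delta> C \<Phi> P .
  \<comment> \<open>The radius \<open>s\<^sub>0\<close> is so small that the flow for times below \<open>2 s\<^sub>0\<close> stays where both solutions
    are defined.\<close>
  define s\<^sub>0 where "s\<^sub>0 = min \<sigma> (\<delta>\<^sub>1 / (4 * (C + 1)))"
  have "0 < s\<^sub>0" "s\<^sub>0 \<le> \<sigma>" using \<sigma>_pos \<open>0 < \<delta>\<^sub>1\<close> C_nonneg by (auto simp: s\<^sub>0_def)
  have "s\<^sub>0 \<le> \<delta>\<^sub>1 / (4 * (C + 1))" by (simp add: s\<^sub>0_def)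
  then have "s\<^sub>0 * (4 * (C + 1)) \<le> \<delta>\<^sub>1"
    using C_nonneg by (subst (asm) pos_le_divide_eq) auto
  then have s\<^sub>0C: "(C + 1) * s\<^sub>0 \<le> \<delta>\<^sub>1 / 4" by (simp add: algebra_simps)
  obtain d where d: "0 < d" "\<And>x. x \<in> ball 0 d \<Longrightarrow> norm (P x) < s\<^sub>0"
    using P_small[OF \<open>0 < s\<^sub>0\<close>] by blast
  define \<delta>\<^sub>2 where "\<delta>\<^sub>2 = min d (min \<delta> (\<delta>\<^sub>1 / 2))"
  have "0 < \<delta>\<^sub>2" using d(1) \<delta>_pos \<open>0 < \<delta>\<^sub>1\<close> by (simp add: \<delta>\<^sub>2_def)
  have "y True x = y False x" if x2: "x \<in> ball 0 \<delta>\<^sub>2" for x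
  proof -
    have x: "x \<in> ball 0 \<delta>" and x1: "norm x < \<delta>\<^sub>1 / 2" and Px: "norm (P x) < s\<^sub>0"
      using x2 d(2)[of x] by (auto simp: \<delta>\<^sub>2_def)
    define \<Gamma> where "\<Gamma> s = \<Phi> (s - P x) x" for s
    have shift: "norm (s - P x) < 2 * s\<^sub>0" "s - P x \<in> ball 0 (4 * \<sigma>)" if "s \<in> ball 0 s\<^sub>0" for s
      using that Px norm_triangle_ineq4[of s "P x"] \<open>s\<^sub>0 \<le> \<sigma>\<close> \<sigma>_pos by auto
    have \<Gamma>\<delta>: "\<Gamma> s \<in> ball 0 \<delta>\<^sub>1" if s: "s \<in> ball 0 s\<^sub>0" for s
    proof -
      have "norm (\<Gamma> s - x) \<le> C * norm (s - P x)"
        unfolding \<Gamma>_def by (rule flow_dist[OF x shift(2)[OF s]])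
      also have "\<dots> \<le> (C + 1) * (2 * s\<^sub>0)"
        using shift(1)[OF s] C_nonneg by (intro mult_mono) auto
      finally show ?thesis
        using s\<^sub>0C x1 norm_triangle_sub[of "\<Gamma> s" x] by simp
    qed
    have \<Gamma>R: "\<Gamma> s \<in> ball 0 R" if "s \<in> ball 0 s\<^sub>0" for s
      using \<Gamma>\<delta>[OF that] \<open>\<delta>\<^sub>1 \<le> R\<close> by simp
    have \<Gamma>hol: "vec_holomorphic \<Gamma> (ball 0 s\<^sub>0)"
      unfolding \<Gamma>_def
      by (intro vec_holomorphic_compose[OF flow_hol[OF x]] holomorphic_intros image_subsetI shift)
    have \<Gamma>der: "vec_deriv \<Gamma> s = b (\<Gamma> s)" if s: "s \<in> ball 0 s\<^sub>0" for s
    proof (rule vec_derivI)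
      fix i
      have "((\<lambda>t. \<Phi> t x $ i) has_field_derivative b (\<Gamma> s) $ i) (at (s + - P x))"
        using has_field_derivative_vec_deriv[OF flow_hol[OF x] open_ball shift(2)[OF s], of i]
          flow_deriv[OF x shift(2)[OF s]] by (simp add: \<Gamma>_def)
      then have "((\<lambda>s. \<Phi> (s + - P x) x $ i) has_field_derivative b (\<Gamma> s) $ i) (at s)"
        by (rule iffD1[OF DERIV_shift])
      then show "((\<lambda>s. \<Gamma> s $ i) has_field_derivative b (\<Gamma> s) $ i) (at s)"
        by (simp add: \<Gamma>_def)
    qed
    have P\<Gamma>: "P (\<Gamma> s) = s" if "s \<in> ball 0 s\<^sub>0" for s
      unfolding \<Gamma>_def using time[OF x shift(2)[OF that]] by simp
    have w_hol: "vec_holomorphic (\<lambda>s. y k (\<Gamma> s)) (ball 0 s\<^sub>0)" for k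
      using \<Gamma>\<delta> by (intro curve_holomorphic_onD[OF y(1) open_ball \<Gamma>hol]) auto
    have w_eq: "s *s vec_deriv (\<lambda>s. y k (\<Gamma> s)) s = \<nu> *v y k (\<Gamma> s) + (F (\<Gamma> s) (y k (\<Gamma> s)) - \<nu> *v y k (\<Gamma> s))"
      if s: "s \<in> ball 0 s\<^sub>0" for s k
      using y(3)[OF open_ball \<Gamma>hol image_subsetI[OF \<Gamma>\<delta>] s \<Gamma>der[OF s], of k] P\<Gamma>[OF s] by simp
    have "P x \<in> ball 0 s\<^sub>0" using Px by simp
    have "y True (\<Gamma> (P x)) = y False (\<Gamma> (P x))"
      by (rule briot_bouquet_unique[OF \<open>0 < s\<^sub>0\<close> w_hol w_hol w_eq w_eq F_lip])
         ((fact | assumption | rule \<Gamma>R y(2) \<Gamma>\<delta>)+)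
    then show ?thesis by (simp add: \<Gamma>_def flow_0)
  qed
  then show ?thesis using \<open>0 < \<delta>\<^sub>2\<close> by blast
qed

end

section \<open>Analytic solutions\<close>

lemma coeff_bound_mono:
  fixes f :: "('d::finite) mseries"
  assumes "norm (f \<alpha>) * r ^ mdeg \<alpha> \<le> C" "0 < r'" "r' \<le> r" "C \<le> C'"
  shows "norm (f \<alpha>) * r' ^ mdeg \<alpha> \<le> C'"
proof -
  have "norm (f \<alpha>) * r' ^ mdeg \<alpha> \<le> norm (f \<alpha>) * r ^ mdeg \<alpha>"
    using assms by (intro mult_left_mono power_mono) auto
  then show ?thesis using assms by linarith
qed

lemma conv_series_common_bound:
  fixes f :: "'i::finite \<Rightarrow> ('d::finite) mseries"
  assumes "\<And>i. f i \<in> conv_series"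
  shows "\<exists>r>0. \<exists>C. \<forall>i \<alpha>. norm (f i \<alpha>) * r ^ mdeg \<alpha> \<le> C"
proof -
  have "\<forall>i. \<exists>r C. 0 < r \<and> (\<forall>\<alpha>. norm (f i \<alpha>) * r ^ mdeg \<alpha> \<le> C)"
    using assms unfolding conv_series_iff_bounded_coeffs by blast
  then obtain r C where rC: "\<And>i. 0 < r i" "\<And>i \<alpha>. norm (f i \<alpha>) * r i ^ mdeg \<alpha> \<le> C i"
    by metis
  have "0 < Min (range r)" using rC(1) by simp
  moreover have "norm (f i \<alpha>) * Min (range r) ^ mdeg \<alpha> \<le> Max (range C)" for i \<alpha>
    by (rule coeff_bound_mono[OF rC(2)[of i] calculation]) auto
  ultimately show ?thesis by blast
qed

lemma continuous_on_ms_eval: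
  fixes f :: "('d::finite) mseries"
  assumes "0 < r" and f: "\<And>\<alpha>. norm (f \<alpha>) * r ^ mdeg \<alpha> \<le> C"
  shows "continuous_on (ball 0 (r / 2)) (ms_eval f)"
proof (rule uniform_limit_theorem)
  let ?F = "finite_subsets_at_top (UNIV :: (nat ^ 'd) set)"
  show "uniform_limit (ball 0 (r / 2)) (\<lambda>A x. \<Sum>\<alpha>\<in>A. f \<alpha> * monom_at x \<alpha>) (ms_eval f) ?F"
    unfolding ms_eval_def[abs_def]
  proof (rule Weierstrass_m_test_general[where M = "\<lambda>\<alpha>. norm (f \<alpha>) * (r / 2) ^ mdeg \<alpha>"])
    fix \<alpha> and x :: "complex ^ 'd" assume "x \<in> ball 0 (r / 2)"
    then have "norm (x $ i) \<le> r / 2" for i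
      by (intro norm_component_le) simp
    then show "norm (f \<alpha> * monom_at x \<alpha>) \<le> norm (f \<alpha>) * (r / 2) ^ mdeg \<alpha>"
      by (auto simp: norm_mult intro!: mult_left_mono norm_monom_at_le)
  qed (rule bounded_coeffs_abs_summable[OF \<open>0 < r\<close> f]; use \<open>0 < r\<close> in auto)
  show "eventually (\<lambda>A. continuous_on (ball 0 (r / 2)) (\<lambda>x. \<Sum>\<alpha>\<in>A. f \<alpha> * monom_at x \<alpha>)) ?F"
    unfolding monom_at_def by (intro always_eventually allI continuous_intros)
qed (rule finite_subsets_at_top_neq_bot)

lemma ms_eval_holomorphic:
  fixes f :: "('d::finite) mseries"
  assumes "0 < r" and f: "\<And>\<alpha>. norm (f \<alpha>) * r ^ mdeg \<alpha> \<le> C"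
    and "open V" "vec_holomorphic \<gamma> V" "\<gamma> ` V \<subseteq> ball 0 (r / 2)"
  shows "(\<lambda>t. ms_eval f (\<gamma> t)) holomorphic_on V"
  unfolding holomorphic_on_def
proof
  fix t assume t: "t \<in> V"
  have "((\<lambda>t. ms_eval f (\<gamma> t)) has_field_derivative
      (\<Sum>j\<in>UNIV. deriv (\<lambda>t. \<gamma> t $ j) t * ms_eval (ms_pderiv j f) (\<gamma> t))) (at t)"
  proof (rule ms_eval_chain[OF \<open>0 < r\<close> f \<open>open V\<close> t])
    show "(\<lambda>t. \<gamma> t $ i) holomorphic_on V" for i using assms(4) by (simp add: vec_holomorphic_def)
    show "norm (\<gamma> t $ i) < r / 2" for i
      using assms(5) t by (intro norm_component_less) auto
  qed
  then show "(\<lambda>t. ms_eval f (\<gamma> t)) field_differentiable at t within V"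
    using field_differentiable_at_within field_differentiable_def by blast
qed

lemma ms_eval_diff:
  fixes f g :: "('d::finite) mseries"
  assumes "0 < r" and f: "\<And>\<alpha>. norm (f \<alpha>) * r ^ mdeg \<alpha> \<le> C" and g: "\<And>\<alpha>. norm (g \<alpha>) * r ^ mdeg \<alpha> \<le> C"
    and x: "\<And>i. norm (x $ i) < r"
  shows "ms_eval (\<lambda>\<alpha>. f \<alpha> - g \<alpha>) x = ms_eval f x - ms_eval g x"
proof -
  have "((\<lambda>\<alpha>. f \<alpha> * monom_at x \<alpha> + (- 1) * (g \<alpha> * monom_at x \<alpha>)) has_sum (ms_eval f x + (- 1) * ms_eval g x)) UNIV"
    by (intro has_sum_add has_sum_cmult_right bounded_coeffs_has_sum(2)[OF \<open>0 < r\<close> f x]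
        bounded_coeffs_has_sum(2)[OF \<open>0 < r\<close> g x])
  then show ?thesis
    unfolding ms_eval_def[of "\<lambda>\<alpha>. f \<alpha> - g \<alpha>"] by (intro infsumI) (simp add: algebra_simps)
qed

lemma conv_series_eqI:
  fixes f g :: "('d::finite) mseries"
  assumes "f \<in> conv_series" "g \<in> conv_series"
    and "0 < \<delta>" and eq: "\<And>x. x \<in> ball 0 \<delta> \<Longrightarrow> ms_eval f x = ms_eval g x"
  shows "f = g"
proof -
  have "\<And>k::bool. (if k then f else g) \<in> conv_series" using assms by auto
  from conv_series_common_bound[of "\<lambda>k::bool. if k then f else g", OF this]
  obtain r C where r: "0 < r" "\<forall>(k::bool) \<alpha>. norm ((if k then f else g) \<alpha>) * r ^ mdeg \<alpha> \<le> C"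
    by blast
  have f: "norm (f \<alpha>) * r ^ mdeg \<alpha> \<le> C" and g: "norm (g \<alpha>) * r ^ mdeg \<alpha> \<le> C" for \<alpha>
    using r(2)[rule_format, of True \<alpha>] r(2)[rule_format, of False \<alpha>] by auto
  have "norm (f \<alpha> - g \<alpha>) * r ^ mdeg \<alpha> \<le> 2 * C" for \<alpha>
  proof -
    have "norm (f \<alpha> - g \<alpha>) * r ^ mdeg \<alpha> \<le> (norm (f \<alpha>) + norm (g \<alpha>)) * r ^ mdeg \<alpha>"
      using \<open>0 < r\<close> by (intro mult_right_mono norm_triangle_ineq4) auto
    then show ?thesis using f[of \<alpha>] g[of \<alpha>] by (simp add: distrib_right)
  qed
  then have "(\<lambda>\<alpha>. f \<alpha> - g \<alpha>) \<in> conv_series"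
    unfolding conv_series_iff_bounded_coeffs using \<open>0 < r\<close> by blast
  moreover have "eventually (\<lambda>x. ms_eval (\<lambda>\<alpha>. f \<alpha> - g \<alpha>) x = 0) (nhds 0)"
    unfolding eventually_nhds_metric
  proof (intro exI[of _ "min \<delta> r"] conjI allI impI)
    fix x :: "complex ^ 'd" assume "dist x 0 < min \<delta> r"
    then have "norm x < \<delta>" "norm x < r" by auto
    moreover have "norm (x $ i) < r" for i
      by (rule norm_component_less[OF \<open>norm x < r\<close>])
    ultimately show "ms_eval (\<lambda>\<alpha>. f \<alpha> - g \<alpha>) x = 0"
      using eq[of x] by (simp add: ms_eval_diff[OF \<open>0 < r\<close> f g])
  qed (use assms(3) \<open>0 < r\<close> in auto)
  ultimately have "f \<alpha> - g \<alpha> = 0" for \<alpha>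
    by (rule ms_eval_eq_0_imp_eq_0)
  then show ?thesis by (simp add: fun_eq_iff)
qed

text \<open>
  On an integral curve of \<open>L / u\<close> the chain rule produces the sum that defines \<open>L f\<close>, divided by \<open>u\<close>.
\<close>

lemma ms_eval_deriv_along_field:
  fixes f :: "('d::finite) mseries"
  assumes "0 < r" and f: "\<And>\<alpha>. norm (f \<alpha>) * r ^ mdeg \<alpha> \<le> C"
    and a: "\<And>j \<alpha>. norm (a j \<alpha>) * r ^ mdeg \<alpha> \<le> C"
    and V: "open V" "vec_holomorphic \<gamma> V" "t \<in> V" and small: "norm (\<gamma> t) < r / 2"
    and b: "vec_deriv \<gamma> t = (\<chi> j. ms_eval (a j) (\<gamma> t) / u)"
  shows "((\<lambda>t. ms_eval f (\<gamma> t)) has_field_derivative ms_eval (vfield a f) (\<gamma> t) / u) (at t)"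
proof -
  have comp: "norm (\<gamma> t $ i) < r / 2" for i
    by (rule norm_component_less[OF small])
  have "((\<lambda>t. ms_eval f (\<gamma> t)) has_field_derivative
      (\<Sum>j\<in>UNIV. deriv (\<lambda>t. \<gamma> t $ j) t * ms_eval (ms_pderiv j f) (\<gamma> t))) (at t)"
    by (rule ms_eval_chain[where \<gamma> = \<gamma>, OF \<open>0 < r\<close> f V(1,3) _ comp]) (use V(2) in \<open>simp add: vec_holomorphic_def\<close>)
  also have "(\<Sum>j\<in>UNIV. deriv (\<lambda>t. \<gamma> t $ j) t * ms_eval (ms_pderiv j f) (\<gamma> t))
      = (\<Sum>j\<in>UNIV. ms_eval (a j) (\<gamma> t) * ms_eval (ms_pderiv j f) (\<gamma> t)) / u"
    using b by (simp add: vec_deriv_def vec_eq_iff sum_divide_distrib)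
  also have "(\<Sum>j\<in>UNIV. ms_eval (a j) (\<gamma> t) * ms_eval (ms_pderiv j f) (\<gamma> t)) = ms_eval (vfield a f) (\<gamma> t)"
    unfolding ms_eval_def[of "vfield a f"]
    by (rule infsumI[symmetric, OF vfield_has_sum[OF \<open>0 < r\<close> f a comp]])
  finally show ?thesis .
qed

lemma has_derivative_vec_curve:
  fixes v :: "complex \<Rightarrow> complex ^ 'n::finite"
  assumes "\<And>i. ((\<lambda>s. v s $ i) has_field_derivative d $ i) (at s)"
  shows "(v has_derivative (\<lambda>h. h *s d)) (at s)"
proof -
  have bl: "bounded_linear (\<lambda>c::complex. c *s axis i 1 :: complex ^ 'n)" for i :: 'n
    by (rule bounded_linear_intro[where K = "norm (axis i 1 :: complex ^ 'n)"])
       (auto simp: vec.scale_left_distrib norm_vector_smult vec_eq_iff)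
  have "((\<lambda>s. v s $ i *s axis i 1) has_derivative (\<lambda>h. (d $ i * h) *s axis i 1 :: complex ^ 'n)) (at s)" for i
    using assms[of i] unfolding has_field_derivative_def by (rule bounded_linear.has_derivative[OF bl])
  then have "((\<lambda>s. \<Sum>i\<in>UNIV. v s $ i *s axis i 1) has_derivative (\<lambda>h. \<Sum>i\<in>UNIV. (d $ i * h) *s axis i 1)) (at s)"
    by (intro has_derivative_sum)
  moreover have "(\<Sum>i\<in>UNIV. v s $ i *s axis i 1) = v s" for s
    by (rule basis_expansion)
  moreover have "(\<Sum>i\<in>UNIV. (d $ i * h) *s axis i 1) = h *s d" for h
    using basis_expansion[of "h *s d"] by (simp add: mult.commute)
  ultimately show ?thesis by simp
qed

text \<open>The chain rule turns complex Frechet differentiability into holomorphy along curves.\<close>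

lemma holomorphic_map_on_curve:
  fixes F :: "(complex ^ 'd::finite) \<times> (complex ^ 'n::finite) \<Rightarrow> complex ^ 'n"
  assumes F: "holomorphic_map_on F U" and V: "open V" "vec_holomorphic \<gamma> V" "vec_holomorphic v V"
    and U: "\<And>t. t \<in> V \<Longrightarrow> (\<gamma> t, v t) \<in> U"
  shows "vec_holomorphic (\<lambda>t. F (\<gamma> t, v t)) V"
  unfolding vec_holomorphic_def holomorphic_on_def
proof (intro allI ballI)
  fix i t assume t: "t \<in> V"
  obtain D where D: "(F has_derivative D) (at (\<gamma> t, v t))" "\<And>c v w. D (c *s v, c *s w) = c *s D (v, w)"
    using F U[OF t] unfolding holomorphic_map_on_def by blast
  have "((\<lambda>t. (\<gamma> t, v t)) has_derivative (\<lambda>h. (h *s vec_deriv \<gamma> t, h *s vec_deriv v t))) (at t)"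
    by (intro has_derivative_Pair has_derivative_vec_curve has_field_derivative_vec_deriv[OF _ V(1) t] V(2,3))
  then have "((\<lambda>t. F (\<gamma> t, v t)) has_derivative (\<lambda>h. D (h *s vec_deriv \<gamma> t, h *s vec_deriv v t))) (at t)"
    by (rule has_derivative_compose[where f = "\<lambda>t. (\<gamma> t, v t)" and g = F, OF _ D(1)])
  then have "((\<lambda>t. F (\<gamma> t, v t)) has_derivative (\<lambda>h. h *s D (vec_deriv \<gamma> t, vec_deriv v t))) (at t)"
    by (simp only: D(2))
  then have "((\<lambda>t. F (\<gamma> t, v t) $ i) has_derivative (\<lambda>h. (h *s D (vec_deriv \<gamma> t, vec_deriv v t)) $ i)) (at t)"
    by (rule bounded_linear.has_derivative[OF bounded_linear_vec_nth])
  then have "((\<lambda>t. F (\<gamma> t, v t) $ i) has_field_derivative D (vec_deriv \<gamma> t, vec_deriv v t) $ i) (at t)"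
    by (simp add: has_field_derivative_def mult_commute_abs)
  then show "(\<lambda>t. F (\<gamma> t, v t) $ i) field_differentiable at t within V"
    using field_differentiable_at_within field_differentiable_def by blast
qed

lemma derivative_snd_eq_jacobian:
  fixes F :: "(complex ^ 'd::finite) \<times> (complex ^ 'n::finite) \<Rightarrow> complex ^ 'n"
  assumes D: "(F has_derivative D) (at (x, y))" "\<And>c v w. D (c *s v, c *s w) = c *s D (v, w)"
  shows "D (0, w) = jacobian_snd F (x, y) *v w"
proof -
  interpret D: bounded_linear D using D(1) by (rule has_derivative_bounded_linear)
  have jac: "jacobian_snd F (x, y) $ i $ j = D (0, axis j 1) $ i" for i j
  proof -
    have ax: "(\<lambda>t. y + axis j t) = (\<lambda>t. y + t *s axis j 1)"
      by (simp add: fun_eq_iff vec_eq_iff axis_def)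
    have "((\<lambda>t. y + axis j t) has_derivative (\<lambda>h. h *s axis j 1)) (at 0)"
      unfolding ax by (rule has_derivative_vec_curve) (auto intro!: derivative_eq_intros)
    then have "((\<lambda>t. (x, y + axis j t)) has_derivative (\<lambda>h. (0, h *s axis j 1))) (at 0)"
      by (intro has_derivative_Pair has_derivative_const)
    moreover have "(F has_derivative D) (at (x, y + axis j 0))"
      using D(1) by (simp add: axis_def zero_vec_def[symmetric])
    ultimately have "((\<lambda>t. F (x, y + axis j t)) has_derivative (\<lambda>h. D (0, h *s axis j 1))) (at 0)"
      by (rule has_derivative_compose)
    also have "(\<lambda>h. D (0, h *s axis j 1)) = (\<lambda>h. h *s D (0, axis j 1))"
      using D(2)[of _ 0 "axis j 1"] by simp
    finally have "((\<lambda>t. F (x, y + axis j t) $ i) has_derivative (\<lambda>h. (h *s D (0, axis j 1)) $ i)) (at 0)"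
      by (rule bounded_linear.has_derivative[OF bounded_linear_vec_nth])
    then have "((\<lambda>t. F (x, y + axis j t) $ i) has_field_derivative D (0, axis j 1) $ i) (at 0)"
      by (simp add: has_field_derivative_def mult_commute_abs)
    then show ?thesis by (simp add: jacobian_snd_def DERIV_imp_deriv)
  qed
  have "D (0, w) = D (0, \<Sum>j\<in>UNIV. w $ j *s axis j 1)" by (simp only: basis_expansion)
  also have "\<dots> = D (\<Sum>j\<in>UNIV. (0, w $ j *s axis j 1))" by (simp add: sum_prod)
  also have "\<dots> = (\<Sum>j\<in>UNIV. D (0, w $ j *s axis j 1))" by (rule D.sum)
  also have "\<dots> = (\<Sum>j\<in>UNIV. w $ j *s D (0, axis j 1))"
    using D(2)[of _ 0] by simp
  also have "\<dots> = jacobian_snd F (x, y) *v w"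
    by (simp add: vec_eq_iff matrix_vector_mult_def jac mult.commute)
  finally show ?thesis .
qed

text \<open>
  Invertibility of the matrices \<open>n - \<nu>\<close> is uniform in \<open>n\<close>, with a bound that grows linearly,
  since \<open>n\<close> dominates \<open>\<nu>\<close> for all but finitely many \<open>n\<close>.
\<close>

lemma nonresonant_exists:
  fixes \<nu> :: "complex ^ 'n ^ 'n::finite"
  assumes inv: "\<And>n::nat. invertible (mat (of_nat n) - \<nu>)"
  shows "\<exists>\<kappa>. nonresonant \<nu> \<kappa>"
proof -
  obtain B where B: "0 < B" "\<And>w. norm (\<nu> *v w) \<le> B * norm w"
    using matrix_vector_norm_bound by blast
  have A: "(mat (of_nat n) - \<nu>) *v z = of_nat n *s z - \<nu> *v z" for n z
    by (simp add: matrix_vector_mult_diff_rdistrib mat_vector_mult)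
  have "\<exists>c>0. \<forall>z. c * norm z \<le> norm (of_nat n *s z - \<nu> *v z)" for n :: nat
  proof -
    obtain A' where A': "A' ** (mat (of_nat n) - \<nu>) = mat 1"
      using inv[of n] unfolding invertible_def by blast
    obtain B' where B': "0 < B'" "\<And>w. norm (A' *v w) \<le> B' * norm w"
      using matrix_vector_norm_bound by blast
    have "1 / B' * norm z \<le> norm (of_nat n *s z - \<nu> *v z)" for z
    proof -
      have "z = A' *v ((mat (of_nat n) - \<nu>) *v z)"
        by (simp add: matrix_vector_mul_assoc A')
      then have "norm z \<le> B' * norm (of_nat n *s z - \<nu> *v z)"
        using B'(2)[of "of_nat n *s z - \<nu> *v z"] by (simp add: A)
      then show ?thesis using B'(1) by (simp add: field_simps)
    qed
    then show ?thesis using B'(1) by (intro exI[of _ "1 / B'"]) auto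
  qed
  then obtain c where c: "\<And>n::nat. 0 < c n" "\<And>n z. c n * norm z \<le> norm (of_nat n *s z - \<nu> *v z)"
    by metis
  define N where "N = nat \<lceil>2 * B + 1\<rceil>"
  define \<kappa> where "\<kappa> = Min (insert (1 / 2) ((\<lambda>n. c n / (real n + 1)) ` {..<N}))"
  have "0 < \<kappa>"
    unfolding \<kappa>_def using c(1) by (subst Min_gr_iff) (auto intro!: divide_pos_pos add_nonneg_pos)
  moreover have "\<kappa> * (real n + 1) * norm z \<le> norm (of_nat n *s z - \<nu> *v z)" for n z
  proof (cases "n < N")
    case True
    then have "\<kappa> \<le> c n / (real n + 1)" unfolding \<kappa>_def by (intro Min_le) auto
    then have "\<kappa> * (real n + 1) \<le> c n" by (simp add: pos_le_divide_eq)
    then have "\<kappa> * (real n + 1) * norm z \<le> c n * norm z" by (intro mult_right_mono) auto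
    then show ?thesis using c(2) order_trans by blast
  next
    case False
    then have "2 * B + 1 \<le> real n" by (simp add: N_def) linarith
    have "\<kappa> \<le> 1 / 2" unfolding \<kappa>_def by (intro Min_le) auto
    then have "\<kappa> * (real n + 1) * norm z \<le> 1 / 2 * (real n + 1) * norm z"
      by (intro mult_right_mono) auto
    also have "\<dots> \<le> (real n - B) * norm z"
      using \<open>2 * B + 1 \<le> real n\<close> by (intro mult_right_mono) auto
    also have "\<dots> \<le> norm (of_nat n *s z) - norm (\<nu> *v z)"
      using B(2)[of z] by (simp add: norm_vector_smult algebra_simps)
    also have "\<dots> \<le> norm (of_nat n *s z - \<nu> *v z)" by (rule norm_triangle_ineq2)
    finally show ?thesis .
  qed
  ultimately show ?thesis by (intro exI[of _ \<kappa>] nonresonant.intro)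
qed


lemma invertible_iff_trivial_kernel:
  fixes A :: "'a::field ^ 'n ^ 'n::finite"
  shows "invertible A \<longleftrightarrow> (\<forall>z. A *v z = 0 \<longrightarrow> z = 0)"
  by (simp add: invertible_left_inverse matrix_left_invertible_injective vec.inj_iff_eq_0)

text \<open>
  After division by \<open>u\<close> and subtraction of its linear part in \<open>v\<close>, the right-hand side is \<open>O(|x|) + o(|v|)\<close>.
  The radius \<open>\<rho>\<close> in \<open>v\<close> is chosen first and the radius \<open>R\<close> in \<open>x\<close> is much smaller.
\<close>

lemma small_nonlinearity:
  fixes F :: "(complex ^ 'd::finite) \<times> (complex ^ 'n::finite) \<Rightarrow> complex ^ 'n"
  assumes D: "(F has_derivative D) (at (0, 0))" and F0: "F (0, 0) = 0"
    and u: "isCont u 0" "u 0 \<noteq> (0 :: complex)" and U: "open U" "(0, 0) \<in> U"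
    and "0 < e" "0 < R\<^sub>0"
  shows "\<exists>\<rho>>0. \<exists>R>0. R \<le> R\<^sub>0 \<and> (\<forall>x v. norm x < R \<longrightarrow> norm v < 2 * \<rho> \<longrightarrow> (x, v) \<in> U \<and>
    norm ((1 / u x) *s F (x, v) - (1 / u 0) *s D (0, v)) \<le> e * \<rho>)"
proof -
  interpret D: bounded_linear D using D by (rule has_derivative_bounded_linear)
  obtain B where B: "0 < B" "\<And>z. norm (D z) \<le> B * norm z"
    using D.pos_bounded by (auto simp: mult.commute)
  define c where "c = norm (u 0)"
  have "0 < c" using u(2) by (simp add: c_def)
  define \<eta> where "\<eta> = e * c / 16"
  have "0 < \<eta>" using \<open>0 < e\<close> \<open>0 < c\<close> by (simp add: \<eta>_def)
  obtain d\<^sub>1 where d\<^sub>1: "0 < d\<^sub>1" "\<And>z. norm (z - (0, 0)) < d\<^sub>1 \<Longrightarrow>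
      norm (F z - F (0, 0) - D (z - (0, 0))) \<le> \<eta> * norm (z - (0, 0))"
    using D \<open>0 < \<eta>\<close> unfolding has_derivative_at_alt by blast
  obtain d\<^sub>2 where d\<^sub>2: "0 < d\<^sub>2" "\<And>z. dist z (0, 0) < d\<^sub>2 \<Longrightarrow> z \<in> U"
    using U unfolding open_dist by blast
  have "isCont (\<lambda>x. 1 / u x) 0"
    using u by (intro continuous_intros)
  then obtain d\<^sub>3 where d\<^sub>3: "0 < d\<^sub>3" "\<And>x. dist x 0 < d\<^sub>3 \<Longrightarrow> dist (1 / u x) (1 / u 0) < min (1 / c) (e / (8 * B))"
    using \<open>0 < c\<close> \<open>0 < e\<close> B(1) unfolding continuous_at_eps_delta
    by (metis divide_pos_pos min_less_iff_conj mult_pos_pos zero_less_numeral zero_less_one)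
  define \<rho> where "\<rho> = min d\<^sub>1 d\<^sub>2 / 4"
  have "0 < \<rho>" using d\<^sub>1(1) d\<^sub>2(1) by (simp add: \<rho>_def)
  define R where "R = min (min R\<^sub>0 \<rho>) (min d\<^sub>3 (e * \<rho> * c / (8 * (\<eta> + B))))"
  have "0 < R"
    using \<open>0 < R\<^sub>0\<close> \<open>0 < \<rho>\<close> d\<^sub>3(1) \<open>0 < e\<close> \<open>0 < c\<close> \<open>0 < \<eta>\<close> B(1) by (simp add: R_def)
  have RB: "(\<eta> + B) * R \<le> e * \<rho> * c / 8"
  proof -
    have "R \<le> e * \<rho> * c / (8 * (\<eta> + B))" by (simp add: R_def)
    then have "R * (8 * (\<eta> + B)) \<le> e * \<rho> * c"
      using \<open>0 < \<eta>\<close> B(1) by (subst (asm) pos_le_divide_eq) auto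
    then show ?thesis by (simp add: algebra_simps)
  qed
  have main: "(x, v) \<in> U \<and> norm ((1 / u x) *s F (x, v) - (1 / u 0) *s D (0, v)) \<le> e * \<rho>"
    if x: "norm x < R" and v: "norm v < 2 * \<rho>" for x v
  proof
    have xv: "norm (x, v) < min d\<^sub>1 d\<^sub>2"
    proof -
      have "norm x < \<rho>" using x by (simp add: R_def)
      then have "norm (x, v) < 4 * \<rho>" using norm_Pair_le[of x v] v \<open>0 < \<rho>\<close> by linarith
      then show ?thesis by (simp add: \<rho>_def)
    qed
    then show "(x, v) \<in> U"
      by (intro d\<^sub>2(2)) (simp add: dist_norm zero_prod_def[symmetric])
    have "dist x 0 < d\<^sub>3" using x by (simp add: R_def)
    from d\<^sub>3(2)[OF this] have u1: "norm (1 / u x - 1 / u 0) < 1 / c"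
      and u2: "norm (1 / u x - 1 / u 0) \<le> e / (8 * B)"
      by (auto simp: dist_norm)
    have u3: "norm (1 / u x) \<le> 2 / c"
      using u1 norm_triangle_sub[of "1 / u x" "1 / u 0"] by (simp add: c_def norm_divide)
    have f1: "norm (F (x, v) - D (x, v)) \<le> \<eta> * (norm x + norm v)"
    proof -
      have "norm (F (x, v) - D (x, v)) \<le> \<eta> * norm (x, v)"
        using d\<^sub>1(2)[of "(x, v)"] xv by (simp add: F0)
      also have "\<dots> \<le> \<eta> * (norm x + norm v)"
        using \<open>0 < \<eta>\<close> by (intro mult_left_mono norm_Pair_le) auto
      finally show ?thesis .
    qed
    have f2: "norm (D (x, 0)) \<le> B * norm x" using B(2)[of "(x, 0)"] by (simp add: norm_Pair)
    have f3: "norm (D (0, v)) \<le> B * norm v" using B(2)[of "(0, v)"] by (simp add: norm_Pair)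
    have "D (x, v) = D (x, 0) + D (0, v)" using D.add[of "(x, 0)" "(0, v)"] by simp
    then have "(1 / u x) *s F (x, v) - (1 / u 0) *s D (0, v)
        = (1 / u x) *s ((F (x, v) - D (x, v)) + D (x, 0)) + (1 / u x - 1 / u 0) *s D (0, v)"
      by (simp add: vec_eq_iff algebra_simps)
    then have "norm ((1 / u x) *s F (x, v) - (1 / u 0) *s D (0, v))
        \<le> norm (1 / u x) * norm ((F (x, v) - D (x, v)) + D (x, 0)) + norm (1 / u x - 1 / u 0) * norm (D (0, v))"
      by (metis norm_triangle_ineq norm_vector_smult)
    also have "\<dots> \<le> 2 / c * (\<eta> * (norm x + norm v) + B * norm x) + e / (8 * B) * (B * norm v)"
      using \<open>0 < c\<close> \<open>0 < e\<close> B(1) u2 u3 f3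
      by (intro add_mono mult_mono order_trans[OF norm_triangle_ineq add_mono[OF f1 f2]]) auto
    also have "\<dots> = 2 / c * ((\<eta> + B) * norm x) + e / 8 * norm v + e / 8 * norm v"
      using \<open>0 < c\<close> B(1) by (simp add: \<eta>_def field_simps)
    also have "\<dots> \<le> 2 / c * (e * \<rho> * c / 8) + e / 8 * (2 * \<rho>) + e / 8 * (2 * \<rho>)"
    proof (intro add_mono mult_left_mono order_trans[OF _ RB])
      show "norm x \<le> R" using x by simp
    qed (use \<open>0 < c\<close> \<open>0 < e\<close> \<open>0 < \<eta>\<close> B(1) v in auto)
    also have "\<dots> \<le> e * \<rho>"
      using \<open>0 < c\<close> \<open>0 < e\<close> \<open>0 < \<rho>\<close> by simp
    finally show "norm ((1 / u x) *s F (x, v) - (1 / u 0) *s D (0, v)) \<le> e * \<rho>" .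
  qed
  have "R \<le> R\<^sub>0" by (simp add: R_def)
  then show ?thesis using \<open>0 < \<rho>\<close> \<open>0 < R\<close> main by blast
qed

theorem theorem1p2:
  fixes P :: "('d::finite) mseries"
    and a :: "'d \<Rightarrow> 'd mseries"
    and F :: "(complex ^ 'd) \<times> (complex ^ 'n) \<Rightarrow> complex ^ ('n::finite)"
    and U :: "((complex ^ 'd) \<times> (complex ^ 'n)) set"
    and \<mu> :: "complex ^ 'n ^ 'n"
  assumes "P \<in> conv_series" and "P \<noteq> (\<lambda>_. 0)" and "ms_eval P 0 = 0"
    and "\<And>j. a j \<in> conv_series" and "\<exists>j. a j \<noteq> (\<lambda>_. 0)"
    and "(0, 0) \<in> U" and "holomorphic_map_on F U" and "F (0, 0) = 0"
    and "\<mu> = jacobian_snd F (0, 0)" and "invertible \<mu>"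
    and "ms_eval (vfield a P) 0 \<noteq> 0"
    and "\<And>n::nat. invertible (\<mu> - mat (of_nat n * ms_eval (vfield a P) 0))"
  shows "\<exists>!y :: 'd mseries ^ 'n. analytic_solution P a F y \<and> (\<forall>i. ms_eval (y $ i) 0 = 0)"
proof -
  have "\<And>k. (case k of None \<Rightarrow> P | Some j \<Rightarrow> a j) \<in> conv_series"
    using assms(1,4) by (auto split: option.split)
  from conv_series_common_bound[of "\<lambda>k. case k of None \<Rightarrow> P | Some j \<Rightarrow> a j", OF this]
  obtain r C where "0 < r" and rC: "\<forall>k \<alpha>. norm ((case k of None \<Rightarrow> P | Some j \<Rightarrow> a j) \<alpha>) * r ^ mdeg \<alpha> \<le> C"
    by blast
  have P_le: "norm (P \<alpha>) * r ^ mdeg \<alpha> \<le> C" for \<alpha> using rC[rule_format, of None \<alpha>] by simp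
  have a_le: "norm (a j \<alpha>) * r ^ mdeg \<alpha> \<le> C" for j \<alpha> using rC[rule_format, of "Some j" \<alpha>] by simp
  have "0 < r / 2" using \<open>0 < r\<close> by simp
  \<comment> \<open>One radius \<open>r\<close> serves for \<open>P\<close> and all \<open>a\<^sub>j\<close>. The products in \<open>u\<close> contain derivatives of \<open>P\<close> and are
    controlled on the ball of radius \<open>r / 4\<close>.\<close>
  define u where "u x = ms_eval (vfield a P) x" for x
  have "u 0 \<noteq> 0" using assms(11) by (simp add: u_def)
  have u_eq: "u x = (\<Sum>j\<in>UNIV. ms_eval (a j) x * ms_eval (ms_pderiv j P) x)" if "x \<in> ball 0 (r / 4)" for x
    unfolding u_def ms_eval_def[of "vfield a P"]
  proof (rule infsumI, rule vfield_has_sum[OF \<open>0 < r\<close> P_le a_le])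
    show "norm (x $ i) < r / 2" for i
      using that \<open>0 < r\<close> by (intro norm_component_less) simp
  qed
  note dP_le = pderiv_bounded_coeffs[OF \<open>0 < r\<close> P_le]
  have cont4: "continuous_on (ball 0 (r / 4)) (ms_eval (a j))" "continuous_on (ball 0 (r / 4)) (ms_eval P)"
    "continuous_on (ball 0 (r / 4)) (ms_eval (ms_pderiv j P))" for j
    using continuous_on_ms_eval[OF \<open>0 < r\<close> a_le[of j]] continuous_on_ms_eval[OF \<open>0 < r\<close> P_le]
      continuous_on_ms_eval[OF \<open>0 < r / 2\<close> dP_le[of j]] \<open>0 < r\<close>
    by (auto intro: continuous_on_subset simp: subset_ball)
  have mem0: "(0 :: complex ^ 'd) \<in> ball 0 (r / 4)" using \<open>0 < r\<close> by simp
  have "continuous_on (ball 0 (r / 4)) u"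
    by (subst continuous_on_cong[OF refl u_eq]) (auto intro!: continuous_intros cont4 simp del: mem_ball_0)
  then have "isCont u 0"
    using mem0 by (simp add: continuous_on_eq_continuous_at)
  have u_hol: "(\<lambda>t. u (\<gamma> t)) holomorphic_on V"
    if V: "open V" "vec_holomorphic \<gamma> V" "\<gamma> ` V \<subseteq> ball 0 (r / 4)" for V and \<gamma> :: "complex \<Rightarrow> complex ^ 'd"
  proof -
    have "\<gamma> ` V \<subseteq> ball 0 (r / 2)" "\<gamma> ` V \<subseteq> ball 0 (r / 2 / 2)"
      using V(3) \<open>0 < r\<close> by force+
    then have "(\<lambda>t. \<Sum>j\<in>UNIV. ms_eval (a j) (\<gamma> t) * ms_eval (ms_pderiv j P) (\<gamma> t)) holomorphic_on V"
      by (intro holomorphic_intros ms_eval_holomorphic[OF \<open>0 < r\<close> a_le V(1,2)]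
          ms_eval_holomorphic[OF \<open>0 < r / 2\<close> dP_le V(1,2)])
    moreover have "u (\<gamma> t) = (\<Sum>j\<in>UNIV. ms_eval (a j) (\<gamma> t) * ms_eval (ms_pderiv j P) (\<gamma> t))" if "t \<in> V" for t
      using V(3) that by (intro u_eq) auto
    ultimately show ?thesis by (simp cong: holomorphic_cong)
  qed
  define b where "b x = (\<chi> j. ms_eval (a j) x / u x)" for x
  have "isCont b 0"
  proof -
    have "isCont (ms_eval (a j)) 0" for j
      using cont4(1) mem0 by (simp add: continuous_on_eq_continuous_at)
    then have "isCont (\<lambda>x. ms_eval (a j) x / u x) 0" for j
      using \<open>isCont u 0\<close> \<open>u 0 \<noteq> 0\<close> by (intro continuous_intros)
    then show ?thesis
      unfolding b_def[abs_def] isCont_def by (intro tendsto_vec_lambda)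
  qed
  obtain d\<^sub>1 where d\<^sub>1: "0 < d\<^sub>1" "\<And>x. dist x 0 < d\<^sub>1 \<Longrightarrow> dist (b x) (b 0) < 1"
    using \<open>isCont b 0\<close> unfolding continuous_at_eps_delta using zero_less_one by blast
  obtain d\<^sub>2 where d\<^sub>2: "0 < d\<^sub>2" "\<And>x. dist x 0 < d\<^sub>2 \<Longrightarrow> dist (u x) (u 0) < norm (u 0)"
    using \<open>isCont u 0\<close> \<open>u 0 \<noteq> 0\<close> unfolding continuous_at_eps_delta by (meson zero_less_norm_iff)
  define R\<^sub>0 where "R\<^sub>0 = min (r / 4) (min d\<^sub>1 d\<^sub>2)"
  have "0 < R\<^sub>0" using \<open>0 < r\<close> d\<^sub>1(1) d\<^sub>2(1) by (simp add: R\<^sub>0_def)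
  have b_le: "norm (b x) \<le> norm (b 0) + 1" if "x \<in> ball 0 R\<^sub>0" for x
    using d\<^sub>1(2)[of x] that norm_triangle_sub[of "b x" "b 0"] by (simp add: R\<^sub>0_def dist_norm)
  have u_nz: "u x \<noteq> 0" if "x \<in> ball 0 R\<^sub>0" for x
    using d\<^sub>2(2)[of x] that by (auto simp: R\<^sub>0_def)

  \<comment> \<open>Division by \<open>u(0)\<close> turns the matrices \<open>\<mu> - n u(0)\<close> into \<open>\<nu> - n\<close>.\<close>
  define \<nu> where "\<nu> = (\<chi> i j. \<mu> $ i $ j / u 0)"
  have \<nu>: "\<nu> *v w = (1 / u 0) *s (\<mu> *v w)" for w
    by (simp add: \<nu>_def vec_eq_iff matrix_vector_mult_def sum_distrib_left)
  have "invertible (mat (of_nat n) - \<nu>)" for n :: nat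
    unfolding invertible_iff_trivial_kernel
  proof (intro allI impI)
    fix z assume z: "(mat (of_nat n) - \<nu>) *v z = 0"
    have "(\<mu> - mat (of_nat n * u 0)) *v z = (- u 0) *s ((mat (of_nat n) - \<nu>) *v z)"
      using \<open>u 0 \<noteq> 0\<close>
      by (simp add: matrix_vector_mult_diff_rdistrib mat_vector_mult \<nu> vec_eq_iff algebra_simps)
    then have "(\<mu> - mat (of_nat n * u 0)) *v z = 0" by (simp add: z)
    then show "z = 0"
      using assms(12)[of n] unfolding invertible_iff_trivial_kernel u_def by blast
  qed
  then obtain \<kappa> where "nonresonant \<nu> \<kappa>" using nonresonant_exists by blast
  then interpret nonresonant \<nu> \<kappa> .

  obtain D where D: "(F has_derivative D) (at (0, 0))" "\<And>c v w. D (c *s v, c *s w) = c *s D (v, w)"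
    using assms(6,7) unfolding holomorphic_map_on_def by blast
  have D\<mu>: "D (0, w) = \<mu> *v w" for w
    using derivative_snd_eq_jacobian[OF D] assms(9) by simp
  have "open U" using assms(7) by (simp add: holomorphic_map_on_def)
  \<comment> \<open>A bound \<open>e \<rho>\<close> of the nonlinearity for \<open>|v| < 2 \<rho>\<close> gives the Lipschitz constant \<open>2 N e\<close> for
    \<open>|v| \<le> \<rho>\<close>, which has to be below \<open>\<epsilon>\<^sub>0\<close>.\<close>
  define e where "e = \<epsilon>\<^sub>0 / (4 * real CARD('n))"
  have card: "1 \<le> real CARD('n)" using zero_less_card_finite[where 'a = 'n] by linarith
  have "0 < e" using \<epsilon>\<^sub>0(1) card by (simp add: e_def)
  have "\<epsilon>\<^sub>0 / (4 * real CARD('n)) \<le> \<epsilon>\<^sub>0 / 1"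
    by (rule divide_left_mono) (use card \<epsilon>\<^sub>0(1) in \<open>linarith | simp\<close>)+
  then have "e \<le> \<epsilon>\<^sub>0" by (simp add: e_def)
  obtain \<rho> R where "0 < \<rho>" "0 < R" "R \<le> R\<^sub>0" and
    FU: "\<And>x v. norm x < R \<Longrightarrow> norm v < 2 * \<rho> \<Longrightarrow> (x, v) \<in> U" and
    FH: "\<And>x v. norm x < R \<Longrightarrow> norm v < 2 * \<rho> \<Longrightarrow> norm ((1 / u x) *s F (x, v) - \<nu> *v v) \<le> e * \<rho>"
    using small_nonlinearity[OF D(1) assms(8) \<open>isCont u 0\<close> \<open>u 0 \<noteq> 0\<close> \<open>open U\<close> assms(6) \<open>0 < e\<close> \<open>0 < R\<^sub>0\<close>]
    unfolding D\<mu> \<nu>[symmetric] by blast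
  have R4: "ball 0 R \<subseteq> ball (0 :: complex ^ 'd) (r / 4)" and RR: "ball 0 R \<subseteq> ball (0 :: complex ^ 'd) R\<^sub>0"
    using \<open>R \<le> R\<^sub>0\<close> by (auto simp: R\<^sub>0_def)
  have R2: "ball 0 R \<subseteq> ball (0 :: complex ^ 'd) (r / 2)"
    using R4 \<open>0 < r\<close> by force
  define G where "G x v = (1 / u x) *s F (x, v)" for x v
  have u_inv_hol: "(\<lambda>t. 1 / u (\<gamma> t)) holomorphic_on V"
    if V: "open V" "vec_holomorphic \<gamma> V" "\<gamma> ` V \<subseteq> ball 0 R" for V \<gamma>
  proof -
    have "\<gamma> t \<in> ball 0 R\<^sub>0" if "t \<in> V" for t using V(3) RR that by blast
    then show ?thesis
      by (intro holomorphic_on_divide holomorphic_on_const u_hol V(1,2) order_trans[OF V(3) R4] u_nz)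
  qed
  interpret transversal_system b "ms_eval P" R "norm (b 0) + 1" \<nu> \<kappa> G \<rho>
  proof
    show "0 < R" "0 < \<rho>" by fact+
    show "curve_holomorphic_on b (ball 0 R)"
      unfolding curve_holomorphic_on_def
    proof (intro allI impI)
      fix V and \<gamma> :: "complex \<Rightarrow> complex ^ 'd"
      assume V: "open V" "vec_holomorphic \<gamma> V" "\<gamma> ` V \<subseteq> ball 0 R"
      have "(\<lambda>t. ms_eval (a j) (\<gamma> t) * (1 / u (\<gamma> t))) holomorphic_on V" for j
        by (intro holomorphic_on_mult u_inv_hol V
            ms_eval_holomorphic[OF \<open>0 < r\<close> a_le[of j] V(1,2) order_trans[OF V(3) R2]])
      then show "vec_holomorphic (\<lambda>t. b (\<gamma> t)) V"
        by (simp add: vec_holomorphic_def b_def)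
    qed
    show "norm (b x) \<le> norm (b 0) + 1" if "x \<in> ball 0 R" for x
      using that RR by (intro b_le) blast
    show "(\<lambda>t. ms_eval P (\<gamma> t)) holomorphic_on V"
      if V: "open V" "vec_holomorphic \<gamma> V" "\<gamma> ` V \<subseteq> ball 0 R" for V \<gamma>
      by (rule ms_eval_holomorphic[OF \<open>0 < r\<close> P_le V(1,2) order_trans[OF V(3) R2]])
    show "deriv (\<lambda>t. ms_eval P (\<gamma> t)) t = 1"
      if V: "open V" "vec_holomorphic \<gamma> V" "\<gamma> ` V \<subseteq> ball 0 R" "t \<in> V" "vec_deriv \<gamma> t = b (\<gamma> t)" for V \<gamma> t
    proof -
      have t: "\<gamma> t \<in> ball 0 R" using V(3,4) by auto
      have "\<gamma> t \<in> ball 0 (r / 2)" using t R2 by blast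
      then have "norm (\<gamma> t) < r / 2" by simp
      have "((\<lambda>t. ms_eval P (\<gamma> t)) has_field_derivative ms_eval (vfield a P) (\<gamma> t) / u (\<gamma> t)) (at t)"
        by (rule ms_eval_deriv_along_field[OF \<open>0 < r\<close> P_le a_le V(1,2,4) \<open>norm (\<gamma> t) < r / 2\<close>])
           (simp add: V(5) b_def)
      moreover have "u (\<gamma> t) \<noteq> 0" using t RR by (intro u_nz) blast
      ultimately show ?thesis by (simp add: u_def DERIV_imp_deriv)
    qed
    show "\<exists>d>0. \<forall>x\<in>ball 0 d. norm (ms_eval P x) < \<eta>" if \<eta>: "0 < \<eta>" for \<eta>
    proof -
      have "isCont (ms_eval P) 0"
        using cont4(2) mem0 by (simp add: continuous_on_eq_continuous_at)
      then obtain d where "0 < d" "\<And>x. dist x 0 < d \<Longrightarrow> dist (ms_eval P x) (ms_eval P 0) < \<eta>"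
        using \<eta> unfolding continuous_at_eps_delta by blast
      then show ?thesis using assms(3) by (intro exI[of _ d]) auto
    qed
    show "vec_holomorphic (\<lambda>t. G (\<gamma> t) (v t)) V"
      if V: "open V" "vec_holomorphic \<gamma> V" "\<gamma> ` V \<subseteq> ball 0 R" "vec_holomorphic v V"
        "\<And>t. t \<in> V \<Longrightarrow> norm (v t) \<le> \<rho>" for V \<gamma> v
    proof -
      have "(\<gamma> t, v t) \<in> U" if "t \<in> V" for t
        using V(3) V(5)[OF that] that \<open>0 < \<rho>\<close> by (intro FU) auto
      then show ?thesis
        unfolding G_def by (intro vec_holomorphic_smult u_inv_hol V holomorphic_map_on_curve[OF assms(7)])
    qed
    show "norm ((G x v - \<nu> *v v) - (G x v' - \<nu> *v v')) \<le> \<epsilon>\<^sub>0 * norm (v - v')"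
      if x: "x \<in> ball 0 R" and v: "norm v \<le> \<rho>" "norm v' \<le> \<rho>" for x v v'
    proof -
      have "curve_holomorphic_on (\<lambda>v. G x v - \<nu> *v v) (ball 0 (2 * \<rho>))"
        unfolding curve_holomorphic_on_def G_def using x
        by (intro allI impI vec_holomorphic_diff vec_holomorphic_smult vec_holomorphic_matrix
            holomorphic_on_const holomorphic_map_on_curve[OF assms(7)] vec_holomorphic_const FU) auto
      moreover have "norm (G x v - \<nu> *v v) \<le> e * \<rho>" if "v \<in> ball 0 (2 * \<rho>)" for v
        using FH[of x v] x that by (simp add: G_def)
      ultimately have "norm ((G x v - \<nu> *v v) - (G x v' - \<nu> *v v'))
          \<le> real CARD('n) * (2 * (e * \<rho>) / \<rho>) * norm (v - v')"
        by (rule lipschitz_of_bounded_holomorphic[OF \<open>0 < \<rho>\<close> _ _ v])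
      also have "real CARD('n) * (2 * (e * \<rho>) / \<rho>) = \<epsilon>\<^sub>0 / 2"
        using \<open>0 < \<rho>\<close> card by (simp add: e_def)
      also have "\<epsilon>\<^sub>0 / 2 * norm (v - v') \<le> \<epsilon>\<^sub>0 * norm (v - v')"
        using \<epsilon>\<^sub>0(1) by (intro mult_right_mono) auto
      finally show ?thesis .
    qed
    show "norm (G x 0) \<le> \<epsilon>\<^sub>0 * \<rho>" if "x \<in> ball 0 R" for x
    proof -
      have "norm (G x 0) \<le> e * \<rho>" using FH[of x 0] that \<open>0 < \<rho>\<close> by (simp add: G_def)
      also have "\<dots> \<le> \<epsilon>\<^sub>0 * \<rho>"
        using \<open>e \<le> \<epsilon>\<^sub>0\<close> \<open>0 < \<rho>\<close> by (intro mult_right_mono) auto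
      finally show ?thesis .
    qed
    show "G 0 0 = 0" using assms(8) by (simp add: G_def)
  qed

  have existence: "\<exists>y. analytic_solution P a F y \<and> (\<forall>i. ms_eval (y $ i) 0 = 0)"
  proof -
    obtain \<delta> y where "0 < \<delta>" and y_le: "\<forall>x\<in>ball 0 \<delta>. norm (y x) \<le> \<rho>" and
      y_hol: "curve_holomorphic_on y (ball 0 \<delta>)" and y_0: "y 0 = 0" and
      eq: "\<forall>x\<in>ball 0 \<delta>. \<exists>e>0. \<exists>\<gamma>. vec_holomorphic \<gamma> (ball 0 e) \<and> \<gamma> ` ball 0 e \<subseteq> ball 0 \<delta> \<and> \<gamma> 0 = x \<and>
        vec_deriv \<gamma> 0 = b x \<and> ms_eval P x *s vec_deriv (\<lambda>t. y (\<gamma> t)) 0 = G x (y x)"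
      using existence by (elim exE conjE) (rule that)
    \<comment> \<open>The norm of a vector is at most the sum of the norms of its \<open>d\<close> components.\<close>
    define s where "s = \<delta> / real CARD('d)"
    have cardd: "0 < real CARD('d)" by simp
    have "0 < s" using \<open>0 < \<delta>\<close> cardd by (simp add: s_def)
    have poly: "x \<in> ball 0 \<delta>" if "\<And>i. norm (x $ i) < s" for x :: "complex ^ 'd"
    proof -
      have "(\<Sum>i\<in>UNIV. norm (x $ i)) < (\<Sum>i\<in>(UNIV :: 'd set). s)"
        by (intro sum_strict_mono that) auto
      then have "norm x < real CARD('d) * s" using norm_vec_le_sum[of x] by simp
      then show ?thesis using cardd by (simp add: s_def)
    qed
    have "\<exists>c\<in>conv_series. \<forall>x. (\<forall>i. norm (x $ i) < s) \<longrightarrow> ms_eval c x = y x $ k" for k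
    proof (rule separately_holomorphic_conv_series[OF \<open>0 < s\<close>])
      show "norm (y x $ k) \<le> \<rho>" if "\<And>i. norm (x $ i) < s" for x
        by (intro norm_component_le bspec[OF y_le] poly that)
      show "(\<lambda>\<zeta>. y (upd x j \<zeta>) $ k) holomorphic_on ball 0 s" if "\<And>i. norm (x $ i) < s" for x j
      proof -
        have "vec_holomorphic (\<lambda>\<zeta>. y (upd x j \<zeta>)) (ball 0 s)"
        proof (rule curve_holomorphic_onD[OF y_hol open_ball])
          show "vec_holomorphic (upd x j) (ball 0 s)"
            unfolding vec_holomorphic_def
          proof
            fix i show "(\<lambda>\<zeta>. upd x j \<zeta> $ i) holomorphic_on ball 0 s"
              by (cases "i = j") auto
          qed
          show "upd x j ` ball 0 s \<subseteq> ball 0 \<delta>"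
            using that by (intro image_subsetI poly) auto
        qed
        then show ?thesis by (simp add: vec_holomorphic_def)
      qed
    qed
    then obtain c where c: "\<And>k. c k \<in> conv_series"
      "\<And>k x. (\<And>i. norm (x $ i) < s) \<Longrightarrow> ms_eval (c k) x = y x $ k"
      by metis
    have cs: "ms_eval (c k) x = y x $ k" if "norm x < s" for k x
      by (rule c(2)) (rule norm_component_less[OF that])
    obtain r' C' where "0 < r'" and c_le: "\<And>k \<alpha>. norm (c k \<alpha>) * r' ^ mdeg \<alpha> \<le> C'"
      using conv_series_common_bound[of c, OF c(1)] by blast
    define r\<^sub>1 where "r\<^sub>1 = min r r'"
    have "0 < r\<^sub>1" using \<open>0 < r\<close> \<open>0 < r'\<close> by (simp add: r\<^sub>1_def)
    have c1: "norm (c k \<alpha>) * r\<^sub>1 ^ mdeg \<alpha> \<le> max C C'" and a1: "norm (a j \<alpha>) * r\<^sub>1 ^ mdeg \<alpha> \<le> max C C'" for k j \<alpha>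
      by (rule coeff_bound_mono[OF c_le \<open>0 < r\<^sub>1\<close>] coeff_bound_mono[OF a_le \<open>0 < r\<^sub>1\<close>]; simp add: r\<^sub>1_def)+
    define \<delta>' where "\<delta>' = min (min \<delta> s) (min R (r\<^sub>1 / 2))"
    have "0 < \<delta>'" using \<open>0 < \<delta>\<close> \<open>0 < s\<close> \<open>0 < R\<close> \<open>0 < r\<^sub>1\<close> by (simp add: \<delta>'_def)
    have sol: "ms_eval P x * ms_eval (vfield a (c k)) x = F (x, \<chi> k. ms_eval (c k) x) $ k"
      if x: "dist x 0 < \<delta>'" for x k
    proof -
      have x\<delta>: "x \<in> ball 0 \<delta>" and xs: "norm x < s" and xR: "x \<in> ball 0 R" and xr: "norm x < r\<^sub>1 / 2"
        using x by (auto simp: \<delta>'_def)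
      obtain e \<gamma> where "0 < e" and \<gamma>: "vec_holomorphic \<gamma> (ball 0 e)" "\<gamma> ` ball 0 e \<subseteq> ball 0 \<delta>" "\<gamma> 0 = x"
        "vec_deriv \<gamma> 0 = b x" "ms_eval P x *s vec_deriv (\<lambda>t. y (\<gamma> t)) 0 = G x (y x)"
        using bspec[OF eq x\<delta>] by (elim exE conjE) (rule that)
      have 0: "0 \<in> ball (0 :: complex) e" using \<open>0 < e\<close> by simp
      \<comment> \<open>The integral curve through \<open>x\<close> stays in the polydisc for small times only.\<close>
      define T where "T = ball 0 e \<inter> \<gamma> -` ball 0 s"
      have "open T"
        unfolding T_def by (rule continuous_open_preimage[OF vec_holomorphic_continuous[OF \<gamma>(1)] open_ball open_ball])
      have "0 \<in> T" using 0 xs \<gamma>(3) by (simp add: T_def)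
      have "((\<lambda>t. ms_eval (c k) (\<gamma> t)) has_field_derivative ms_eval (vfield a (c k)) (\<gamma> 0) / u x) (at 0)"
        by (rule ms_eval_deriv_along_field[OF \<open>0 < r\<^sub>1\<close> c1 a1 open_ball \<gamma>(1) 0])
           (use xr \<gamma>(3,4) in \<open>auto simp: b_def\<close>)
      then have "((\<lambda>t. y (\<gamma> t) $ k) has_field_derivative ms_eval (vfield a (c k)) x / u x) (at 0)"
        unfolding \<gamma>(3)
        by (rule has_field_derivative_transform_within_open[OF _ \<open>open T\<close> \<open>0 \<in> T\<close>]) (simp add: T_def cs)
      then have "vec_deriv (\<lambda>t. y (\<gamma> t)) 0 $ k = ms_eval (vfield a (c k)) x / u x"
        by (simp add: vec_deriv_def DERIV_imp_deriv)
      then have "ms_eval P x * (ms_eval (vfield a (c k)) x / u x) = G x (y x) $ k"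
        using \<gamma>(5) by (metis vector_smult_component)
      moreover have "u x \<noteq> 0" using xR RR by (intro u_nz) blast
      moreover have "(\<chi> k. ms_eval (c k) x) = y x" by (simp add: vec_eq_iff cs[OF xs])
      ultimately show ?thesis by (simp add: G_def field_simps)
    qed
    have "analytic_solution P a F (\<chi> k. c k)"
      unfolding analytic_solution_def eventually_nhds_metric
      using c(1) \<open>0 < \<delta>'\<close> sol by auto
    moreover have "ms_eval (c i) 0 = 0" for i
      using cs[of 0 i] \<open>0 < s\<close> y_0 by simp
    ultimately show ?thesis by (intro exI[of _ "\<chi> k. c k"]) simp
  qed

  have uniqueness: "y1 = y2"
    if y1: "analytic_solution P a F y1" "\<And>i. ms_eval (y1 $ i) 0 = 0"
      and y2: "analytic_solution P a F y2" "\<And>i. ms_eval (y2 $ i) 0 = 0" for y1 y2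
  proof -
    \<comment> \<open>Indexing the two solutions by truth values treats them simultaneously.\<close>
    define y where "y k = (if k then y1 else y2)" for k
    have conv: "y k $ i \<in> conv_series" for k i
      using y1(1) y2(1) by (simp add: y_def analytic_solution_def)
    define Y where "Y k x = (\<chi> i. ms_eval (y k $ i) x)" for k x
    obtain r' C' where "0 < r'" and y_le: "\<And>k i \<alpha>. norm ((y k $ i) \<alpha>) * r' ^ mdeg \<alpha> \<le> C'"
      using conv_series_common_bound[of "\<lambda>(k, i). y k $ i"] conv by (auto simp: split_beta)
    define r\<^sub>1 where "r\<^sub>1 = min r r'"
    have "0 < r\<^sub>1" using \<open>0 < r\<close> \<open>0 < r'\<close> by (simp add: r\<^sub>1_def)
    have c1: "norm ((y k $ i) \<alpha>) * r\<^sub>1 ^ mdeg \<alpha> \<le> max C C'" and a1: "norm (a j \<alpha>) * r\<^sub>1 ^ mdeg \<alpha> \<le> max C C'" for k i j \<alpha>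
      by (rule coeff_bound_mono[OF y_le \<open>0 < r\<^sub>1\<close>] coeff_bound_mono[OF a_le \<open>0 < r\<^sub>1\<close>]; simp add: r\<^sub>1_def)+
    have "Y k 0 = 0" for k
      using y1(2) y2(2) by (simp add: Y_def y_def vec_eq_iff)
    have "\<exists>d>0. \<forall>x. dist x 0 < d \<longrightarrow> norm (Y k x) \<le> \<rho> \<and>
      (\<forall>i. ms_eval P x * ms_eval (vfield a (y k $ i)) x = F (x, Y k x) $ i)" for k
    proof -
      have "isCont (ms_eval (y k $ i)) 0" for i
        using continuous_on_ms_eval[OF \<open>0 < r\<^sub>1\<close> c1] \<open>0 < r\<^sub>1\<close> by (simp add: continuous_on_eq_continuous_at)
      then have "isCont (Y k) 0"
        unfolding Y_def[abs_def] isCont_def by (intro tendsto_vec_lambda)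
      then obtain d where d: "0 < d" "\<And>x. dist x 0 < d \<Longrightarrow> dist (Y k x) (Y k 0) < \<rho>"
        using \<open>0 < \<rho>\<close> unfolding continuous_at_eps_delta by blast
      have "analytic_solution P a F (y k)" using y1(1) y2(1) by (simp add: y_def)
      then obtain d' where d': "0 < d'" "\<And>x. dist x 0 < d' \<Longrightarrow>
          (\<forall>i. ms_eval P x * ms_eval (vfield a (y k $ i)) x = F (x, Y k x) $ i)"
        unfolding analytic_solution_def eventually_nhds_metric Y_def by blast
      show ?thesis
        using d(1) d'(1) d(2) d'(2) \<open>Y k 0 = 0\<close>
        by (intro exI[of _ "min d d'"]) (auto simp: less_imp_le)
    qed
    then obtain d where d: "\<And>k. 0 < d k" "\<And>k x. dist x 0 < d k \<Longrightarrow> norm (Y k x) \<le> \<rho>"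
      "\<And>k x i. dist x 0 < d k \<Longrightarrow> ms_eval P x * ms_eval (vfield a (y k $ i)) x = F (x, Y k x) $ i"
      by metis
    define \<delta>\<^sub>1 where "\<delta>\<^sub>1 = min (min (d True) (d False)) (min R (r\<^sub>1 / 2))"
    have "0 < \<delta>\<^sub>1" "\<delta>\<^sub>1 \<le> R" using d(1) \<open>0 < R\<close> \<open>0 < r\<^sub>1\<close> by (auto simp: \<delta>\<^sub>1_def)
    have in_d: "dist x 0 < d k" if "x \<in> ball 0 \<delta>\<^sub>1" for x k
      using that by (cases k) (auto simp: \<delta>\<^sub>1_def dist_commute)
    have "\<exists>\<delta>>0. \<forall>x\<in>ball 0 \<delta>. Y True x = Y False x"
    proof (rule uniqueness[OF \<open>0 < \<delta>\<^sub>1\<close> \<open>\<delta>\<^sub>1 \<le> R\<close>])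
      show "curve_holomorphic_on (Y k) (ball 0 \<delta>\<^sub>1)" for k
        unfolding curve_holomorphic_on_def
      proof (intro allI impI)
        fix V and \<gamma> :: "complex \<Rightarrow> complex ^ 'd"
        assume V: "open V" "vec_holomorphic \<gamma> V" "\<gamma> ` V \<subseteq> ball 0 \<delta>\<^sub>1"
        have "\<gamma> ` V \<subseteq> ball 0 (r\<^sub>1 / 2)" using V(3) by (auto simp: \<delta>\<^sub>1_def)
        then show "vec_holomorphic (\<lambda>t. Y k (\<gamma> t)) V"
          unfolding vec_holomorphic_def Y_def
          using ms_eval_holomorphic[OF \<open>0 < r\<^sub>1\<close> c1 V(1,2)] by simp
      qed
      show "norm (Y k x) \<le> \<rho>" if "x \<in> ball 0 \<delta>\<^sub>1" for k x
        by (rule d(2)[OF in_d[OF that]])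
      show "ms_eval P (\<gamma> t) *s vec_deriv (\<lambda>t. Y k (\<gamma> t)) t = G (\<gamma> t) (Y k (\<gamma> t))"
        if V: "open V" "vec_holomorphic \<gamma> V" "\<gamma> ` V \<subseteq> ball 0 \<delta>\<^sub>1" "t \<in> V" "vec_deriv \<gamma> t = b (\<gamma> t)" for k V \<gamma> t
      proof -
        have t: "\<gamma> t \<in> ball 0 \<delta>\<^sub>1" using V(3,4) by auto
        then have tr: "norm (\<gamma> t) < r\<^sub>1 / 2" by (simp add: \<delta>\<^sub>1_def)
        have "((\<lambda>t. ms_eval (y k $ i) (\<gamma> t)) has_field_derivative ms_eval (vfield a (y k $ i)) (\<gamma> t) / u (\<gamma> t)) (at t)" for i
          by (rule ms_eval_deriv_along_field[OF \<open>0 < r\<^sub>1\<close> c1 a1 V(1,2,4) tr]) (simp add: V(5) b_def)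
        then have "vec_deriv (\<lambda>t. Y k (\<gamma> t)) t = (\<chi> i. ms_eval (vfield a (y k $ i)) (\<gamma> t) / u (\<gamma> t))"
          by (intro vec_derivI) (simp add: Y_def)
        then show ?thesis
          using d(3)[OF in_d[OF t], of k] by (simp add: G_def vec_eq_iff)
      qed
    qed
    then obtain \<delta> where "0 < \<delta>" "\<And>x. x \<in> ball 0 \<delta> \<Longrightarrow> Y True x = Y False x" by blast
    then have "y1 $ i = y2 $ i" for i
      using conv[of True i] conv[of False i]
      by (intro conv_series_eqI[of _ _ \<delta>]) (auto simp: Y_def y_def vec_eq_iff)
    then show ?thesis by (simp add: vec_eq_iff)
  qed
  show ?thesis
    using existence uniqueness by (intro ex_ex1I) auto
qed

end
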